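(* Let $X\in GL_n(\mathbb{R}[t,t^{-1}])$. Then $X$ is equal to $X(N)$ for some cylindric network $N$ with nonnegative weight function if and only if $X\in GL_n(\mathbb{R}[t,t^{-1}])_{\ge 0}$, i.e. if and only if $X$ is totally nonnegative.
   Context: Fix $n\ge 1$. $GL_n(\mathbb{R}[t,t^{-1}])$ is the group of $n\times n$ matrices with real Laurent polynomial entries whose determinant is a non-zero monomial. To $A(t)=(a_{ij}(t))_{i,j=1}^n$ one associates its unfolding: the doubly infinite real matrix $X=(x_{i,j})_{i,j\in\mathbb{Z}}$ with $x_{i+n,j+n}=x_{i,j}$ and $a_{ij}(t)=\sum_{k\in\mathbb{Z}}x_{i,j+kn}t^k$ for $1\le i,j\le n$; $A(t)$ is identified with $X$. $X$ is totally nonnegative if every finite minor of the infinite matrix $X$ is nonnegative. For $i\in\mathbb{Z}$, $\bar i\in\{1,\dots,n\}$ is the representative of $i$ modulo $n$, and $\alpha(i)=(i-\bar i)/n$. A cylindric network $N=(G,w,\mathfrak h)$ consists of: a finite acyclic oriented graph $G$ embedded in the cylinder $S^1\times[0,1]$, having $n$ sources $v_1,\dots,v_n$ on one boundary circle (the bottom) and $n$ sinks $w_1,\dots,w_n$ on the other boundary circle (the top), sources and sinks each numbered in counterclockwise order (viewed from above); a weight function $w$ assigning to each edge a nonnegative real number; and a chord $\mathfrak h$, a single arc connecting the two boundary circles, starting on the boundary arc from $v_n$ to $v_1$ and ending on the boundary arc from $w_n$ to $w_1$, chosen so that no vertex of $G$ lies on it. The weight $w(p)$ of a (directed) path $p$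 is the product of the weights of its edges. The rotor $\mathrm{rot}(p)$ is the number of times $p$ crosses $\mathfrak h$ counterclockwise minus the number of times it crosses $\mathfrak h$ clockwise. For $i,j\in\mathbb{Z}$, an $(i,j)$-path is a path in $G$ from $v_{\bar i}$ to $w_{\bar j}$ with rotor $\alpha(j)-\alpha(i)$. The matrix $X(N)=(x_{i,j})_{i,j\in\mathbb{Z}}$ has $x_{i,j}$ equal to the sum of $w(p)$ over all $(i,j)$-paths $p$; it satisfies $x_{i+n,j+n}=x_{i,j}$. *)

theory Defs
  imports
    "HOL-Analysis.Path_Connected"
    "HOL-Computational_Algebra.Formal_Laurent_Series"
    "Jordan_Normal_Form.Determinant"
    "Graph_Theory.Arc_Walk"
begin

section \<open>Laurent polynomial matrices and their unfoldings\<close>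

definition laurent_poly :: "real fls \<Rightarrow> bool" where
  "laurent_poly f \<longleftrightarrow> finite {k. fls_nth f k \<noteq> 0}"

definition GL_laurent :: "nat \<Rightarrow> real fls mat set" where
  "GL_laurent n = {A \<in> carrier_mat n n.
     (\<forall>i<n. \<forall>j<n. laurent_poly (A $$ (i, j))) \<and>
     (\<exists>c k. c \<noteq> 0 \<and> Determinant.det A = fls_const c * fls_X_intpow k)}"

text \<open>\<open>res n i\<close> is the representative of \<open>i\<close> modulo \<open>n\<close> in \<open>{1..n}\<close>, not in \<open>{0..<n}\<close>.\<close>

definition res :: "nat \<Rightarrow> int \<Rightarrow> int" where
  "res n i = (i - 1) mod int n + 1"

definition alpha :: "nat \<Rightarrow> int \<Rightarrow> int" where
  "alpha n i = (i - res n i) div int n"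

text \<open>
  Doubly infinite matrices are functions \<open>int \<Rightarrow> int \<Rightarrow> real\<close>.  Entries of type \<open>mat\<close> are numbered
  from 0, which accounts for the shift by 1.  The lemmas \<open>unfold_mat_coeff\<close> and
  \<open>unfold_mat_periodic\<close> below are the two conditions that determine the unfolding.
\<close>

definition unfold_mat :: "nat \<Rightarrow> real fls mat \<Rightarrow> int \<Rightarrow> int \<Rightarrow> real" where
  "unfold_mat n A i j =
     fls_nth (A $$ (nat (res n i - 1), nat (res n j - 1))) (alpha n j - alpha n i)"

lemma res_add: "res n (i + int n * k) = res n i"
  unfolding res_def by (metis add_diff_eq add.commute mod_mult_self2)

lemma alpha_eq: "n \<ge> 1 \<Longrightarrow> i = res n i + int n * alpha n i"
proof -
  assume "n \<ge> 1"
  have "i - res n i = int n * ((i - 1) div int n)"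
    unfolding res_def using div_mult_mod_eq[of "i - 1" "int n"] by (simp add: algebra_simps)
  then show ?thesis using \<open>n \<ge> 1\<close> unfolding alpha_def by simp
qed

lemma alpha_add: "n \<ge> 1 \<Longrightarrow> alpha n (i + int n * k) = alpha n i + k"
  unfolding alpha_def res_add by (simp add: diff_add_eq[symmetric])

lemma res_id: "1 \<le> i \<Longrightarrow> i \<le> int n \<Longrightarrow> res n i = i"
  by (simp add: res_def)

lemma unfold_mat_periodic:
  "n \<ge> 1 \<Longrightarrow> unfold_mat n A (i + int n) (j + int n) = unfold_mat n A i j"
  using res_add[of n _ 1] alpha_add[of n _ 1] by (simp add: unfold_mat_def)

lemma unfold_mat_coeff:
  assumes "i \<in> {1..n}" "j \<in> {1..n}"
  shows "unfold_mat n A (int i) (int j + k * int n) = fls_nth (A $$ (i - 1, j - 1)) k"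
proof -
  have "res n (int j + k * int n) = int j" "alpha n (int j + k * int n) = k"
    using assms res_add[of n "int j" k] alpha_add[of n "int j" k] res_id[of "int j" n]
    by (simp_all add: mult.commute alpha_def)
  moreover have "res n (int i) = int i" "alpha n (int i) = 0"
    using assms res_id[of "int i" n] by (simp_all add: alpha_def)
  moreover have "nat (int i - 1) = i - 1" "nat (int j - 1) = j - 1" by simp_all
  ultimately show ?thesis unfolding unfold_mat_def by (simp only: diff_zero)
qed

definition totally_nonneg :: "(int \<Rightarrow> int \<Rightarrow> real) \<Rightarrow> bool" where
  "totally_nonneg X \<longleftrightarrow>
     (\<forall>m (I :: nat \<Rightarrow> int) (J :: nat \<Rightarrow> int).
        strict_mono_on {..<m} I \<longrightarrow> strict_mono_on {..<m} J \<longrightarrow>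
        Determinant.det (Matrix.mat m m (\<lambda>(a, b). X (I a) (J b))) \<ge> 0)"


section \<open>The cylinder and crossings of a chord\<close>

type_synonym cyl_point = "complex \<times> real"

definition cylinder :: "cyl_point set" where
  "cylinder = sphere 0 1 \<times> {0..1}"

text \<open>
  The universal cover of the cylinder is the horizontal strip below; the positive real direction
  covers the counterclockwise direction of the circle.
\<close>

definition strip :: "complex set" where
  "strip = {z. 0 \<le> Im z \<and> Im z \<le> 1}"

definition cyl_cover :: "complex \<Rightarrow> cyl_point" where
  "cyl_cover z = (cis (2 * pi * Re z), Im z)"

definition is_lift :: "(real \<Rightarrow> complex) \<Rightarrow> (real \<Rightarrow> cyl_point) \<Rightarrow> bool" where
  "is_lift g c \<longleftrightarrow> path g \<and> path_image g \<subseteq> strip \<and> (\<forall>s\<in>{0..1}. cyl_cover (g s) = c s)"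

text \<open>
  A lifted chord \<open>H\<close> joins the bottom line of the strip to the top line and cuts the strip into the
  part that extends infinitely far to the left and the part that extends infinitely far to
  the right.
\<close>

definition west_of :: "(real \<Rightarrow> complex) \<Rightarrow> complex set" where
  "west_of H = {z \<in> strip - path_image H.
     \<forall>M. \<exists>z' \<in> connected_component_set (strip - path_image H) z. Re z' < M}"

definition east_of :: "(real \<Rightarrow> complex) \<Rightarrow> complex set" where
  "east_of H = {z \<in> strip - path_image H.
     \<forall>M. \<exists>z' \<in> connected_component_set (strip - path_image H) z. Re z' > M}"

text \<open>
  The two sides of a chord \<open>h\<close> near one of its points are told apart in the universal cover: the
  curve \<open>c\<close> crosses \<open>h\<close> counterclockwise at time \<open>s\<close> if it is on the west side of the lift of \<open>h\<close>
  through the point in question just before \<open>s\<close>, and on the east side just after \<open>s\<close>.  Touching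
  \<open>h\<close> without changing sides is no crossing.
\<close>

definition crosses_ccw :: "(real \<Rightarrow> cyl_point) \<Rightarrow> (real \<Rightarrow> cyl_point) \<Rightarrow> real \<Rightarrow> bool" where
  "crosses_ccw h c s \<longleftrightarrow> s \<in> {0<..<1} \<and>
     (\<exists>H g. is_lift H h \<and> is_lift g c \<and> g s \<in> path_image H \<and>
        (\<forall>\<^sub>F u in at_left s. g u \<in> west_of H) \<and> (\<forall>\<^sub>F u in at_right s. g u \<in> east_of H))"

definition crosses_cw :: "(real \<Rightarrow> cyl_point) \<Rightarrow> (real \<Rightarrow> cyl_point) \<Rightarrow> real \<Rightarrow> bool" where
  "crosses_cw h c s \<longleftrightarrow> s \<in> {0<..<1} \<and>
     (\<exists>H g. is_lift H h \<and> is_lift g c \<and> g s \<in> path_image H \<and>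
        (\<forall>\<^sub>F u in at_left s. g u \<in> east_of H) \<and> (\<forall>\<^sub>F u in at_right s. g u \<in> west_of H))"

text \<open>
  The points \<open>p 0, \<dots>, p n\<close> are pairwise distinct and occur in this counterclockwise order on the
  circle at height \<open>y\<close>.
\<close>

definition ccw_ordered :: "nat \<Rightarrow> real \<Rightarrow> (nat \<Rightarrow> cyl_point) \<Rightarrow> bool" where
  "ccw_ordered n y p \<longleftrightarrow>
     (\<exists>\<theta> :: nat \<Rightarrow> real. strict_mono_on {0..n} \<theta> \<and> \<theta> n < \<theta> 0 + 1 \<and>
        (\<forall>k\<in>{0..n}. p k = cyl_cover (Complex (\<theta> k) y)))"


section \<open>Cylindric networks\<close>

text \<open>
  An embedded directed graph is given by its set of vertices, which are points of the cylinder, and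
  its set of edges, which are arcs directed from \<open>pathstart\<close> to \<open>pathfinish\<close>.  Parallel
  edges are distinct arcs.
\<close>

record cyl_network =
  vertices :: "cyl_point set"
  edges :: "(real \<Rightarrow> cyl_point) set"
  source :: "nat \<Rightarrow> cyl_point"
  sink :: "nat \<Rightarrow> cyl_point"
  weight :: "(real \<Rightarrow> cyl_point) \<Rightarrow> real"
  chord :: "real \<Rightarrow> cyl_point"

definition net_graph :: "cyl_network \<Rightarrow> (cyl_point, real \<Rightarrow> cyl_point) pre_digraph" where
  "net_graph N = \<lparr>verts = vertices N, arcs = edges N, tail = pathstart, head = pathfinish\<rparr>"

definition embedded_in_cylinder :: "cyl_point set \<Rightarrow> (real \<Rightarrow> cyl_point) set \<Rightarrow> bool" where
  "embedded_in_cylinder V E \<longleftrightarrow>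
     V \<subseteq> cylinder \<and>
     (\<forall>e\<in>E. arc e \<and> path_image e \<subseteq> cylinder \<and> e ` {0<..<1} \<inter> V = {}) \<and>
     (\<forall>e\<in>E. \<forall>f\<in>E. e \<noteq> f \<longrightarrow> e ` {0<..<1} \<inter> f ` {0<..<1} = {})"

text \<open>
  The two \<open>ccw_ordered\<close> conditions place the initial and final points of the chord, inserted at
  index 0, on the boundary arcs from \<open>source N n\<close> to \<open>source N 1\<close> and from \<open>sink N n\<close> to
  \<open>sink N 1\<close>.  Since edges are merely topological arcs, each of them is required to meet the chord
  finitely often, so that the crossings can be counted.
\<close>

definition cylindric_network :: "nat \<Rightarrow> cyl_network \<Rightarrow> bool" where
  "cylindric_network n N \<longleftrightarrow>
     fin_digraph (net_graph N) \<and>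
     (\<nexists>p. pre_digraph.cycle (net_graph N) p) \<and>
     embedded_in_cylinder (vertices N) (edges N) \<and>
     (\<forall>k\<in>{1..n}. source N k \<in> vertices N \<and> in_degree (net_graph N) (source N k) = 0) \<and>
     (\<forall>k\<in>{1..n}. sink N k \<in> vertices N \<and> out_degree (net_graph N) (sink N k) = 0) \<and>
     ccw_ordered n 0 (\<lambda>k. if k = 0 then pathstart (chord N) else source N k) \<and>
     ccw_ordered n 1 (\<lambda>k. if k = 0 then pathfinish (chord N) else sink N k) \<and>
     (\<forall>e\<in>edges N. weight N e \<ge> 0) \<and>
     arc (chord N) \<and>
     chord N ` {0<..<1} \<subseteq> sphere 0 1 \<times> {0<..<1} \<and>
     path_image (chord N) \<inter> vertices N = {} \<and>
     (\<forall>e\<in>edges N. finite (path_image e \<inter> path_image (chord N)))"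

text \<open>
  No vertex lies on the chord, so every crossing of a path in the graph takes place in the
  interior of one of its edges.
\<close>

definition rot :: "cyl_network \<Rightarrow> (real \<Rightarrow> cyl_point) list \<Rightarrow> int" where
  "rot N p = (\<Sum>e\<leftarrow>p. int (card {s. crosses_ccw (chord N) e s})
                   - int (card {s. crosses_cw (chord N) e s}))"

definition ij_paths ::
  "nat \<Rightarrow> cyl_network \<Rightarrow> int \<Rightarrow> int \<Rightarrow> (real \<Rightarrow> cyl_point) list set" where
  "ij_paths n N i j =
     {p. pre_digraph.awalk (net_graph N) (source N (nat (res n i))) p (sink N (nat (res n j))) \<and>
         rot N p = alpha n j - alpha n i}"

definition network_matrix :: "nat \<Rightarrow> cyl_network \<Rightarrow> int \<Rightarrow> int \<Rightarrow> real" where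
  "network_matrix n N i j = (\<Sum>p\<in>ij_paths n N i j. \<Prod>e\<leftarrow>p. weight N e)"

text \<open>The sum above is finite, and so are the sets of crossing times counted by \<open>rot\<close>.\<close>

lemma finite_ij_paths:
  assumes "cylindric_network n N"
  shows "finite (ij_paths n N i j)"
proof -
  interpret fin_digraph "net_graph N" using assms by (simp add: cylindric_network_def)
  have ac: "\<not> cycle p" for p using assms by (simp add: cylindric_network_def)
  have ap: "apath u p v" if "awalk u p v" for u p v
  proof (rule ccontr)
    assume "\<not> apath u p v"
    with that have "\<not> distinct (awalk_verts u p)" by (simp add: apath_def)
    with that obtain r where "closed_w r"
      using awalk_cyc_decompE'[of u p v] by metis
    then show False using closed_w_imp_cycle ac by blast
  qed
  have "ij_paths n N i j \<subseteq>
      {p. apath (source N (nat (res n i))) p (sink N (nat (res n j)))}"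
    unfolding ij_paths_def using ap by blast
  then show ?thesis using apaths_finite finite_subset by blast
qed

lemma finite_crossings:
  assumes "cylindric_network n N" "e \<in> edges N"
  shows "finite {s. crosses_ccw (chord N) e s}" "finite {s. crosses_cw (chord N) e s}"
proof -
  let ?T = "{s \<in> {0..1}. e s \<in> path_image e \<inter> path_image (chord N)}"
  have "arc e" "finite (path_image e \<inter> path_image (chord N))"
    using assms by (auto simp: cylindric_network_def embedded_in_cylinder_def)
  then have fin: "finite ?T"
    using finite_vimage_IntI[of "path_image e \<inter> path_image (chord N)" e "{0..1}"]
    by (auto simp: arc_def vimage_def Int_def conj_commute)
  have "e s \<in> path_image (chord N)"
    if "is_lift H (chord N)" "is_lift g e" "g s \<in> path_image H" "s \<in> {0..1}" for H g s
    using that by (force simp: is_lift_def path_image_def)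
  then have "{s. crosses_ccw (chord N) e s} \<subseteq> ?T" "{s. crosses_cw (chord N) e s} \<subseteq> ?T"
    unfolding crosses_ccw_def crosses_cw_def by (fastforce simp: path_image_def)+
  then show "finite {s. crosses_ccw (chord N) e s}" "finite {s. crosses_cw (chord N) e s}"
    using fin finite_subset by blast+
qed

end

theory Submission
  imports Defs "HOL-Analysis.Fashoda_Theorem" "HOL-Analysis.Smooth_Paths" "HOL-Analysis.Further_Topology"
begin

text \<open>
  Both directions pass through the universal cover of the cylinder, the strip
  \<open>{z. 0 \<le> Im z \<le> 1}\<close> on which the integers act by horizontal translation.

  From networks to total nonnegativity. A lift \<open>H\<close> of the chord cuts the strip into an east side
  and a west side, and so does each translate \<open>H + k\<close>. Counting the translates that have a
  point on their east side numbers the sheets of the cover, and the counterclockwise minus the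
  clockwise crossings of a curve with the chord are the increase of this number along a lift of the
  curve (\<open>rotor_eq_sheet_difference\<close>). Hence an \<open>(i,j)\<close>-path is the same as a path in the lifted
  graph from the \<open>i\<close>-th lifted source to the \<open>j\<close>-th lifted sink, and these lie on the
  two boundary lines in the order of \<open>i\<close> and \<open>j\<close>. Two lifted paths that connect their ends in the
  wrong order meet (\<open>paths_across_strip_meet\<close>), and because the graph is embedded they then
  have a vertex in common. This is the hypothesis of the lemma of Lindstroem, Gessel and Viennot in the form
  \<open>path_det_nonneg\<close>: a determinant of path sums is nonnegative if vertex-disjoint families of
  paths only ever realise the identity permutation. Instead of a sign-reversing involution, the
  proof moves one starting point at a time along its outgoing edges, expanding the determinant in
  the corresponding row.

  From total nonnegativity to networks. The unfolding \<open>X\<close> of a matrix of \<open>GL_n\<close> over the Laurent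
  polynomials is periodic, banded, and has a banded inverse. Its rightmost nonzero column in row \<open>i\<close>
  is a nondecreasing function of \<open>i\<close>; if rows \<open>i\<close> and \<open>i + 1\<close> end in the same column and
  row \<open>i - 1\<close> ends further left, then subtracting a multiple of row \<open>i + 1\<close> from row \<open>i\<close>,
  simultaneously modulo \<open>n\<close>, shortens row \<open>i\<close>. Of total nonnegativity, only the part that
  concerns minors with consecutive rows is carried along: such a minor of the new matrix is zero, a
  minor of the old one, or up to a positive factor a larger minor of the old one
  (\<open>elimination_step\<close>). The same works from the left by reversing rows and columns. When no step
  applies, all rows end and all rows begin along a diagonal, and the banded inverse forces these two
  diagonals to coincide, so that the matrix is a positive diagonal matrix times a power of the
  shift. Therefore \<open>X\<close> is a product of nonnegative periodic bidiagonal matrices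
  (\<open>bidiagonal_factorization\<close>). Each factor is the matrix of one horizontal layer of a network in
  which every vertex sends one edge straight up and one edge to a neighbouring column; stacking
  the layers multiplies the matrices (\<open>network_matrix_N\<close>).
\<close>

section \<open>Indices modulo n\<close>

lemma periodic_int_mult:
  fixes f :: "int \<Rightarrow> 'a"
  assumes "\<And>i. f (i + c) = f i" shows "f (i + c * t) = f i"
proof (induction t rule: int_induct[where k = 0])
  case (step1 t)
  then show ?case using assms[of "i + c * t"] by (simp add: algebra_simps)
next
  case (step2 t)
  then show ?case using assms[of "i + c * (t - 1)"] by (simp add: algebra_simps)
qed simp

lemma res_range:
  assumes "n \<ge> 1" shows "1 \<le> res n i" "res n i \<le> int n" "nat (res n i) \<in> {1..n}"
proof -
  have "0 < int n" using assms by simp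
  from pos_mod_sign[OF this, of "i - 1"] pos_mod_bound[OF this, of "i - 1"]
  show "1 \<le> res n i" "res n i \<le> int n" "nat (res n i) \<in> {1..n}" unfolding res_def by auto
qed

lemma periodic_res:
  assumes "n \<ge> 1" "\<And>i. f (i + int n) = f i" shows "f (res n k) = f k"
  using periodic_int_mult[of f "int n" "res n k" "alpha n k", OF assms(2)] alpha_eq[OF assms(1), of k] by simp

section \<open>Determinants of path sums in acyclic digraphs\<close>

abbreviation minor :: "nat \<Rightarrow> (nat \<Rightarrow> nat \<Rightarrow> real) \<Rightarrow> real" where
  "minor m f \<equiv> Determinant.det (Matrix.mat m m (\<lambda>(a, b). f a b))"

text \<open>
  The coefficients are the cofactors of row \<open>a\<close>, which do not involve the entries of that row.
\<close>

lemma det_linear_in_row: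
  fixes g :: "nat \<Rightarrow> nat \<Rightarrow> real"
  assumes "a < m"
  shows "\<exists>C. \<forall>r. minor m (\<lambda>x b. if x = a then r b else g x b) = (\<Sum>j<m. r j * C j)"
proof -
  define M where "M r = Matrix.mat m m (\<lambda>(x, b). if x = a then r b else g x b)" for r
  define C where "C j = cofactor (M (\<lambda>_. 0)) a j" for j
  have cof: "cofactor (M r) a j = C j" if "j < m" for r j
  proof -
    have "mat_delete (M r) a j = mat_delete (M (\<lambda>_. 0)) a j"
      using assms that by (auto simp: mat_delete_def M_def intro!: eq_matI)
    then show ?thesis by (simp add: C_def cofactor_def)
  qed
  have "Determinant.det (M r) = (\<Sum>j<m. r j * C j)" for r
  proof -
    have "Determinant.det (M r) = (\<Sum>j<m. M r $$ (a, j) * cofactor (M r) a j)"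
      using laplace_expansion_row[of "M r" m a] assms by (simp add: M_def)
    also have "\<dots> = (\<Sum>j<m. r j * C j)"
      by (intro sum.cong) (use assms in \<open>simp_all add: cof, simp add: M_def\<close>)
    finally show ?thesis .
  qed
  then show ?thesis unfolding M_def by blast
qed

text \<open>
  The sum \<open>P v w\<close> over the paths from \<open>v\<close> to \<open>w\<close> enters only through the recursion on the first
  edge. The vertices may form an infinite set, as they do in a universal cover; acyclicity is
  expressed by a height that drops along every edge.
\<close>

locale weighted_acyclic =
  fixes out :: "'v \<Rightarrow> 'e set" and nxt :: "'v \<Rightarrow> 'e \<Rightarrow> 'v" and wt :: "'e \<Rightarrow> real"
    and height :: "'v \<Rightarrow> nat" and P :: "'v \<Rightarrow> 'v \<Rightarrow> real"
  assumes fin_out: "finite (out v)"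
    and height_nxt: "e \<in> out v \<Longrightarrow> height (nxt v e) < height v"
    and wt_nonneg: "e \<in> out v \<Longrightarrow> wt e \<ge> 0"
    and P_rec: "P v w = of_bool (v = w) + (\<Sum>e\<in>out v. wt e * P (nxt v e) w)"
begin

text \<open>
  A path is remembered only by the set of vertices on it, which is what matters for disjointness.
\<close>

inductive visits :: "'v \<Rightarrow> 'v set \<Rightarrow> 'v \<Rightarrow> bool" where
  stop: "visits v {v} v"
| go: "e \<in> out v \<Longrightarrow> visits (nxt v e) S w \<Longrightarrow> visits v (insert v S) w"

lemma visits_height: "visits v S w \<Longrightarrow> x \<in> S \<Longrightarrow> x = v \<or> height x < height v"
proof (induction rule: visits.induct)
  case (go e v S w)
  then show ?case using height_nxt[of e v] by (auto dest: less_trans)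
qed auto

text \<open>
  The nonnegativity part of the Lindstroem-Gessel-Viennot lemma. If two starting points agree, then
  so do two rows. Otherwise let \<open>u a\<close> be of maximal height among the starting points with an
  outgoing edge. Expanding the path sums in row \<open>a\<close> by the
  first edge writes the determinant as a nonnegative combination of the determinants in which
  \<open>u a\<close> is replaced by a successor. No path from another starting point can reach \<open>u a\<close>, so
  a vertex-disjoint family for the new starting points extends by this edge to one for the old
  ones, and the hypothesis is inherited. In the end all starting points are without outgoing edges,
  and the matrix has a zero row or is a permutation matrix, which by the hypothesis is the identity.
\<close>

theorem path_det_nonneg:
  assumes "inj_on w {..<m}" "\<And>b. b < m \<Longrightarrow> out (w b) = {}"
    and "\<And>\<sigma> S. \<sigma> permutes {..<m} \<Longrightarrow> (\<And>a. a < m \<Longrightarrow> visits (u a) (S a) (w (\<sigma> a))) \<Longrightarrow>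
           (\<And>a b. a < m \<Longrightarrow> b < m \<Longrightarrow> a \<noteq> b \<Longrightarrow> S a \<inter> S b = {}) \<Longrightarrow> \<sigma> = id"
  shows "minor m (\<lambda>a b. P (u a) (w b)) \<ge> 0"
  using assms(3)
proof (induction "\<Sum>a<m. height (u a)" arbitrary: u rule: less_induct)
  case less
  let ?M = "Matrix.mat m m (\<lambda>(a, b). P (u a) (w b))"
  show ?case
  proof (cases "inj_on u {..<m}")
    case False
    then obtain a b where ab: "a < m" "b < m" "a \<noteq> b" "u a = u b" by (auto simp: inj_on_def)
    then have "Determinant.det ?M = 0"
      by (intro det_identical_rows[of _ m a b]) (auto intro!: eq_vecI)
    then show ?thesis by simp
  next
    case inj: True
    show ?thesis
    proof (cases "\<forall>a<m. out (u a) = {}")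
      case True
      then have P: "P (u a) (w b) = of_bool (u a = w b)" if "a < m" for a b
        using that P_rec[of "u a" "w b"] by simp
      show ?thesis
      proof (cases "u ` {..<m} \<subseteq> w ` {..<m}")
        case False
        then obtain a where a: "a < m" "u a \<notin> w ` {..<m}" by auto
        have "Determinant.det ?M = (\<Sum>j<m. ?M $$ (a, j) * cofactor ?M a j)"
          using laplace_expansion_row[of ?M m a] a by simp
        also have "\<dots> = 0" using a P by (intro sum.neutral) auto
        finally show ?thesis by simp
      next
        case True
        define \<sigma> where "\<sigma> a = (if a < m then inv_into {..<m} w (u a) else a)" for a
        have \<sigma>: "\<sigma> a < m" "w (\<sigma> a) = u a" if "a < m" for a
        proof -
          have "u a \<in> w ` {..<m}" using True that by auto
          then show "\<sigma> a < m" "w (\<sigma> a) = u a"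
            using inv_into_into[of "u a" w "{..<m}"] f_inv_into_f[of "u a" w "{..<m}"] that
            by (auto simp: \<sigma>_def)
        qed
        have "\<sigma> permutes {..<m}"
        proof (rule bij_imp_permutes)
          have "inj_on \<sigma> {..<m}"
            by (rule inj_onI) (metis \<sigma>(2) inj inj_onD lessThan_iff)
          moreover have "\<sigma> ` {..<m} \<subseteq> {..<m}" using \<sigma> by auto
          ultimately show "bij_betw \<sigma> {..<m} {..<m}"
            by (simp add: bij_betw_def endo_inj_surj)
        qed (auto simp: \<sigma>_def)
        moreover have "visits (u a) {u a} (w (\<sigma> a))" if "a < m" for a
          using \<sigma>[OF that] visits.stop[of "u a"] by simp
        moreover have "{u a} \<inter> {u b} = {}" if "a < m" "b < m" "a \<noteq> b" for a b
          using inj that by (auto simp: inj_on_def)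
        ultimately have "\<sigma> = id" by (rule less.prems[where S = "\<lambda>a. {u a}"])
        then have "u a = w a" if "a < m" for a using \<sigma>(2)[OF that] by simp
        then have "?M = 1\<^sub>m m"
          using assms(1) P by (intro eq_matI) (auto simp: inj_on_def)
        then show ?thesis by simp
      qed
    next
      case False
      \<comment> \<open>the height is compared only among starting points that still have an outgoing edge\<close>
      define A where "A = {a. a < m \<and> out (u a) \<noteq> {}}"
      have "finite A" "A \<noteq> {}" using False by (auto simp: A_def)
      then have "Max ((height \<circ> u) ` A) \<in> (height \<circ> u) ` A" by (intro Max_in) auto
      then obtain a where a: "a \<in> A" and "Max ((height \<circ> u) ` A) = height (u a)" by auto
      with \<open>finite A\<close> have top: "height (u b) \<le> height (u a)" if "b \<in> A" for b
        using that Max_ge[of "(height \<circ> u) ` A" "height (u b)"] by auto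
      have am: "a < m" using a by (simp add: A_def)
      have fresh: "u a \<notin> S" if "visits (u b) S v" "b < m" "b \<noteq> a" for b S v
      proof
        assume S: "u a \<in> S"
        have ne: "u a \<noteq> u b" using inj that am by (auto simp: inj_on_def)
        from visits_height[OF that(1) S] ne have "height (u a) < height (u b)" by simp
        moreover have "b \<in> A"
        proof (rule ccontr)
          assume "b \<notin> A"
          then have "out (u b) = {}" using that by (simp add: A_def)
          with that(1) have "S = {u b}" by cases auto
          with S ne show False by simp
        qed
        ultimately show False using top[of b] by simp
      qed
      have w_ne: "u a \<noteq> w b" if "b < m" for b using assms(2)[OF that] a by (auto simp: A_def)
      have Pa: "P (u a) (w b) = (\<Sum>e\<in>out (u a). wt e * P (nxt (u a) e) (w b))" if "b < m" for b
        using w_ne[OF that] by (subst P_rec) simp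
      obtain C where C: "\<And>r. minor m (\<lambda>x b. if x = a then r b else P (u x) (w b)) = (\<Sum>j<m. r j * C j)"
        using det_linear_in_row[OF am, of "\<lambda>x b. P (u x) (w b)"] by blast
      have upd: "Matrix.mat m m (\<lambda>(x, b). P ((u(a := v)) x) (w b)) =
          Matrix.mat m m (\<lambda>(x, b). if x = a then P v (w b) else P (u x) (w b))" for v
        by (intro eq_matI) auto
      have detC: "minor m (\<lambda>x b. P ((u(a := v)) x) (w b)) =
          (\<Sum>j<m. P v (w j) * C j)" for v
        by (subst upd) (rule C)
      have "Determinant.det ?M = (\<Sum>j<m. P (u a) (w j) * C j)"
        using detC[of "u a"] by (simp only: fun_upd_triv)
      also have "\<dots> = (\<Sum>j<m. \<Sum>e\<in>out (u a). wt e * P (nxt (u a) e) (w j) * C j)"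
        by (intro sum.cong) (auto simp: Pa sum_distrib_right)
      also have "\<dots> = (\<Sum>e\<in>out (u a). wt e * (\<Sum>j<m. P (nxt (u a) e) (w j) * C j))"
        by (subst sum.swap) (simp add: sum_distrib_left mult.assoc)
      also have "\<dots> = (\<Sum>e\<in>out (u a). wt e *
          minor m (\<lambda>x b. P ((u(a := nxt (u a) e)) x) (w b)))"
        by (simp only: detC)
      also have "\<dots> \<ge> 0"
      proof (intro sum_nonneg mult_nonneg_nonneg wt_nonneg)
        fix e assume e: "e \<in> out (u a)"
        let ?u = "u(a := nxt (u a) e)"
        show "minor m (\<lambda>x b. P (?u x) (w b)) \<ge> 0"
        proof (rule less.hyps)
          show "(\<Sum>x<m. height (?u x)) < (\<Sum>x<m. height (u x))"
            using am height_nxt[OF e] by (intro sum_strict_mono_ex1) (auto intro: less_imp_le)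
        next
          fix \<sigma> S
          assume \<sigma>: "\<sigma> permutes {..<m}" and S: "\<And>x. x < m \<Longrightarrow> visits (?u x) (S x) (w (\<sigma> x))"
            and dis: "\<And>x y. x < m \<Longrightarrow> y < m \<Longrightarrow> x \<noteq> y \<Longrightarrow> S x \<inter> S y = {}"
          let ?S = "S(a := insert (u a) (S a))"
          show "\<sigma> = id"
          proof (rule less.prems[OF \<sigma>, of ?S])
            fix x assume x: "x < m"
            show "visits (u x) (?S x) (w (\<sigma> x))"
              using S[OF x] visits.go[OF e, of "S a" "w (\<sigma> a)"] by (auto split: if_splits)
          next
            fix x y assume xy: "x < m" "y < m" "x \<noteq> y"
            have "u a \<notin> S z" if "z < m" "z \<noteq> a" for z
              using fresh[of z "S z"] S[OF that(1)] that by auto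
            then show "?S x \<inter> ?S y = {}"
              using dis[OF xy] xy by auto
          qed
        qed
      qed
      finally show ?thesis .
    qed
  qed
qed

end

section \<open>Lifting curves from the cylinder to the strip\<close>

text \<open>
  The Fashoda meet theorem for the complex plane instead of \<open>real^2\<close>.
\<close>

lemma crossing_paths_in_rectangle:
  fixes f g :: "real \<Rightarrow> complex"
  assumes "path f" "path g"
    and f: "\<And>z. z \<in> path_image f \<Longrightarrow> a \<le> Re z \<and> Re z \<le> b \<and> c \<le> Im z \<and> Im z \<le> d"
    and g: "\<And>z. z \<in> path_image g \<Longrightarrow> a \<le> Re z \<and> Re z \<le> b \<and> c \<le> Im z \<and> Im z \<le> d"
    and "Re (pathstart f) = a" "Re (pathfinish f) = b" "Im (pathstart g) = c" "Im (pathfinish g) = d"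
  obtains z where "z \<in> path_image f" "z \<in> path_image g"
proof -
  define \<phi> :: "complex \<Rightarrow> real^2" where "\<phi> z = (\<chi> i. if i = 1 then Re z else Im z)" for z
  have \<phi>: "\<phi> z $ 1 = Re z" "\<phi> z $ 2 = Im z" for z by (simp_all add: \<phi>_def)
  have inj: "z = w" if "\<phi> z = \<phi> w" for z w using \<phi> that by (metis complex_eqI)
  have cont: "continuous_on S \<phi>" for S
    unfolding \<phi>_def
  proof (rule continuous_on_vec_lambda)
    show "continuous_on S (\<lambda>x. if i = 1 then Re x else Im x)" for i :: 2
      by (cases "i = 1") (simp_all add: continuous_on_Re continuous_on_Im)
  qed
  have img: "path_image (\<phi> \<circ> p) = \<phi> ` path_image p" for p by (simp add: path_image_compose)
  define u v where "u = \<phi> (Complex a c)" and "v = \<phi> (Complex b d)"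
  obtain y where "y \<in> path_image (\<phi> \<circ> f)" "y \<in> path_image (\<phi> \<circ> g)"
  proof (rule fashoda[of "\<phi> \<circ> f" "\<phi> \<circ> g" u v])
    show "path (\<phi> \<circ> f)" "path (\<phi> \<circ> g)"
      using assms(1,2) cont by (auto intro: path_continuous_image)
    show "path_image (\<phi> \<circ> f) \<subseteq> cbox u v" "path_image (\<phi> \<circ> g) \<subseteq> cbox u v"
      using f g by (auto simp: img mem_box_cart forall_2 \<phi> u_def v_def)
  qed (use assms in \<open>auto simp: pathstart_compose pathfinish_compose \<phi> u_def v_def\<close>)
  then show ?thesis using that inj unfolding img by blast
qed

lemma cyl_cover_eq_iff: "cyl_cover z = cyl_cover w \<longleftrightarrow> (\<exists>k::int. w = z + of_int k)"
proof
  assume "cyl_cover z = cyl_cover w"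
  then have "sin (2 * pi * Re w) = sin (2 * pi * Re z) \<and> cos (2 * pi * Re w) = cos (2 * pi * Re z)"
    and Im: "Im z = Im w" by (auto simp: cyl_cover_def cis.ctr complex_eq_iff)
  then obtain k :: int where "2 * pi * Re w = 2 * pi * Re z + 2 * pi * k"
    using sin_cos_eq_iff by blast
  then have "2 * pi * Re w = 2 * pi * (Re z + k)" by (simp add: algebra_simps)
  then have "Re w = Re z + k" by simp
  then show "\<exists>k::int. w = z + of_int k" using Im by (intro exI[of _ k]) (simp add: complex_eq_iff)
next
  assume "\<exists>k::int. w = z + of_int k"
  then obtain k :: int where "w = z + of_int k" by blast
  then have "2 * pi * Re w = 2 * pi * Re z + 2 * pi * k" by (simp add: algebra_simps)
  then have "sin (2 * pi * Re w) = sin (2 * pi * Re z) \<and> cos (2 * pi * Re w) = cos (2 * pi * Re z)"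
    using sin_cos_eq_iff[of "2 * pi * Re w" "2 * pi * Re z"] by blast
  then show "cyl_cover z = cyl_cover w"
    using \<open>w = _\<close> by (simp add: cyl_cover_def complex_eq_iff)
qed

lemma cyl_cover_add_int [simp]: "cyl_cover (z + of_int k) = cyl_cover z"
  using cyl_cover_eq_iff[of z "z + of_int k"] by auto

lemma cyl_cover_in_cylinder: "cyl_cover z \<in> cylinder \<longleftrightarrow> z \<in> strip"
  by (auto simp: cyl_cover_def cylinder_def strip_def)

lemma strip_add_int [simp]: "z + of_int k \<in> strip \<longleftrightarrow> z \<in> strip"
  by (simp add: strip_def)

lemma convex_strip: "convex strip"
proof -
  have "strip = {z. Im z \<ge> 0} \<inter> {z. Im z \<le> 1}" by (auto simp: strip_def)
  then show ?thesis by (metis convex_Int convex_halfspace_Im_ge convex_halfspace_Im_le)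
qed

lemma path_image_add: "path_image (\<lambda>s. g s + c) = (\<lambda>z. z + c) ` path_image g"
  by (auto simp: path_image_def)

lemma is_lift_add_int: "is_lift g c \<Longrightarrow> is_lift (\<lambda>s. g s + of_int k) c"
  unfolding is_lift_def path_image_add by (auto simp: path_def intro: continuous_intros)

text \<open>
  The angular coordinate of the curve has a continuous logarithm because the parameter interval is
  contractible.
\<close>

lemma lift_exists:
  assumes "path c" "path_image c \<subseteq> cylinder" "cyl_cover z0 = c 0"
  obtains g where "is_lift g c" "g 0 = z0"
proof -
  have cc: "continuous_on {0..1} c" using assms(1) by (simp add: path_def)
  have cyl: "c s \<in> cylinder" if "s \<in> {0..1}" for s using assms(2) that by (auto simp: path_image_def)
  have n1: "norm (fst (c s)) = 1" if "s \<in> {0..1}" for s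
    using cyl[OF that] by (auto simp: cylinder_def)
  obtain \<theta> where \<theta>: "continuous_on {0..1} \<theta>" "\<And>s. s \<in> {0..1} \<Longrightarrow> fst (c s) = exp (\<theta> s)"
  proof (rule continuous_logarithm_on_contractible[of "{0..1::real}" "\<lambda>s. fst (c s)"])
    show "continuous_on {0..1} (\<lambda>s. fst (c s))" using cc by (intro continuous_intros)
    show "contractible {0..1::real}" by (simp add: convex_imp_contractible)
    show "fst (c s) \<noteq> 0" if "s \<in> {0..1}" for s using n1[OF that] by auto
  qed blast
  define g0 where "g0 s = Complex (Im (\<theta> s) / (2 * pi)) (snd (c s))" for s
  have cov: "cyl_cover (g0 s) = c s" if "s \<in> {0..1}" for s
  proof -
    have "Re (\<theta> s) = 0" using n1[OF that] \<theta>(2)[OF that] by simp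
    then have "exp (\<theta> s) = cis (Im (\<theta> s))" by (simp add: exp_eq_polar)
    then show ?thesis using \<theta>(2)[OF that] by (simp add: cyl_cover_def g0_def prod_eq_iff)
  qed
  have "continuous_on {0..1} g0"
    unfolding g0_def Complex_eq using cc \<theta>(1) by (intro continuous_intros) auto
  then have lift: "is_lift g0 c"
    using cov cyl cyl_cover_in_cylinder by (fastforce simp: is_lift_def path_def path_image_def)
  obtain k :: int where "z0 = g0 0 + of_int k"
    using cov[of 0] assms(3) cyl_cover_eq_iff[of "g0 0" z0] by auto
  then show ?thesis using that[OF is_lift_add_int[OF lift, of k]] by simp
qed

text \<open>
  The difference of two lifts is a continuous function with integer values.
\<close>

lemma lift_unique:
  assumes "is_lift g c" "is_lift g' c"
  obtains k :: int where "\<And>s. s \<in> {0..1} \<Longrightarrow> g' s = g s + of_int k"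
proof -
  have int: "\<exists>k::int. g' s = g s + of_int k" if "s \<in> {0..1}" for s
    using assms that cyl_cover_eq_iff[of "g s" "g' s"] by (simp add: is_lift_def)
  have "(\<lambda>s. g' s - g s) constant_on {0..1}"
  proof (rule continuous_discrete_range_constant)
    show "continuous_on {0..1} (\<lambda>s. g' s - g s)"
      using assms by (auto simp: is_lift_def path_def intro: continuous_intros)
    fix s :: real assume s: "s \<in> {0..1}"
    have "1 \<le> norm (g' t - g t - (g' s - g s))" if t: "t \<in> {0..1}" "g' t - g t \<noteq> g' s - g s" for t
    proof -
      obtain k l :: int where "g' s = g s + of_int k" "g' t = g t + of_int l" using int s t by meson
      then have "g' t - g t - (g' s - g s) = of_int (l - k)" "l - k \<noteq> 0" using t by auto
      moreover have "1 \<le> \<bar>real_of_int (l - k)\<bar>" using \<open>l - k \<noteq> 0\<close> by linarith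
      ultimately show ?thesis by (metis norm_of_int)
    qed
    then show "\<exists>e>0. \<forall>y. y \<in> {0..1} \<and> g' y - g y \<noteq> g' s - g s \<longrightarrow> e \<le> norm (g' y - g y - (g' s - g s))"
      by (intro exI[of _ 1]) auto
  qed simp
  then obtain d where d: "\<And>s. s \<in> {0..1} \<Longrightarrow> g' s - g s = d" by (auto simp: constant_on_def)
  obtain k :: int where k: "g' 0 = g 0 + of_int k" using int[of 0] by auto
  have "g' s = g s + of_int k" if "s \<in> {0..1}" for s
    using d[OF that] d[of 0] k by (simp add: algebra_simps)
  then show ?thesis using that by blast
qed

text \<open>
  A truth value that is locally constant off a finite set changes from its initial to its
  final value by its upward minus its downward jumps. Elements of \<open>F\<close> at which nothing changes are
  allowed, and count as neither.
\<close>

lemma jump_count: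
  fixes \<tau> :: "real \<Rightarrow> bool"
  assumes "finite F" "F \<subseteq> {a<..<b}" "a < b"
    and "\<And>x y. a \<le> x \<Longrightarrow> x \<le> y \<Longrightarrow> y \<le> b \<Longrightarrow> {x..y} \<inter> F = {} \<Longrightarrow> \<tau> x = \<tau> y"
  shows "int (card {s \<in> F. (\<forall>\<^sub>F u in at_left s. \<not> \<tau> u) \<and> (\<forall>\<^sub>F u in at_right s. \<tau> u)})
       - int (card {s \<in> F. (\<forall>\<^sub>F u in at_left s. \<tau> u) \<and> (\<forall>\<^sub>F u in at_right s. \<not> \<tau> u)})
       = of_bool (\<tau> b) - of_bool (\<tau> a)"
  using assms
proof (induction F arbitrary: b rule: finite_linorder_max_induct)
  case empty
  have "\<tau> a = \<tau> b" by (rule empty.prems(3)) (use empty.prems(2) in auto)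
  then show ?case by simp
next
  case (insert x F)
  \<comment> \<open>\<open>m\<close> separates the last jump \<open>x\<close> from the others\<close>
  define m where "m = (Max (insert a F) + x) / 2"
  have Mx: "Max (insert a F) < x" using insert.hyps insert.prems(1) by auto
  then have m: "m < x" "\<And>y. y \<in> insert a F \<Longrightarrow> y < m"
  proof -
    show "m < x" using Mx by (simp add: m_def)
    fix y assume "y \<in> insert a F"
    then have "y \<le> Max (insert a F)" using insert.hyps(1) by simp
    then show "y < m" using Mx by (simp add: m_def)
  qed
  have x: "x < b" "a < x" using insert.prems(1) by auto
  let ?up = "\<lambda>s. (\<forall>\<^sub>F u in at_left s. \<not> \<tau> u) \<and> (\<forall>\<^sub>F u in at_right s. \<tau> u)"
  let ?dn = "\<lambda>s. (\<forall>\<^sub>F u in at_left s. \<tau> u) \<and> (\<forall>\<^sub>F u in at_right s. \<not> \<tau> u)"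
  have IH: "int (card {s \<in> F. ?up s}) - int (card {s \<in> F. ?dn s}) = of_bool (\<tau> m) - of_bool (\<tau> a)"
  proof (rule insert.IH)
    show "F \<subseteq> {a<..<m}" using m insert.prems(1) by auto
    show "a < m" using m by auto
    show "\<tau> u = \<tau> v" if "a \<le> u" "u \<le> v" "v \<le> m" "{u..v} \<inter> F = {}" for u v
      using that m x by (intro insert.prems(3)) auto
  qed
  have "\<tau> u = \<tau> m" if "u \<in> {m<..<x}" for u
    using that m x insert.prems(3)[of m u] by force
  then have left: "\<forall>\<^sub>F u in at_left x. \<tau> u = \<tau> m"
    using m(1) by (intro eventually_at_leftI[of m]) auto
  have "\<tau> u = \<tau> b" if "u \<in> {x<..<b}" for u
    using that x insert.prems(3)[of u b] insert.hyps(2) by force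
  then have right: "\<forall>\<^sub>F u in at_right x. \<tau> u = \<tau> b"
    using x by (intro eventually_at_rightI[of x b]) auto
  have ev: "(\<forall>\<^sub>F u in at_left x. \<tau> u) \<longleftrightarrow> \<tau> m" "(\<forall>\<^sub>F u in at_left x. \<not> \<tau> u) \<longleftrightarrow> \<not> \<tau> m"
    "(\<forall>\<^sub>F u in at_right x. \<tau> u) \<longleftrightarrow> \<tau> b" "(\<forall>\<^sub>F u in at_right x. \<not> \<tau> u) \<longleftrightarrow> \<not> \<tau> b"
    using eventually_subst[OF left] eventually_subst[OF right]
      eventually_subst[of "\<lambda>u. \<not> \<tau> u" "\<lambda>u. \<not> \<tau> m" "at_left x"] eventually_subst[of "\<lambda>u. \<not> \<tau> u" "\<lambda>u. \<not> \<tau> b" "at_right x"]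
      left right by (simp_all add: eventually_mono)
  have xF: "x \<notin> F" using insert.hyps(2) by auto
  have "{s \<in> insert x F. ?up s} = (if \<not> \<tau> m \<and> \<tau> b then insert x {s \<in> F. ?up s} else {s \<in> F. ?up s})"
    "{s \<in> insert x F. ?dn s} = (if \<tau> m \<and> \<not> \<tau> b then insert x {s \<in> F. ?dn s} else {s \<in> F. ?dn s})"
    using ev by auto
  then have "int (card {s \<in> insert x F. ?up s}) = int (card {s \<in> F. ?up s}) + of_bool (\<not> \<tau> m \<and> \<tau> b)"
    "int (card {s \<in> insert x F. ?dn s}) = int (card {s \<in> F. ?dn s}) + of_bool (\<tau> m \<and> \<not> \<tau> b)"
    using insert.hyps(1) xF by auto
  then show ?case using IH by (cases "\<tau> m"; cases "\<tau> b") auto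
qed

section \<open>The two sides of a chord\<close>

text \<open>
  The side of a point depends only on its component in the complement of the chord.
\<close>

lemma side_transfer:
  assumes "connected T" "T \<subseteq> strip - path_image H" "z \<in> T" "w \<in> T"
  shows "z \<in> east_of H \<longleftrightarrow> w \<in> east_of H" "z \<in> west_of H \<longleftrightarrow> w \<in> west_of H"
proof -
  have "connected_component (strip - path_image H) z w"
    using assms by (auto simp: connected_component_def)
  then have "connected_component_set (strip - path_image H) z = connected_component_set (strip - path_image H) w"
    by (metis connected_component_eq mem_Collect_eq)
  note eq = this
  have zw: "z \<in> strip - path_image H" "w \<in> strip - path_image H" using assms by auto
  have E: "x \<in> east_of H \<longleftrightarrow> x \<in> strip - path_image H \<and>
      (\<forall>M. \<exists>z' \<in> connected_component_set (strip - path_image H) x. Re z' > M)"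
    and W: "x \<in> west_of H \<longleftrightarrow> x \<in> strip - path_image H \<and>
      (\<forall>M. \<exists>z' \<in> connected_component_set (strip - path_image H) x. Re z' < M)" for x
    by (auto simp: east_of_def west_of_def)
  show "z \<in> east_of H \<longleftrightarrow> w \<in> east_of H" "z \<in> west_of H \<longleftrightarrow> w \<in> west_of H"
    using zw by (simp_all only: E W eq simp_thms)
qed

lemma linepath_between:
  assumes "w \<in> path_image (linepath p q)"
  shows "min (Re p) (Re q) \<le> Re w" "Re w \<le> max (Re p) (Re q)"
    "min (Im p) (Im q) \<le> Im w" "Im w \<le> max (Im p) (Im q)"
proof -
  obtain u where u: "0 \<le> u" "u \<le> 1" "w = (1 - u) *\<^sub>R p + u *\<^sub>R q"
    using assms by (auto simp: closed_segment_def)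
  have "(1 - u) * a + u * b \<in> closed_segment a b" for a b :: real
    using u by (auto simp: closed_segment_def)
  then have "(1 - u) * a + u * b \<in> {min a b..max a b}" for a b :: real
    by (metis closed_segment_eq_real_ivl1 max_def min_def order_less_imp_le not_le closed_segment_commute closed_segment_eq_real_ivl)
  then show "min (Re p) (Re q) \<le> Re w" "Re w \<le> max (Re p) (Re q)"
    "min (Im p) (Im q) \<le> Im w" "Im w \<le> max (Im p) (Im q)"
    using u(3) by simp_all
qed

lemma horizontal_segment_connected: "connected {z. Im z = y \<and> a \<le> Re z \<and> Re z \<le> b}"
proof -
  have "{z. Im z = y \<and> a \<le> Re z \<and> Re z \<le> b} = (\<lambda>x. Complex x y) ` {a..b}"
    by (auto simp: image_iff complex_eq_iff)
  moreover have "continuous_on {a..b} (\<lambda>x. Complex x y)"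
    unfolding Complex_eq by (intro continuous_intros)
  ultimately show ?thesis by (metis connected_continuous_image connected_Icc)
qed

lemma side_of_segment:
  assumes "Im z = Im w" "\<And>v. Im v = Im z \<Longrightarrow> min (Re z) (Re w) \<le> Re v \<Longrightarrow> Re v \<le> max (Re z) (Re w) \<Longrightarrow> v \<in> S"
  shows "w \<in> connected_component_set S z"
proof -
  let ?T = "{v. Im v = Im z \<and> min (Re z) (Re w) \<le> Re v \<and> Re v \<le> max (Re z) (Re w)}"
  have "connected ?T" "?T \<subseteq> S" "z \<in> ?T" "w \<in> ?T"
    using horizontal_segment_connected assms by auto
  then show ?thesis unfolding mem_Collect_eq connected_component_def by blast
qed

lemma ray_east_of:
  assumes "z \<in> strip" "\<And>x. x \<ge> Re z \<Longrightarrow> Complex x (Im z) \<notin> path_image H"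
  shows "z \<in> east_of H"
proof -
  have free: "v \<in> strip - path_image H" if "Im v = Im z" "Re z \<le> Re v" for v
    using that assms(1) assms(2)[of "Re v"] by (metis DiffI complex_surj mem_Collect_eq strip_def)
  have "Complex (max (Re z) (M + 1)) (Im z) \<in> connected_component_set (strip - path_image H) z" for M
    by (rule side_of_segment, simp, rule free) auto
  note seg = this
  show ?thesis unfolding east_of_def
  proof (intro CollectI conjI allI)
    show "z \<in> strip - path_image H" using free[of z] by simp
    show "\<exists>z' \<in> connected_component_set (strip - path_image H) z. M < Re z'" for M
      by (rule bexI[OF _ seg[of M]]) simp
  qed
qed

lemma ray_west_of:
  assumes "z \<in> strip" "\<And>x. x \<le> Re z \<Longrightarrow> Complex x (Im z) \<notin> path_image H"
  shows "z \<in> west_of H"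
proof -
  have free: "v \<in> strip - path_image H" if "Im v = Im z" "Re v \<le> Re z" for v
    using that assms(1) assms(2)[of "Re v"] by (metis DiffI complex_surj mem_Collect_eq strip_def)
  have "Complex (min (Re z) (M - 1)) (Im z) \<in> connected_component_set (strip - path_image H) z" for M
    by (rule side_of_segment, simp, rule free) auto
  note seg = this
  show ?thesis unfolding west_of_def
  proof (intro CollectI conjI allI)
    show "z \<in> strip - path_image H" using free[of z] by simp
    show "\<exists>z' \<in> connected_component_set (strip - path_image H) z. Re z' < M" for M
      by (rule bexI[OF _ seg[of M]]) simp
  qed
qed

lemma side_cong: "path_image H = path_image H' \<Longrightarrow> east_of H = east_of H' \<and> west_of H = west_of H'"
  by (simp add: east_of_def west_of_def)

lemma east_of_add_int_imp:
  assumes "z \<in> east_of H" shows "z + of_int k \<in> east_of (\<lambda>s. H s + of_int k)"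
proof -
  let ?S = "strip - path_image H" and ?S' = "strip - path_image (\<lambda>s. H s + complex_of_int k)"
  have S: "w + of_int k \<in> ?S'" if "w \<in> ?S" for w
    using that by (auto simp: path_image_add)
  have comp: "w + of_int k \<in> connected_component_set ?S' (z + of_int k)"
    if w: "w \<in> connected_component_set ?S z" for w
  proof -
    obtain T where T: "connected T" "T \<subseteq> ?S" "z \<in> T" "w \<in> T"
      using w unfolding mem_Collect_eq connected_component_def by blast
    have "connected ((\<lambda>w. w + of_int k) ` T)"
      using T(1) by (intro connected_continuous_image continuous_intros)
    moreover have "(\<lambda>w. w + of_int k) ` T \<subseteq> ?S'" using T(2) S by blast
    ultimately show ?thesis using T(3,4) unfolding mem_Collect_eq connected_component_def by blast
  qed
  show ?thesis
    unfolding east_of_def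
  proof (intro CollectI conjI allI)
    show "z + of_int k \<in> ?S'" using assms S by (simp add: east_of_def)
    fix M
    obtain w where "w \<in> connected_component_set ?S z" "M - of_int k < Re w"
      using assms unfolding east_of_def by blast
    then show "\<exists>z'\<in>connected_component_set ?S' (z + of_int k). M < Re z'"
      by (intro bexI[OF _ comp]) auto
  qed
qed

lemma east_of_add_int:
  "z + of_int k \<in> east_of (\<lambda>s. H s + of_int k) \<longleftrightarrow> z \<in> east_of H"
  using east_of_add_int_imp[of z H k] east_of_add_int_imp[of "z + of_int k" "\<lambda>s. H s + of_int k" "- k"] by auto

locale strip_chord =
  fixes H :: "real \<Rightarrow> complex"
  assumes arc_H: "arc H"
    and Im_start: "Im (H 0) = 0" and Im_finish: "Im (H 1) = 1"
    and Im_interior: "0 < t \<Longrightarrow> t < 1 \<Longrightarrow> 0 < Im (H t) \<and> Im (H t) < 1"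
begin

lemma chord_in_strip: "path_image H \<subseteq> strip"
proof -
  have "H t \<in> strip" if "0 \<le> t" "t \<le> 1" for t
    using that Im_start Im_finish Im_interior[of t] by (cases "t = 0"; cases "t = 1") (auto simp: strip_def)
  then show ?thesis by (auto simp: path_image_def)
qed

lemma chord_boundary:
  assumes "z \<in> path_image H" "Im z \<in> {0, 1}" shows "z = H (Im z)"
proof -
  obtain t where "0 \<le> t" "t \<le> 1" "z = H t" using assms(1) by (auto simp: path_image_def)
  then show ?thesis using assms(2) Im_start Im_finish Im_interior[of t] by (cases "t = 0"; cases "t = 1") auto
qed

lemma chord_bounded: obtains M where "M > 0" "\<And>z. z \<in> path_image H \<Longrightarrow> \<bar>Re z\<bar> < M"
proof -
  have "bounded (path_image H)" using arc_H by (simp add: bounded_path_image arc_imp_path)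
  then obtain M where "M > 0" "\<And>z. z \<in> path_image H \<Longrightarrow> norm z < M" by (auto simp: bounded_pos_less)
  then show ?thesis using that abs_Re_le_cmod le_less_trans by metis
qed

text \<open>
  The chord meets each boundary line only once, so a horizontal ray on that line that starts
  away from the chord and leads away from it never meets it.
\<close>

lemma boundary_side:
  assumes "Im w \<in> {0, 1}"
  shows "Re w > Re (H (Im w)) \<Longrightarrow> w \<in> east_of H" "Re w < Re (H (Im w)) \<Longrightarrow> w \<in> west_of H"
proof -
  have w: "w \<in> strip" using assms by (auto simp: strip_def)
  show "w \<in> east_of H" if "Re w > Re (H (Im w))"
    using that assms chord_boundary[of "Complex _ (Im w)"] by (intro ray_east_of[OF w]) force
  show "w \<in> west_of H" if "Re w < Re (H (Im w))"
    using that assms chord_boundary[of "Complex _ (Im w)"] by (intro ray_west_of[OF w]) force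
qed

text \<open>
  The complement of an arc in the plane is connected, so some curve that avoids the chord leads from
  \<open>z\<close> out of the strip. The point \<open>w\<close> at which it first reaches the boundary of the strip can be
  moved along the boundary line to infinity.
\<close>

lemma east_or_west:
  assumes "z \<in> strip" "z \<notin> path_image H"
  shows "z \<in> east_of H \<or> z \<in> west_of H"
proof -
  \<comment> \<open>some point outside the strip\<close>
  let ?L = "Complex 0 2"
  have "?L \<notin> path_image H" using chord_in_strip by (auto simp: strip_def)
  moreover have "path_connected (- path_image H)"
    by (rule path_connected_arc_complement[OF arc_H]) simp
  ultimately obtain q where q: "path q" "path_image q \<subseteq> - path_image H" "pathstart q = z" "pathfinish q = ?L"
    using assms(2) unfolding path_connected_def by (metis ComplI)
  obtain h where h: "path h" "path_image h \<subseteq> path_image q" "pathstart h = pathstart q"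
    "path_image h - {pathfinish h} \<subseteq> interior strip" "pathfinish h \<in> frontier strip"
  proof (rule exists_path_subpath_to_frontier[OF q(1)])
    show "pathstart q \<in> closure strip" using q assms closure_subset by auto
    show "pathfinish q \<notin> strip" using q by (simp add: strip_def)
  qed blast
  define w where "w = pathfinish h"
  have closed: "closed strip"
  proof -
    have "strip = {z. Im z \<ge> 0} \<inter> {z. Im z \<le> 1}" by (auto simp: strip_def)
    then show ?thesis by (metis closed_Int closed_halfspace_Im_ge closed_halfspace_Im_le)
  qed
  have w: "w \<in> strip" "w \<notin> interior strip" using h(5) closed by (auto simp: w_def frontier_def)
  have "Im w \<in> {0, 1}"
  proof (rule ccontr)
    assume "Im w \<notin> {0, 1}"
    then have "w \<in> {z. 0 < Im z} \<inter> {z. Im z < 1}" using w(1) by (auto simp: strip_def)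
    moreover have "open ({z. 0 < Im z} \<inter> {z. Im z < 1})"
      by (intro open_Int open_halfspace_Im_gt open_halfspace_Im_lt)
    moreover have "{z. 0 < Im z} \<inter> {z. Im z < 1} \<subseteq> strip" by (auto simp: strip_def)
    ultimately show False using w(2) interiorI by blast
  qed
  have img: "path_image h \<subseteq> strip - path_image H"
    using h q w interior_subset[of strip] by (auto simp: w_def)
  have "w \<in> path_image h" "z \<in> path_image h" using h(3) q(3) by (auto simp: w_def)
  note wz = this
  have "w \<notin> path_image H" using wz(1) img by blast
  have "w \<in> east_of H \<longleftrightarrow> z \<in> east_of H" "w \<in> west_of H \<longleftrightarrow> z \<in> west_of H"
    using side_transfer[OF connected_path_image[OF h(1)] img wz] by simp_all
  moreover have "H (Im w) \<in> path_image H" using \<open>Im w \<in> _\<close> by (auto simp: path_image_def)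
  then have "Re w \<noteq> Re (H (Im w))"
  proof -
    have "Im (H (Im w)) = Im w" using \<open>Im w \<in> {0,1}\<close> Im_start Im_finish by auto
    then show ?thesis using \<open>w \<notin> path_image H\<close> \<open>H (Im w) \<in> _\<close> by (metis complex_eqI)
  qed
  then have "w \<in> east_of H \<or> w \<in> west_of H"
    using boundary_side[OF \<open>Im w \<in> {0,1}\<close>] by linarith
  ultimately show ?thesis by blast
qed

text \<open>
  Otherwise some curve in the complement of the chord leads from far left to far right. Prolonged
  by horizontal segments to the sides of a rectangle, it would have to meet the chord, which
  connects the bottom to the top of this rectangle.
\<close>

lemma not_east_and_west: "\<not> (z \<in> east_of H \<and> z \<in> west_of H)"
proof
  assume EW: "z \<in> east_of H \<and> z \<in> west_of H"
  let ?S = "strip - path_image H"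
  obtain M where M: "M > 0" "\<And>z. z \<in> path_image H \<Longrightarrow> \<bar>Re z\<bar> < M" using chord_bounded by blast
  obtain z1 z2 where z1: "connected_component ?S z z1" "Re z1 < - M"
    and z2: "connected_component ?S z z2" "Re z2 > M"
  proof -
    have "\<exists>w \<in> connected_component_set ?S z. Re w > M" using EW unfolding east_of_def by blast
    moreover have "\<exists>w \<in> connected_component_set ?S z. Re w < - M" using EW unfolding west_of_def by blast
    ultimately show ?thesis using that by blast
  qed
  have lpc: "locally path_connected ?S"
  proof (rule locally_open_subset)
    show "locally path_connected strip" by (rule convex_imp_locally_path_connected[OF convex_strip])
    show "openin (top_of_set strip) ?S"
      using closed_path_image[OF arc_imp_path[OF arc_H]] by (auto simp: openin_open Diff_eq)
  qed
  have "connected_component ?S z1 z2" using z1 z2 connected_component_sym connected_component_trans by metis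
  then have "path_component ?S z1 z2" using path_component_eq_connected_component[OF lpc] by metis
  then obtain p where p: "path p" "path_image p \<subseteq> ?S" "pathstart p = z1" "pathfinish p = z2"
    unfolding path_component_def by blast
  have "bounded (path_image p)" using p(1) by (rule bounded_path_image)
  then obtain B where B: "\<And>z. z \<in> path_image p \<Longrightarrow> norm z \<le> B" unfolding bounded_iff by blast
  define c where "c = max M B + 1"
  have pc: "\<bar>Re w\<bar> \<le> c" if "w \<in> path_image p" for w
    using B[OF that] abs_Re_le_cmod[of w] by (simp add: c_def)
  have zs: "z1 \<in> path_image p" "z2 \<in> path_image p" using p(3,4) by auto
  let ?l = "linepath (Complex (- c) (Im z1)) z1" and ?r = "linepath z2 (Complex c (Im z2))"
  let ?f = "?l +++ p +++ ?r"
  have l: "Im w = Im z1 \<and> - c \<le> Re w \<and> Re w < - M" if "w \<in> path_image ?l" for w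
    using linepath_between[OF that] pc[OF zs(1)] z1(2) M(1) by auto
  have r: "Im w = Im z2 \<and> M < Re w \<and> Re w \<le> c" if "w \<in> path_image ?r" for w
    using linepath_between[OF that] pc[OF zs(2)] z2(2) M(1) by auto
  have fimg: "path_image ?f = path_image ?l \<union> path_image p \<union> path_image ?r"
    using p by (simp add: path_image_join Un_assoc)
  have zstrip: "0 \<le> Im w \<and> Im w \<le> 1" if "w \<in> path_image p" for w
    using p(2) that by (auto simp: strip_def)
  have box: "- c \<le> Re w \<and> Re w \<le> c \<and> 0 \<le> Im w \<and> Im w \<le> 1" if w: "w \<in> path_image ?f" for w
  proof -
    consider "w \<in> path_image ?l" | "w \<in> path_image p" | "w \<in> path_image ?r" using w unfolding fimg by blast
    then show ?thesis
    proof cases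
      case 1
      then show ?thesis using l[OF 1] zstrip[OF zs(1)] M(1) by (simp add: c_def)
    next
      case 2
      then show ?thesis using zstrip[OF 2] pc[OF 2] by (simp add: abs_le_iff)
    next
      case 3
      then show ?thesis using r[OF 3] zstrip[OF zs(2)] M(1) by (simp add: c_def)
    qed
  qed
  obtain w where w: "w \<in> path_image ?f" "w \<in> path_image H"
  proof (rule crossing_paths_in_rectangle[of ?f H "- c" c 0 1])
    show "path ?f" "path H" using p arc_H by (auto simp: arc_imp_path)
    show "- c \<le> Re w \<and> Re w \<le> c \<and> 0 \<le> Im w \<and> Im w \<le> 1" if "w \<in> path_image ?f" for w
      by (rule box[OF that])
    show "- c \<le> Re w \<and> Re w \<le> c \<and> 0 \<le> Im w \<and> Im w \<le> 1" if "w \<in> path_image H" for w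
    proof -
      have "0 \<le> Im w \<and> Im w \<le> 1" using that chord_in_strip by (auto simp: strip_def)
      then show ?thesis using M(2)[OF that] by (auto simp: c_def abs_less_iff)
    qed
  qed (use Im_start Im_finish in \<open>auto simp: pathstart_def pathfinish_def joinpaths_def linepath_def\<close>)
  have "w \<notin> path_image ?l" "w \<notin> path_image ?r" using l[of w] r[of w] M(2)[OF w(2)] by (auto simp: abs_less_iff)
  then show False using w p(2) unfolding fimg by blast
qed

lemma west_iff: "z \<in> west_of H \<longleftrightarrow> z \<in> strip - path_image H \<and> z \<notin> east_of H"
proof -
  have "z \<in> west_of H \<Longrightarrow> z \<in> strip - path_image H" by (simp add: west_of_def)
  then show ?thesis using east_or_west[of z] not_east_and_west[of z] by blast
qed

end

section \<open>Crossing numbers and sheets\<close>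

text \<open>
  The paths may run along the boundary lines of the strip, so the Fashoda theorem is applied in a
  larger rectangle: \<open>f\<close> is prolonged to the left edge below the strip and to the right edge above
  it, and \<open>g\<close> vertically to the bottom and to the top. Outside the strip the two prolonged paths
  are disjoint, and inside it they agree with \<open>f\<close> and \<open>g\<close>.
\<close>

lemma paths_across_strip_meet:
  assumes f: "path f" "path_image f \<subseteq> strip" "Im (pathstart f) = 0" "Im (pathfinish f) = 1"
    and g: "path g" "path_image g \<subseteq> strip" "Im (pathstart g) = 0" "Im (pathfinish g) = 1"
    and lt: "Re (pathstart f) < Re (pathstart g)" "Re (pathfinish g) < Re (pathfinish f)"
  shows "path_image f \<inter> path_image g \<noteq> {}"
proof
  assume disj: "path_image f \<inter> path_image g = {}"
  have "bounded (path_image f \<union> path_image g)" using f g by (simp add: bounded_path_image)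
  then obtain B where B: "\<And>z. z \<in> path_image f \<union> path_image g \<Longrightarrow> norm z \<le> B" unfolding bounded_iff by blast
  have Re: "- B \<le> Re z \<and> Re z \<le> B" if "z \<in> path_image f \<union> path_image g" for z
    using B[OF that] abs_Re_le_cmod[of z] by (simp add: abs_le_iff)
  have Im: "0 \<le> Im z \<and> Im z \<le> 1" if "z \<in> path_image f \<union> path_image g" for z
    using that f(2) g(2) by (auto simp: strip_def)
  define a b c d where "a = pathstart f" and "b = pathfinish f" and "c = pathstart g" and "d = pathfinish g"
  have ends: "a \<in> path_image f" "b \<in> path_image f" "c \<in> path_image g" "d \<in> path_image g"
    by (auto simp: a_def b_def c_def d_def)
  note vals = f(3,4)[folded a_def b_def] g(3,4)[folded c_def d_def] lt[folded a_def b_def c_def d_def]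
  let ?f1 = "linepath (Complex (- B) (-1/2)) (Complex (Re a) (-1/2))" and ?f2 = "linepath (Complex (Re a) (-1/2)) a"
    and ?f3 = "linepath b (Complex (Re b) (3/2))" and ?f4 = "linepath (Complex (Re b) (3/2)) (Complex B (3/2))"
  let ?g1 = "linepath (Complex (Re c) (-1)) c" and ?g2 = "linepath d (Complex (Re d) 2)"
  let ?f = "?f1 +++ ?f2 +++ f +++ ?f3 +++ ?f4" and ?g = "?g1 +++ g +++ ?g2"
  have pi: "path_image ?f = path_image ?f1 \<union> path_image ?f2 \<union> path_image f \<union> path_image ?f3 \<union> path_image ?f4"
    "path_image ?g = path_image ?g1 \<union> path_image g \<union> path_image ?g2"
    by (simp_all add: path_image_join a_def b_def c_def d_def Un_assoc del: path_image_linepath)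
  have B': "- B \<le> Re a" "Re b \<le> B" "- B \<le> Re c" "Re c \<le> B" "- B \<le> Re d" "Re d \<le> B" "Re a \<le> B" "- B \<le> Re b"
    using Re ends by auto
  have f1: "Im z = -1/2 \<and> - B \<le> Re z \<and> Re z \<le> Re a" if "z \<in> path_image ?f1" for z
    using linepath_between[OF that] B' by simp
  have f2: "Re z = Re a \<and> -1/2 \<le> Im z \<and> Im z \<le> 0" if "z \<in> path_image ?f2" for z
    using linepath_between[OF that] vals by simp
  have f3: "Re z = Re b \<and> 1 \<le> Im z \<and> Im z \<le> 3/2" if "z \<in> path_image ?f3" for z
    using linepath_between[OF that] vals by simp
  have f4: "Im z = 3/2 \<and> Re b \<le> Re z \<and> Re z \<le> B" if "z \<in> path_image ?f4" for z
    using linepath_between[OF that] B' by simp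
  have g1: "Re z = Re c \<and> -1 \<le> Im z \<and> Im z \<le> 0" if "z \<in> path_image ?g1" for z
    using linepath_between[OF that] vals by simp
  have g2: "Re z = Re d \<and> 1 \<le> Im z \<and> Im z \<le> 2" if "z \<in> path_image ?g2" for z
    using linepath_between[OF that] vals by simp
  have F: "(z \<in> path_image f \<or> Im z < 0 \<and> Re z \<le> Re a \<or> Im z > 1 \<and> Re b \<le> Re z) \<and>
      - B \<le> Re z \<and> Re z \<le> B \<and> -1 \<le> Im z \<and> Im z \<le> 2" if z: "z \<in> path_image ?f" for z
  proof (cases "z \<in> path_image f")
    case True
    then show ?thesis using Re[of z] Im[of z] by simp
  next
    case False
    then have off: "z \<noteq> a" "z \<noteq> b" using ends by auto
    from z False consider "z \<in> path_image ?f1" | "z \<in> path_image ?f2" | "z \<in> path_image ?f3" | "z \<in> path_image ?f4"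
      unfolding pi by blast
    then show ?thesis
    proof cases
      case 1 then show ?thesis using f1[OF 1] B' by simp
    next
      case 2
      moreover have "Im z \<noteq> 0" using f2[OF 2] off(1) vals by (auto simp: complex_eq_iff)
      ultimately show ?thesis using f2[OF 2] B' by simp
    next
      case 3
      moreover have "Im z \<noteq> 1" using f3[OF 3] off(2) vals by (auto simp: complex_eq_iff)
      ultimately show ?thesis using f3[OF 3] B' by simp
    next
      case 4 then show ?thesis using f4[OF 4] B' by simp
    qed
  qed
  have G: "(z \<in> path_image g \<or> Im z < 0 \<and> Re z = Re c \<or> Im z > 1 \<and> Re z = Re d) \<and>
      - B \<le> Re z \<and> Re z \<le> B \<and> -1 \<le> Im z \<and> Im z \<le> 2" if z: "z \<in> path_image ?g" for z
  proof (cases "z \<in> path_image g")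
    case True
    then show ?thesis using Re[of z] Im[of z] by simp
  next
    case False
    then have off: "z \<noteq> c" "z \<noteq> d" using ends by auto
    from z False consider "z \<in> path_image ?g1" | "z \<in> path_image ?g2" unfolding pi by blast
    then show ?thesis
    proof cases
      case 1
      moreover have "Im z \<noteq> 0" using g1[OF 1] off(1) vals by (auto simp: complex_eq_iff)
      ultimately show ?thesis using g1[OF 1] B' by simp
    next
      case 2
      moreover have "Im z \<noteq> 1" using g2[OF 2] off(2) vals by (auto simp: complex_eq_iff)
      ultimately show ?thesis using g2[OF 2] B' by simp
    qed
  qed
  obtain z where z: "z \<in> path_image ?f" "z \<in> path_image ?g"
  proof (rule crossing_paths_in_rectangle[of ?f ?g "- B" B "-1" 2])
    show "path ?f" "path ?g" using f(1) g(1) by (auto simp: a_def b_def c_def d_def)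
  qed (use F G in auto)
  show False using F[OF z(1)] G[OF z(2)] Im[of z] disj vals by auto
qed

lemma eventually_not_in_finite:
  fixes s :: real
  assumes "finite F" shows "\<forall>\<^sub>F u in at s. u \<notin> F"
proof -
  have "open (- (F - {s}))" using assms by (intro open_Compl finite_imp_closed) simp
  then show ?thesis unfolding eventually_at_topological by (intro exI[of _ "- (F - {s})"]) auto
qed

locale chord_lift =
  fixes h :: "real \<Rightarrow> cyl_point" and H :: "real \<Rightarrow> complex"
  assumes arc_h: "arc h" and lift_H: "is_lift H h"
    and h0: "snd (h 0) = 0" and h1: "snd (h 1) = 1"
    and h_interior: "h ` {0<..<1} \<subseteq> sphere 0 1 \<times> {0<..<1}"
begin

abbreviation Hk :: "int \<Rightarrow> real \<Rightarrow> complex" where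
  "Hk k \<equiv> \<lambda>s. H s + of_int k"

lemma cover_H: "s \<in> {0..1} \<Longrightarrow> cyl_cover (H s) = h s"
  using lift_H by (simp add: is_lift_def)

lemma Im_H: "s \<in> {0..1} \<Longrightarrow> Im (H s) = snd (h s)"
  by (simp add: cover_H[symmetric] cyl_cover_def)

lemma h_inj: "s \<in> {0..1} \<Longrightarrow> t \<in> {0..1} \<Longrightarrow> h s = h t \<Longrightarrow> s = t"
  using arc_h by (auto simp: arc_def inj_on_def)

sublocale strip_chord "Hk k" for k
proof
  have "path (Hk k)" using lift_H is_lift_add_int by (auto simp: is_lift_def)
  moreover have "s = t" if "s \<in> {0..1}" "t \<in> {0..1}" "Hk k s = Hk k t" for s t
    using that cover_H[of s] cover_H[of t] h_inj by simp
  ultimately show "arc (Hk k)" by (auto simp: arc_def inj_on_def)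
  show "Im (Hk k 0) = 0" "Im (Hk k 1) = 1" using Im_H[of 0] Im_H[of 1] h0 h1 by auto
  show "0 < Im (Hk k t) \<and> Im (Hk k t) < 1" if "0 < t" "t < 1" for t
    using h_interior Im_H[of t] that by (force simp: image_subset_iff)
qed

lemma translates_disjoint:
  assumes "z \<in> path_image (Hk k)" "z \<in> path_image (Hk l)" shows "k = l"
proof -
  obtain s t where st: "s \<in> {0..1}" "t \<in> {0..1}" "z = Hk k s" "z = Hk l t"
    using assms by (auto simp: path_image_def)
  then have "h s = h t" using cover_H[of s] cover_H[of t] by (metis cyl_cover_add_int)
  then have "s = t" using st h_inj by blast
  then show ?thesis using st by simp
qed

lemma cover_on_chord:
  assumes "z \<in> path_image (Hk k)" shows "cyl_cover z \<in> path_image h"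
proof -
  obtain s where s: "s \<in> {0..1}" "z = Hk k s" using assms by (auto simp: path_image_def)
  then have "cyl_cover z = h s" using cover_H by simp
  then show ?thesis using s(1) by (auto simp: path_image_def)
qed

text \<open>
  The number of the sheet that contains \<open>z\<close> is the number of chord translates to the west of \<open>z\<close>.
  Infinitely many translates lie on either side, so they are counted relative to the state in
  which exactly the translates by \<open>k \<le> 0\<close> lie to the west.
\<close>

definition sheet_term :: "complex \<Rightarrow> int \<Rightarrow> int" where
  "sheet_term z k = of_bool (z \<in> east_of (Hk k)) - of_bool (k \<le> 0)"

definition sheet :: "complex \<Rightarrow> int" where
  "sheet z = (\<Sum>k | sheet_term z k \<noteq> 0. sheet_term z k)"

text \<open>
  Only finitely many translates of the chord reach the vertical line through \<open>z\<close>.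
\<close>

lemma far_sides:
  assumes "z \<in> strip"
  obtains m where "\<And>k. k < - m \<Longrightarrow> z \<in> east_of (Hk k)" "\<And>k. k > m \<Longrightarrow> z \<notin> east_of (Hk k)" "m \<ge> 0"
proof -
  obtain M where M: "M > 0" "\<And>z. z \<in> path_image (Hk 0) \<Longrightarrow> \<bar>Re z\<bar> < M" using chord_bounded[of 0] by blast
  have Mk: "real_of_int k - M < Re w \<and> Re w < real_of_int k + M" if w: "w \<in> path_image (Hk k)" for k w
  proof -
    obtain v where "v \<in> path_image (Hk 0)" "w = v + of_int k" using w by (auto simp: path_image_def)
    then show ?thesis using M(2)[of v] by (simp add: abs_less_iff)
  qed
  define m where "m = \<lceil>\<bar>Re z\<bar> + M\<rceil>"
  have m: "\<bar>Re z\<bar> + M \<le> real_of_int m" by (simp add: m_def)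
  have "z \<in> east_of (Hk k)" if "k < - m" for k
  proof (rule ray_east_of[OF assms])
    fix x assume "x \<ge> Re z"
    moreover have "real_of_int k < - real_of_int m" using that by linarith
    ultimately show "Complex x (Im z) \<notin> path_image (Hk k)" using Mk[of "Complex x (Im z)" k] m by (auto simp: abs_if split: if_splits)
  qed
  moreover have "z \<notin> east_of (Hk k)" if "k > m" for k
  proof -
    have "z \<in> west_of (Hk k)"
    proof (rule ray_west_of[OF assms])
      fix x assume "x \<le> Re z"
      moreover have "real_of_int k > real_of_int m" using that by linarith
      ultimately show "Complex x (Im z) \<notin> path_image (Hk k)" using Mk[of "Complex x (Im z)" k] m by (auto simp: abs_if split: if_splits)
    qed
    then show ?thesis using not_east_and_west by blast
  qed
  moreover have "m \<ge> 0" using m M(1) by linarith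
  ultimately show ?thesis using that by blast
qed

lemma finite_sheet_term:
  assumes "z \<in> strip" shows "finite {k. sheet_term z k \<noteq> 0}"
proof -
  obtain m where m: "\<And>k. k < - m \<Longrightarrow> z \<in> east_of (Hk k)" "\<And>k. k > m \<Longrightarrow> z \<notin> east_of (Hk k)" "m \<ge> 0"
    using far_sides[OF assms] by metis
  have "sheet_term z k = 0" if "k \<notin> {- m..m}" for k
    using that m(1)[of k] m(2)[of k] m(3) by (cases "k < - m") (auto simp: sheet_term_def)
  then have "{k. sheet_term z k \<noteq> 0} \<subseteq> {- m..m}" by blast
  then show ?thesis by (rule finite_subset) simp
qed

lemma sheet_eq:
  assumes "z \<in> strip" "finite K" "{k. sheet_term z k \<noteq> 0} \<subseteq> K"
  shows "sheet z = (\<Sum>k\<in>K. sheet_term z k)"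
  unfolding sheet_def using assms by (intro sum.mono_neutral_left) auto

lemma sheet_eqI:
  assumes "z \<in> strip" "\<And>k. z \<in> east_of (Hk k) \<longleftrightarrow> k \<le> m"
  shows "sheet z = m"
proof (cases "m \<ge> 0")
  case True
  then have eq: "sheet_term z k = of_bool (k \<in> {1..m})" for k using assms(2) by (auto simp: sheet_term_def)
  have "sheet z = (\<Sum>k\<in>{1..m}. sheet_term z k)" by (rule sheet_eq[OF assms(1)]) (auto simp: eq)
  then show ?thesis using True by (simp add: eq)
next
  case False
  then have eq: "sheet_term z k = - of_bool (k \<in> {m + 1..0})" for k using assms(2) by (auto simp: sheet_term_def)
  have "sheet z = (\<Sum>k\<in>{m + 1..0}. sheet_term z k)" by (rule sheet_eq[OF assms(1)]) (auto simp: eq)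
  then show ?thesis using False by (simp add: eq)
qed

lemma sides_add_int:
  "z + of_int m \<in> east_of (Hk k) \<longleftrightarrow> z \<in> east_of (Hk (k - m))"
  "z + of_int m \<in> west_of (Hk k) \<longleftrightarrow> z \<in> west_of (Hk (k - m))"
proof -
  have Hk: "(\<lambda>s. Hk (k - m) s + of_int m) = Hk k" by (simp add: fun_eq_iff)
  show east: "z + of_int m \<in> east_of (Hk k) \<longleftrightarrow> z \<in> east_of (Hk (k - m))"
    using east_of_add_int[of z m "Hk (k - m)"] unfolding Hk .
  have "z + of_int m \<in> path_image (Hk k) \<longleftrightarrow> z \<in> path_image (Hk (k - m))"
    unfolding Hk[symmetric] path_image_add[of "Hk (k - m)"] by auto
  then show "z + of_int m \<in> west_of (Hk k) \<longleftrightarrow> z \<in> west_of (Hk (k - m))"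
    using east by (simp only: west_iff Diff_iff strip_add_int)
qed

lemma sheet_add_one:
  assumes "z \<in> strip" shows "sheet (z + 1) = sheet z + 1"
proof -
  have z1: "z + 1 \<in> strip" using strip_add_int[of z 1] assms by simp
  let ?S = "{k. sheet_term z k \<noteq> 0}"
  have term1: "sheet_term (z + 1) k = sheet_term z (k - 1) + of_bool (k = 1)" for k
    using sides_add_int(1)[of z 1 k] by (auto simp: sheet_term_def)
  define K where "K = insert 1 ((\<lambda>k. k + 1) ` ?S)"
  have finK: "finite K" using finite_sheet_term[OF assms] by (simp add: K_def)
  have "k \<in> K" if "sheet_term (z + 1) k \<noteq> 0" for k
  proof (cases "k = 1")
    case False
    then have "k - 1 \<in> ?S" using that term1[of k] by simp
    then show ?thesis unfolding K_def by (intro insertI2 image_eqI[of _ _ "k - 1"]) auto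
  qed (simp add: K_def)
  then have "sheet (z + 1) = (\<Sum>k\<in>K. sheet_term (z + 1) k)" using finK by (intro sheet_eq[OF z1]) auto
  also have "\<dots> = (\<Sum>k\<in>K. sheet_term z (k - 1)) + (\<Sum>k\<in>K. of_bool (k = 1))"
    by (simp only: term1 sum.distrib)
  also have "(\<Sum>k\<in>K. of_bool (k = 1)) = (1 :: int)" using finK by (simp add: K_def of_bool_def)
  also have "(\<Sum>k\<in>K. sheet_term z (k - 1)) = (\<Sum>k\<in>(\<lambda>k. k - 1) ` K. sheet_term z k)"
    by (simp add: sum.reindex inj_on_def)
  also have "\<dots> = sheet z"
    using finK by (intro sheet_eq[OF assms, symmetric]) (auto simp: K_def image_iff)
  finally show ?thesis .
qed

lemma sheet_add_int:
  assumes "z \<in> strip" shows "sheet (z + of_int m) = sheet z + m"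
proof (induction m rule: int_induct[where k = 0])
  case (step1 i)
  have "z + of_int (i + 1) = (z + of_int i) + 1" by simp
  then show ?case using step1 sheet_add_one[of "z + of_int i"] assms by (simp only: strip_add_int)
next
  case (step2 i)
  have "z + of_int i = (z + of_int (i - 1)) + 1" by simp
  then have "sheet (z + of_int i) = sheet (z + of_int (i - 1)) + 1"
    using sheet_add_one[of "z + of_int (i - 1)"] assms by (simp only: strip_add_int)
  then show ?case using step2 by simp
qed simp

text \<open>
  A crossing of \<open>h\<close> by \<open>e\<close> is a crossing of exactly one translate \<open>H + k\<close> by the fixed lift \<open>g\<close>.
  For a single translate the crossings are the jumps of the truth value of \<open>g u\<close> being to the
  east, so \<open>jump_count\<close> applies, and the result is summed over \<open>k\<close>.
\<close>

theorem rotor_eq_sheet_difference: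
  assumes e: "arc e" "path_image e \<subseteq> cylinder" "finite (path_image e \<inter> path_image h)"
    and ends: "e 0 \<notin> path_image h" "e 1 \<notin> path_image h" and g: "is_lift g e"
  shows "int (card {s. crosses_ccw h e s}) - int (card {s. crosses_cw h e s}) = sheet (g 1) - sheet (g 0)"
proof -
  have gs: "g s \<in> strip" "cyl_cover (g s) = e s" if "s \<in> {0..1}" for s
    using g that by (auto simp: is_lift_def path_image_def)
  have g_cont: "continuous_on {0..1} g" using g by (auto simp: is_lift_def path_def)
  define F where "F k = {s \<in> {0..1}. g s \<in> path_image (Hk k)}" for k
  define T where "T = {s \<in> {0..1}. e s \<in> path_image h}"
  have "finite (e -` (path_image e \<inter> path_image h) \<inter> {0..1})"
    using e(1,3) by (intro finite_vimage_IntI) (auto simp: arc_def)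
  moreover have "T \<subseteq> e -` (path_image e \<inter> path_image h) \<inter> {0..1}"
    by (auto simp: T_def path_image_def[of e])
  ultimately have finT: "finite T" using finite_subset by blast
  have F_T: "F k \<subseteq> T" for k using cover_on_chord gs by (fastforce simp: F_def T_def)
  then have finF: "finite (F k)" for k using finT finite_subset by blast
  have F_int: "F k \<subseteq> {0<..<1}" for k
  proof
    fix s assume "s \<in> F k"
    then have "s \<in> T" using F_T by blast
    then have "s \<noteq> 0" "s \<noteq> 1" "0 \<le> s" "s \<le> 1" using ends by (auto simp: T_def)
    then show "s \<in> {0<..<1}" by auto
  qed
  have F_disj: "k = l" if "s \<in> F k" "s \<in> F l" for s k l
    using that translates_disjoint by (auto simp: F_def)
  let ?E = "\<lambda>k u. g u \<in> east_of (Hk k)"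
  have const: "?E k x \<longleftrightarrow> ?E k y" if xy: "0 \<le> x" "x \<le> y" "y \<le> 1" "{x..y} \<inter> F k = {}" for k x y
  proof (rule side_transfer(1))
    have sub: "{x..y} \<subseteq> {0..1}" using xy by auto
    show "connected (g ` {x..y})"
      using continuous_on_subset[OF g_cont sub] by (intro connected_continuous_image) auto
    show "g ` {x..y} \<subseteq> strip - path_image (Hk k)" using xy(4) sub gs by (auto simp: F_def)
  qed (use xy in auto)
  have ev: "(\<forall>\<^sub>F u in at s within S. g u \<in> west_of (Hk k)) \<longleftrightarrow> (\<forall>\<^sub>F u in at s within S. \<not> ?E k u)"
    if s: "s \<in> {0<..<1}" for s S k
  proof (rule eventually_subst)
    have "\<forall>\<^sub>F u in at s. u \<in> {0<..<1} \<and> u \<notin> F k"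
      using s finF by (intro eventually_conj eventually_at_in_open' eventually_not_in_finite) auto
    then have "\<forall>\<^sub>F u in at s within S. u \<in> {0<..<1} \<and> u \<notin> F k"
      by (rule filter_leD[OF at_le, rotated]) simp
    then show "\<forall>\<^sub>F u in at s within S. (g u \<in> west_of (Hk k)) = (\<not> ?E k u)"
      by eventually_elim (use gs west_iff in \<open>auto simp: F_def\<close>)
  qed
  define U where "U k = {s \<in> F k. (\<forall>\<^sub>F u in at_left s. \<not> ?E k u) \<and> (\<forall>\<^sub>F u in at_right s. ?E k u)}" for k
  define D where "D k = {s \<in> F k. (\<forall>\<^sub>F u in at_left s. ?E k u) \<and> (\<forall>\<^sub>F u in at_right s. \<not> ?E k u)}" for k
  \<comment> \<open>any lifts of the chord and of the curve are simultaneously translated to some \<open>Hk k\<close> and \<open>g\<close>\<close>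
  have normal: "\<exists>k. s \<in> F k \<and> (\<forall>u\<in>{0..1}. (g' u \<in> west_of H' \<longleftrightarrow> g u \<in> west_of (Hk k)) \<and>
      (g' u \<in> east_of H' \<longleftrightarrow> g u \<in> east_of (Hk k)))"
    if lifts: "is_lift H' h" "is_lift g' e" "g' s \<in> path_image H'" "s \<in> {0<..<1}" for H' g' s
  proof -
    obtain a where a: "\<And>u. u \<in> {0..1} \<Longrightarrow> H' u = H u + of_int a" using lift_unique[OF lift_H lifts(1)] by blast
    obtain b where b: "\<And>u. u \<in> {0..1} \<Longrightarrow> g' u = g u + of_int b" using lift_unique[OF g lifts(2)] by blast
    have img: "path_image H' = path_image (Hk a)" using a by (auto simp: path_image_def)
    have "g' u \<in> west_of H' \<longleftrightarrow> g u \<in> west_of (Hk (a - b))" "g' u \<in> east_of H' \<longleftrightarrow> g u \<in> east_of (Hk (a - b))"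
      if "u \<in> {0..1}" for u
      using side_cong[OF img] b[OF that] sides_add_int[of "g u" b a] by simp_all
    moreover have "g s \<in> path_image (Hk (a - b))"
    proof -
      obtain t where "t \<in> {0..1}" "g s + of_int b = Hk a t"
        using lifts(3,4) b[of s] unfolding img by (auto simp: path_image_def)
      then show ?thesis unfolding path_image_def by (intro image_eqI[of _ _ t]) (auto simp: algebra_simps)
    qed
    ultimately show ?thesis using lifts(4) by (intro exI[of _ "a - b"]) (auto simp: F_def)
  qed
  have ev01: "\<forall>\<^sub>F u in at s within S. u \<in> {0..1}" if "s \<in> {0<..<1::real}" for s S
  proof -
    have "\<forall>\<^sub>F u in at s. u \<in> {0<..<1}" using that by (intro eventually_at_in_open') auto
    then have "\<forall>\<^sub>F u in at s within S. u \<in> {0<..<1}" by (rule filter_leD[OF at_le, rotated]) simp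
    then show ?thesis by eventually_elim auto
  qed
  have cross: "(\<exists>H' g'. is_lift H' h \<and> is_lift g' e \<and> g' s \<in> path_image H' \<and>
        (\<forall>\<^sub>F u in at_left s. g' u \<in> X H') \<and> (\<forall>\<^sub>F u in at_right s. g' u \<in> Y H')) \<longleftrightarrow>
      (\<exists>k. s \<in> F k \<and> (\<forall>\<^sub>F u in at_left s. g u \<in> X (Hk k)) \<and> (\<forall>\<^sub>F u in at_right s. g u \<in> Y (Hk k)))"
    (is "?l \<longleftrightarrow> ?r") if s: "s \<in> {0<..<1}" and XY: "(X, Y) \<in> {(west_of, east_of), (east_of, west_of)}" for s X Y
  proof
    assume ?l
    then obtain H' g' where *: "is_lift H' h" "is_lift g' e" "g' s \<in> path_image H'"
      "\<forall>\<^sub>F u in at_left s. g' u \<in> X H'" "\<forall>\<^sub>F u in at_right s. g' u \<in> Y H'" by blast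
    obtain k where k: "s \<in> F k" "\<And>u. u \<in> {0..1} \<Longrightarrow> g' u \<in> X H' \<longleftrightarrow> g u \<in> X (Hk k)"
      "\<And>u. u \<in> {0..1} \<Longrightarrow> g' u \<in> Y H' \<longleftrightarrow> g u \<in> Y (Hk k)" using normal[OF *(1-3) s] XY by blast
    have "\<forall>\<^sub>F u in at_left s. g u \<in> X (Hk k)" using *(4) ev01[OF s] by eventually_elim (use k in auto)
    moreover have "\<forall>\<^sub>F u in at_right s. g u \<in> Y (Hk k)" using *(5) ev01[OF s] by eventually_elim (use k in auto)
    ultimately show ?r using k(1) by blast
  next
    assume ?r
    then show ?l using is_lift_add_int[OF lift_H] g by (auto simp: F_def)
  qed
  have ccw: "crosses_ccw h e s \<longleftrightarrow> (\<exists>k. s \<in> U k)" and cw: "crosses_cw h e s \<longleftrightarrow> (\<exists>k. s \<in> D k)" for s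
  proof -
    have "crosses_ccw h e s \<longleftrightarrow> s \<in> {0<..<1} \<and> (\<exists>k. s \<in> U k)"
      using cross[of s west_of east_of] ev by (auto simp: crosses_ccw_def U_def)
    moreover have "crosses_cw h e s \<longleftrightarrow> s \<in> {0<..<1} \<and> (\<exists>k. s \<in> D k)"
      using cross[of s east_of west_of] ev by (auto simp: crosses_cw_def D_def)
    moreover have "U k \<subseteq> {0<..<1}" "D k \<subseteq> {0<..<1}" for k using F_int[of k] by (auto simp: U_def D_def)
    ultimately show "crosses_ccw h e s \<longleftrightarrow> (\<exists>k. s \<in> U k)" "crosses_cw h e s \<longleftrightarrow> (\<exists>k. s \<in> D k)" by blast+
  qed
  \<comment> \<open>only the translates that the curve meets contribute\<close>
  define K where "K = {k. F k \<noteq> {}}"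
  have "K \<subseteq> (\<lambda>s. THE k. s \<in> F k) ` T"
  proof
    fix k assume "k \<in> K"
    then obtain s where s: "s \<in> F k" by (auto simp: K_def)
    then have "(THE k. s \<in> F k) = k" using F_disj by (intro the_equality) auto
    then show "k \<in> (\<lambda>s. THE k. s \<in> F k) ` T" using s F_T by blast
  qed
  then have finK: "finite K" using finT finite_surj by blast
  have "{s. crosses_ccw h e s} = (\<Union>k\<in>K. U k)" "{s. crosses_cw h e s} = (\<Union>k\<in>K. D k)"
    using ccw cw by (auto simp: K_def U_def D_def)
  moreover have "card (\<Union>k\<in>K. U k) = (\<Sum>k\<in>K. card (U k))" "card (\<Union>k\<in>K. D k) = (\<Sum>k\<in>K. card (D k))"
    using finK finF F_disj by (auto intro!: card_UN_disjoint simp: U_def D_def)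
  ultimately have "int (card {s. crosses_ccw h e s}) - int (card {s. crosses_cw h e s})
      = (\<Sum>k\<in>K. int (card (U k)) - int (card (D k)))"
    by (simp add: sum_subtractf)
  also have "\<dots> = (\<Sum>k\<in>K. sheet_term (g 1) k - sheet_term (g 0) k)"
  proof (rule sum.cong)
    fix k
    have "int (card (U k)) - int (card (D k)) = of_bool (?E k 1) - of_bool (?E k 0)"
      unfolding U_def D_def using finF F_int const by (intro jump_count) auto
    then show "int (card (U k)) - int (card (D k)) = sheet_term (g 1) k - sheet_term (g 0) k"
      by (simp add: sheet_term_def)
  qed simp
  also have "\<dots> = (\<Sum>k\<in>K \<union> {k. sheet_term (g 1) k \<noteq> 0} \<union> {k. sheet_term (g 0) k \<noteq> 0}. sheet_term (g 1) k - sheet_term (g 0) k)"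
  proof (rule sum.mono_neutral_left)
    have "sheet_term (g 1) k = sheet_term (g 0) k" if "k \<notin> K" for k
      using that const[of 0 1 k] by (simp add: K_def sheet_term_def)
    then show "\<forall>k\<in>K \<union> {k. sheet_term (g 1) k \<noteq> 0} \<union> {k. sheet_term (g 0) k \<noteq> 0} - K.
        sheet_term (g 1) k - sheet_term (g 0) k = 0" by auto
  qed (use finK finite_sheet_term gs in auto)
  also have "\<dots> = sheet (g 1) - sheet (g 0)"
    unfolding sum_subtractf using finK finite_sheet_term gs
    by (intro arg_cong2[of _ _ _ _ minus] sheet_eq[symmetric]) auto
  finally show ?thesis .
qed

end

section \<open>Walks in the universal cover of a network\<close>

text \<open>
  The parameters \<open>\<theta>\<close> and \<open>\<phi>\<close> are angles of the sources and sinks in which the index 0 stands for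
  the ends of the chord, and \<open>H\<close> is the lift of the chord that starts and ends at the angles
  \<open>\<theta> 0\<close> and \<open>\<phi> 0\<close>.
\<close>

locale lifted_network = chord_lift "chord N" H
  for N :: cyl_network and H :: "real \<Rightarrow> complex" +
  fixes n :: nat and \<theta> \<phi> :: "nat \<Rightarrow> real"
  assumes n: "n \<ge> 1" and net: "cylindric_network n N"
    and \<theta>: "strict_mono_on {0..n} \<theta>" "\<theta> n < \<theta> 0 + 1" "H 0 = Complex (\<theta> 0) 0"
      "\<And>k. k \<in> {1..n} \<Longrightarrow> source N k = cyl_cover (Complex (\<theta> k) 0)"
    and \<phi>: "strict_mono_on {0..n} \<phi>" "\<phi> n < \<phi> 0 + 1" "H 1 = Complex (\<phi> 0) 1"
      "\<And>k. k \<in> {1..n} \<Longrightarrow> sink N k = cyl_cover (Complex (\<phi> k) 1)"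
begin

lemmas res_bounds = res_range[OF n]

sublocale G: fin_digraph "net_graph N"
  using net by (simp add: cylindric_network_def)

lemma net_graph_simps [simp]: "verts (net_graph N) = vertices N" "arcs (net_graph N) = edges N"
    "tail (net_graph N) = pathstart" "head (net_graph N) = pathfinish"
  by (simp_all add: net_graph_def)

lemma edge_properties: assumes "e \<in> edges N"
  shows "arc e" "path e" "path_image e \<subseteq> cylinder" "e ` {0<..<1} \<inter> vertices N = {}" "weight N e \<ge> 0"
    "finite (path_image e \<inter> path_image (chord N))"
    "pathstart e \<in> vertices N" "pathfinish e \<in> vertices N"
proof -
  show "arc e" "path_image e \<subseteq> cylinder" "e ` {0<..<1} \<inter> vertices N = {}" "weight N e \<ge> 0"
    "finite (path_image e \<inter> path_image (chord N))"
    using net assms by (auto simp: cylindric_network_def embedded_in_cylinder_def)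
  then show "path e" by (simp add: arc_imp_path)
  show "pathstart e \<in> vertices N" "pathfinish e \<in> vertices N"
    using G.tail_in_verts[of e] G.head_in_verts[of e] assms by simp_all
qed

lemma edges_disjoint: "e \<in> edges N \<Longrightarrow> f \<in> edges N \<Longrightarrow> e \<noteq> f \<Longrightarrow> e ` {0<..<1} \<inter> f ` {0<..<1} = {}"
  using net by (auto simp: cylindric_network_def embedded_in_cylinder_def)

lemma vertex_position: assumes "v \<in> vertices N" shows "v \<in> cylinder" "v \<notin> path_image (chord N)"
  using net assms by (auto simp: cylindric_network_def embedded_in_cylinder_def)

text \<open>
  The vertices of the universal cover are pairs \<open>(v, k)\<close> of a vertex and a sheet number. The lift of
  \<open>v\<close> to sheet 0 serves as the origin of the fibre.
\<close>

definition base :: "cyl_point \<Rightarrow> complex" where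
  "base v = (SOME z. cyl_cover z = v \<and> sheet z = 0)"

lemma base: assumes "v \<in> cylinder" shows "cyl_cover (base v) = v" "sheet (base v) = 0" "base v \<in> strip"
proof -
  obtain c y where v: "v = (c, y)" "norm c = 1" "0 \<le> y" "y \<le> 1" using assms by (auto simp: cylinder_def)
  then have "c = cis (Arg c)" by (metis cis_Arg norm_zero sgn_div_norm div_by_1 of_real_1 scaleR_one inverse_1 zero_neq_one sgn_eq divide_self_if)
  then have z: "cyl_cover (Complex (Arg c / (2 * pi)) y) = v" using v(1) by (simp add: cyl_cover_def)
  let ?z = "Complex (Arg c / (2 * pi)) y"
  have zs: "?z \<in> strip" using v by (simp add: strip_def)
  have "cyl_cover (?z + of_int (- sheet ?z)) = v" by (simp only: cyl_cover_add_int z)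
  moreover have "sheet (?z + of_int (- sheet ?z)) = 0" using sheet_add_int[OF zs, of "- sheet ?z"] by simp
  ultimately have "cyl_cover (base v) = v \<and> sheet (base v) = 0" unfolding base_def by (metis (mono_tags, lifting) someI_ex)
  then show "cyl_cover (base v) = v" "sheet (base v) = 0" "base v \<in> strip" 
    using assms cyl_cover_in_cylinder[of "base v"] by auto
qed

definition pos :: "cyl_point \<times> int \<Rightarrow> complex" where
  "pos x = base (fst x) + of_int (snd x)"

lemma pos: assumes "fst x \<in> cylinder" shows "cyl_cover (pos x) = fst x" "sheet (pos x) = snd x" "pos x \<in> strip"
  using base[OF assms] sheet_add_int[of "base (fst x)" "snd x"] by (simp_all add: pos_def)

lemma pos_eqI:
  assumes "z \<in> strip" "cyl_cover z = v" "sheet z = k" shows "z = pos (v, k)"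
proof -
  have v: "v \<in> cylinder" using assms cyl_cover_in_cylinder by blast
  obtain m :: int where m: "z = base v + of_int m"
    using assms(2) base(1)[OF v] cyl_cover_eq_iff[of "base v" z] by auto
  then have "k = m" using assms(3) sheet_add_int[OF base(3)[OF v], of m] base(2)[OF v] by simp
  then show ?thesis using m by (simp add: pos_def)
qed

definition rotor :: "(real \<Rightarrow> cyl_point) \<Rightarrow> int" where
  "rotor e = int (card {s. crosses_ccw (chord N) e s}) - int (card {s. crosses_cw (chord N) e s})"

lemma rot_Nil [simp]: "rot N [] = 0" and rot_Cons [simp]: "rot N (e # p) = rotor e + rot N p"
  by (simp_all add: rot_def rotor_def)

definition elift :: "(real \<Rightarrow> cyl_point) \<Rightarrow> real \<Rightarrow> complex" where
  "elift e = (SOME g. is_lift g e \<and> g 0 = base (pathstart e))"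

lemma elift:
  assumes "e \<in> edges N"
  shows "is_lift (elift e) e" "elift e 0 = base (pathstart e)" "elift e 1 = pos (pathfinish e, rotor e)"
proof -
  note e = edge_properties[OF assms]
  have "cyl_cover (base (pathstart e)) = e 0" using base(1)[OF vertex_position(1)[OF e(7)]] by (simp add: pathstart_def)
  then have "\<exists>g. is_lift g e \<and> g 0 = base (pathstart e)"
    using lift_exists[OF e(2,3)] by metis
  then have *: "is_lift (elift e) e \<and> elift e 0 = base (pathstart e)" unfolding elift_def by (rule someI_ex)
  then show l: "is_lift (elift e) e" "elift e 0 = base (pathstart e)" by auto
  have "rotor e = sheet (elift e 1) - sheet (elift e 0)"
    unfolding rotor_def using vertex_position(2)[OF e(7)] vertex_position(2)[OF e(8)]
    by (intro rotor_eq_sheet_difference e(1,3,6) l(1)) (auto simp: pathstart_def pathfinish_def)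
  then have "sheet (elift e 1) = rotor e" using l(2) base(2)[OF vertex_position(1)[OF e(7)]] by simp
  then show "elift e 1 = pos (pathfinish e, rotor e)"
    using l(1) by (intro pos_eqI) (auto simp: is_lift_def path_image_def pathfinish_def)
qed

lemma rotor_eqI:
  assumes "e \<in> edges N" "is_lift g e" shows "rotor e = sheet (g 1) - sheet (g 0)"
  unfolding rotor_def using vertex_position(2)[OF edge_properties(7)[OF assms(1)]] vertex_position(2)[OF edge_properties(8)[OF assms(1)]]
  by (intro rotor_eq_sheet_difference edge_properties[OF assms(1)] assms(2)) (auto simp: pathstart_def pathfinish_def)

definition step :: "cyl_point rel" where
  "step = (\<lambda>e. (pathstart e, pathfinish e)) ` edges N"

lemma step_walk: "(v, w) \<in> step\<^sup>+ \<Longrightarrow> \<exists>p. p \<noteq> [] \<and> G.awalk v p w"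
proof (induction rule: trancl_induct)
  case (base y)
  then obtain e where "e \<in> edges N" "v = pathstart e" "y = pathfinish e" by (auto simp: step_def)
  then have "G.awalk v [e] y" using G.arc_implies_awalk[of e] by simp
  then show ?case by blast
next
  case (step y z)
  then obtain p e where "G.awalk v p y" "p \<noteq> []" "e \<in> edges N" "y = pathstart e" "z = pathfinish e" by (auto simp: step_def)
  then have "G.awalk v (p @ [e]) z" using G.arc_implies_awalk[of e] by (auto intro: G.awalk_appendI)
  then show ?case by blast
qed

text \<open>
  A closed walk in a finite digraph contains a cycle.
\<close>

lemma step_acyclic: "(v, v) \<notin> step\<^sup>+"
proof
  assume "(v, v) \<in> step\<^sup>+"
  then obtain p where "p \<noteq> []" "G.awalk v p v" using step_walk by blast
  then have "G.closed_w p" unfolding G.closed_w_def by blast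
  then show False using G.closed_w_imp_cycle net by (auto simp: cylindric_network_def)
qed

text \<open>
  The number of vertices that can be reached drops along every edge, since an acyclic graph offers
  no way back to the tail.
\<close>

definition height :: "cyl_point \<times> int \<Rightarrow> nat" where
  "height x = card {w. (fst x, w) \<in> step\<^sup>+}"

lemma height_decreases:
  assumes "e \<in> edges N" shows "height (pathfinish e, k) < height (pathstart e, l)"
proof -
  have st: "(pathstart e, pathfinish e) \<in> step" using assms by (auto simp: step_def)
  have "finite step" using G.finite_arcs by (simp add: step_def)
  then have "finite {w. (v, w) \<in> step\<^sup>+}" for v
    by (intro finite_subset[OF _ finite_imageI[of "step\<^sup>+" snd]]) (force simp: finite_trancl)+
  moreover have "{w. (pathfinish e, w) \<in> step\<^sup>+} \<subset> {w. (pathstart e, w) \<in> step\<^sup>+}"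
    using st step_acyclic[of "pathfinish e"] by (auto intro: trancl_into_trancl2)
  ultimately show ?thesis unfolding height_def by (simp add: psubset_card_mono)
qed

text \<open>
  The walks in the universal cover, described by their projections: a projected walk determines
  its lift once the initial sheet is known, and the rotor gives the final sheet.
\<close>

definition walks :: "cyl_point \<times> int \<Rightarrow> cyl_point \<times> int \<Rightarrow> (real \<Rightarrow> cyl_point) list set" where
  "walks x y = {p. G.awalk (fst x) p (fst y) \<and> snd x + rot N p = snd y}"

definition out :: "cyl_point \<times> int \<Rightarrow> (real \<Rightarrow> cyl_point) set" where
  "out x = {e \<in> edges N. pathstart e = fst x}"

definition nxt :: "cyl_point \<times> int \<Rightarrow> (real \<Rightarrow> cyl_point) \<Rightarrow> cyl_point \<times> int" where
  "nxt x e = (pathfinish e, snd x + rotor e)"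

text \<open>
  The value at points other than vertices is chosen so that the recursion \<open>walk_sum_rec\<close>
  holds without restriction.
\<close>

definition walk_sum :: "cyl_point \<times> int \<Rightarrow> cyl_point \<times> int \<Rightarrow> real" where
  "walk_sum x y = (if fst x \<in> vertices N then (\<Sum>p\<in>walks x y. \<Prod>e\<leftarrow>p. weight N e) else of_bool (x = y))"

lemma finite_walks: "finite (walks x y)"
proof -
  have "p \<in> {p. set p \<subseteq> edges N \<and> length p \<le> card (vertices N)}" if "p \<in> walks x y" for p
  proof -
    have w: "G.awalk (fst x) p (fst y)" using that by (simp add: walks_def)
    have "G.apath (fst x) p (fst y)"
    proof (rule ccontr)
      assume "\<not> ?thesis"
      with w have "\<not> distinct (G.awalk_verts (fst x) p)" by (simp add: G.apath_def)
      with w obtain r where "G.closed_w r" using G.awalk_cyc_decompE'[of "fst x" p "fst y"] by metis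
      then show False using G.closed_w_imp_cycle net by (auto simp: cylindric_network_def)
    qed
    then have d: "distinct (G.awalk_verts (fst x) p)" by (simp add: G.apath_def)
    have "set (G.awalk_verts (fst x) p) \<subseteq> vertices N"
      using w G.awalk_verts_in_verts[of "fst x" p] unfolding G.awalk_def by auto
    then have "length (G.awalk_verts (fst x) p) \<le> card (vertices N)"
      using d G.finite_verts by (metis card_mono distinct_card net_graph_simps(1))
    then show ?thesis using w by (auto simp: G.awalk_def G.length_awalk_verts)
  qed
  then have "walks x y \<subseteq> {p. set p \<subseteq> edges N \<and> length p \<le> card (vertices N)}" by blast
  moreover have "finite \<dots>" using G.finite_arcs by (intro finite_lists_length_le) simp
  ultimately show ?thesis by (rule finite_subset)
qed

lemma walks_rec:
  assumes "fst x \<in> vertices N"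
  shows "walks x y = (if x = y then {[]} else {}) \<union> (\<Union>e\<in>out x. (#) e ` walks (nxt x e) y)"
proof (rule equalityI; rule subsetI)
  fix p assume p: "p \<in> walks x y"
  show "p \<in> (if x = y then {[]} else {}) \<union> (\<Union>e\<in>out x. (#) e ` walks (nxt x e) y)"
  proof (cases p)
    case Nil
    then show ?thesis using p by (simp add: walks_def G.awalk_Nil_iff prod_eq_iff)
  next
    case (Cons e q)
    then have "e \<in> out x" "q \<in> walks (nxt x e) y"
      using p by (auto simp: walks_def out_def nxt_def G.awalk_Cons_iff algebra_simps)
    then show ?thesis using Cons by blast
  qed
next
  fix p assume "p \<in> (if x = y then {[]} else {}) \<union> (\<Union>e\<in>out x. (#) e ` walks (nxt x e) y)"
  then show "p \<in> walks x y"
    using assms by (auto simp: walks_def out_def nxt_def G.awalk_Cons_iff G.awalk_Nil_iff split: if_splits)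
qed

lemma walk_sum_rec:
  "walk_sum x y = of_bool (x = y) + (\<Sum>e\<in>out x. weight N e * walk_sum (nxt x e) y)"
proof (cases "fst x \<in> vertices N")
  case True
  have fin: "finite (out x)" using G.finite_arcs by (simp add: out_def)
  let ?w = "\<lambda>p. \<Prod>e\<leftarrow>p. weight N e"
  have "walk_sum x y = sum ?w (if x = y then {[]} else {}) + sum ?w (\<Union>e\<in>out x. (#) e ` walks (nxt x e) y)"
    unfolding walk_sum_def using True fin finite_walks
    by (simp only: if_True walks_rec[OF True]) (intro sum.union_disjoint, auto)
  also have "sum ?w (\<Union>e\<in>out x. (#) e ` walks (nxt x e) y) = (\<Sum>e\<in>out x. sum ?w ((#) e ` walks (nxt x e) y))"
    using fin finite_walks by (intro sum.UNION_disjoint) auto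
  also have "\<dots> = (\<Sum>e\<in>out x. weight N e * walk_sum (nxt x e) y)"
  proof (rule sum.cong)
    fix e assume "e \<in> out x"
    then have "fst (nxt x e) \<in> vertices N" using edge_properties(8)[of e] by (simp add: out_def nxt_def)
    then show "sum ?w ((#) e ` walks (nxt x e) y) = weight N e * walk_sum (nxt x e) y"
      by (simp add: sum.reindex walk_sum_def sum_distrib_left)
  qed simp
  finally show ?thesis by simp
next
  case False
  then have "out x = {}" using edge_properties(7) unfolding out_def by force
  then show ?thesis using False by (simp add: walk_sum_def)
qed

sublocale W: weighted_acyclic out nxt "weight N" height walk_sum
proof
  show "finite (out v)" for v using G.finite_arcs by (simp add: out_def)
  show "height (nxt v e) < height v" if "e \<in> out v" for e v
    using that height_decreases[of e "snd v + rotor e" "snd v"] by (simp add: out_def nxt_def)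
  show "0 \<le> weight N e" if "e \<in> out v" for e v using that edge_properties(5) by (simp add: out_def)
qed (rule walk_sum_rec)

text \<open>
  The sources lie between the initial points of \<open>H\<close> and \<open>H + 1\<close>, hence in sheet 0, and
  likewise the sinks.
\<close>

lemma boundary_position:
  fixes \<psi> :: "nat \<Rightarrow> real"
  assumes y: "y = 0 \<or> y = 1" and "H y = Complex (\<psi> 0) y" "strict_mono_on {0..n} \<psi>" "\<psi> n < \<psi> 0 + 1"
  shows "1 \<le> k \<Longrightarrow> k \<le> n \<Longrightarrow> pos (cyl_cover (Complex (\<psi> k) y), m) = Complex (\<psi> k + of_int m) y"
proof -
  assume k: "1 \<le> k" "k \<le> n"
  have lt: "\<psi> 0 < \<psi> k" using assms(3) k by (auto simp: strict_mono_on_def)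
  have le: "\<psi> k \<le> \<psi> n" using assms(3) k by (cases "k = n") (auto simp: strict_mono_on_def less_imp_le)
  let ?z = "Complex (\<psi> k) y"
  have zs: "?z \<in> strip" using y by (auto simp: strip_def)
  have "?z \<in> east_of (Hk i) \<longleftrightarrow> i \<le> 0" for i
  proof
    assume "?z \<in> east_of (Hk i)"
    then have "?z \<notin> west_of (Hk i)" using not_east_and_west by blast
    then have "\<not> Re ?z < Re (Hk i y)" using boundary_side(2)[of ?z i] y by auto
    then have "\<psi> 0 + i \<le> \<psi> k" using assms(2) by simp
    then have "of_int i < (1 :: real)" using le assms(4) by linarith
    then show "i \<le> 0" by linarith
  next
    assume "i \<le> 0"
    then have "real_of_int i \<le> 0" by linarith
    then have "Re ?z > Re (Hk i y)" using lt assms(2) by simp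
    then show "?z \<in> east_of (Hk i)" using boundary_side(1)[of ?z i] y by auto
  qed
  then have "sheet ?z = 0" by (rule sheet_eqI[OF zs])
  then have "sheet (?z + of_int m) = m" using sheet_add_int[OF zs, of m] by simp
  then have "?z + of_int m = pos (cyl_cover ?z, m)" using zs by (intro pos_eqI) auto
  then show ?thesis by (simp add: complex_eq_iff)
qed

section \<open>Total nonnegativity of network matrices\<close>

lemma visits_start: "W.visits x S y \<Longrightarrow> x \<in> S"
  by (erule W.visits.cases) auto

text \<open>
  Every point of a lifted walk with vertex set \<open>S\<close> has this property. Which edges the walk uses is
  not recorded; it suffices that the tail of the edge lies in \<open>S\<close>.
\<close>

definition tracks :: "(cyl_point \<times> int) set \<Rightarrow> complex \<Rightarrow> bool" where
  "tracks S z \<longleftrightarrow> z \<in> pos ` S \<or>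
     (\<exists>e\<in>edges N. \<exists>k. (pathstart e, k) \<in> S \<and> z \<in> (\<lambda>s. elift e s + of_int k) ` {0<..<1})"

lemma tracks_mono: "tracks S z \<Longrightarrow> S \<subseteq> S' \<Longrightarrow> tracks S' z"
  unfolding tracks_def by blast

text \<open>
  The lifted edges are concatenated, each beginning at the lifted vertex at which its predecessor ends.
\<close>

lemma visits_path:
  assumes "W.visits x S y" "fst x \<in> vertices N"
  shows "\<exists>f. path f \<and> path_image f \<subseteq> strip \<and> pathstart f = pos x \<and> pathfinish f = pos y \<and>
      (\<forall>z\<in>path_image f. tracks S z) \<and> fst ` S \<subseteq> vertices N"
  using assms
proof (induction rule: W.visits.induct)
  case (stop v)
  then have "pos v \<in> strip" by (intro pos(3) vertex_position(1))
  then show ?case using stop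
    by (intro exI[of _ "\<lambda>_. pos v"]) (auto simp: path_def path_image_def pathstart_def pathfinish_def tracks_def)
next
  case (go e v S w)
  have e: "e \<in> edges N" "pathstart e = fst v" using go.hyps(1) by (auto simp: out_def)
  have "fst (nxt v e) \<in> vertices N" using edge_properties(8)[OF e(1)] by (simp add: nxt_def)
  from go.IH[OF this] obtain f where f: "path f" "path_image f \<subseteq> strip" "pathstart f = pos (nxt v e)" "pathfinish f = pos w"
    "\<And>z. z \<in> path_image f \<Longrightarrow> tracks S z" "fst ` S \<subseteq> vertices N" by blast
  let ?g = "\<lambda>s. elift e s + of_int (snd v)"
  have "is_lift ?g e" by (rule is_lift_add_int[OF elift(1)[OF e(1)]])
  then have g: "path ?g" "path_image ?g \<subseteq> strip" by (auto simp: is_lift_def)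
  have ends: "pathstart ?g = pos v" "pathfinish ?g = pos (nxt v e)"
    using elift(2,3)[OF e(1)] e(2) by (auto simp: pathstart_def pathfinish_def pos_def nxt_def)
  have "tracks (insert v S) z" if z: "z \<in> path_image ?g" for z
  proof -
    obtain s where s: "0 \<le> s" "s \<le> 1" "z = ?g s" using z by (auto simp: path_image_def)
    consider "s = 0" | "s = 1" | "s \<in> {0<..<1}" using s by (cases "s = 0 \<or> s = 1") auto
    then show ?thesis
    proof cases
      case 1
      then have "z = pos v" using s ends by (simp add: pathstart_def)
      then show ?thesis by (simp add: tracks_def)
    next
      case 2
      then have "z = pos (nxt v e)" using s ends by (simp add: pathfinish_def)
      then show ?thesis using visits_start[OF go.hyps(2)] by (simp add: tracks_def)
    next
      case 3
      then have "z \<in> ?g ` {0<..<1}" using s(3) by blast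
      moreover have "(pathstart e, snd v) \<in> insert v S" using e(2) by (simp add: prod_eq_iff)
      ultimately show ?thesis using e(1) unfolding tracks_def by blast
    qed
  qed
  moreover have "tracks (insert v S) z" if "z \<in> path_image f" for z using f(5)[OF that] by (rule tracks_mono) blast
  ultimately have "\<forall>z\<in>path_image (?g +++ f). tracks (insert v S) z"
    using ends f by (simp add: path_image_join ball_Un)
  moreover have "path (?g +++ f)" "path_image (?g +++ f) \<subseteq> strip" "pathstart (?g +++ f) = pos v" "pathfinish (?g +++ f) = pos w"
    using f g ends by (auto simp: path_image_join)
  moreover have "fst ` insert v S \<subseteq> vertices N" using f(6) go.prems by simp
  ultimately show ?case by blast
qed

text \<open>
  If \<open>z\<close> lies over a vertex, then its lift belongs to both sets. Otherwise \<open>z\<close> is an interior point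
  of two lifted edges, which coincide because the interiors of different edges are disjoint; their
  tail belongs to both sets.
\<close>

lemma tracks_common_vertex:
  assumes "tracks S z" "tracks S' z" "fst ` S \<subseteq> vertices N" "fst ` S' \<subseteq> vertices N"
  shows "S \<inter> S' \<noteq> {}"
proof -
  have inner: "cyl_cover z = e s" "e s \<notin> vertices N" if "e \<in> edges N" "s \<in> {0<..<1}" "z = elift e s + of_int k" for e s k
  proof -
    show "cyl_cover z = e s" using that elift(1)[OF that(1)] by (simp add: is_lift_def)
    have "e s \<in> e ` {0<..<1}" using that(2) by (rule imageI)
    then show "e s \<notin> vertices N" using edge_properties(4)[OF that(1)] by blast
  qed
  have outer: "cyl_cover z \<in> vertices N" if "z \<in> pos ` S''" "fst ` S'' \<subseteq> vertices N" for S''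
    using that pos(1) vertex_position(1) by auto
  show ?thesis
  proof (cases "cyl_cover z \<in> vertices N")
    case True
    then have "z \<in> pos ` S" "z \<in> pos ` S'"
      using assms(1,2) inner unfolding tracks_def by (metis (no_types, lifting) imageE)+
    then obtain x y where xy: "x \<in> S" "y \<in> S'" "pos x = pos y" by auto
    then have "fst x \<in> cylinder" "fst y \<in> cylinder" using assms(3,4) vertex_position(1) xy(1,2) by (metis image_subset_iff)+
    then have "x = y" using pos(1,2)[of x] pos(1,2)[of y] xy(3) by (simp add: prod_eq_iff)
    then show ?thesis using xy by blast
  next
    case False
    then have "z \<notin> pos ` S" "z \<notin> pos ` S'" using outer assms(3,4) by blast+
    note off = this
    obtain e k s where e: "e \<in> edges N" "(pathstart e, k) \<in> S" "s \<in> {0<..<1}" "z = elift e s + of_int k"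
      using assms(1) off(1) unfolding tracks_def by blast
    obtain e' k' s' where e': "e' \<in> edges N" "(pathstart e', k') \<in> S'" "s' \<in> {0<..<1}" "z = elift e' s' + of_int k'"
      using assms(2) off(2) unfolding tracks_def by blast
    have "e s = e' s'" using inner(1)[OF e(1,3,4)] inner(1)[OF e'(1,3,4)] by simp
    then have "e = e'" using edges_disjoint[OF e(1) e'(1)] e(3) e'(3) by (metis disjoint_iff imageI)
    moreover have "s = s'"
      using edge_properties(1)[OF e(1)] \<open>e s = e' s'\<close> \<open>e = e'\<close> e(3) e'(3) by (auto simp: arc_def inj_on_def)
    ultimately have "k = k'" using e(4) e'(4) by simp
    then show ?thesis using e(2) e'(2) \<open>e = e'\<close> by blast
  qed
qed

definition src :: "int \<Rightarrow> cyl_point \<times> int" where "src i = (source N (nat (res n i)), alpha n i)"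
definition snk :: "int \<Rightarrow> cyl_point \<times> int" where "snk j = (sink N (nat (res n j)), alpha n j)"

lemma src_vertex: "fst (src i) \<in> vertices N" and snk_vertex: "fst (snk i) \<in> vertices N"
  using net res_bounds(3)[of i] by (auto simp: cylindric_network_def src_def snk_def)

lemma network_matrix_walk_sum: "network_matrix n N i j = walk_sum (src i) (snk j)"
proof -
  have "ij_paths n N i j = walks (src i) (snk j)"
    by (auto simp: ij_paths_def walks_def src_def snk_def)
  then show ?thesis using src_vertex[of i] by (simp add: network_matrix_def walk_sum_def)
qed

lemma pos_src: "pos (src i) = Complex (\<theta> (nat (res n i)) + of_int (alpha n i)) 0"
  using boundary_position[of 0 \<theta>] \<theta> res_bounds(3)[of i] by (simp add: src_def)

lemma pos_snk: "pos (snk i) = Complex (\<phi> (nat (res n i)) + of_int (alpha n i)) 1"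
  using boundary_position[of 1 \<phi>] \<phi> res_bounds(3)[of i] by (simp add: snk_def)

text \<open>
  Angles of boundary points within one turn, continued periodically, increase along the integers.
\<close>

lemma unrolled_strict_mono:
  fixes \<psi> :: "nat \<Rightarrow> real"
  assumes "strict_mono_on {0..n} \<psi>" "\<psi> n < \<psi> 0 + 1" "i < j"
  shows "\<psi> (nat (res n i)) + of_int (alpha n i) < \<psi> (nat (res n j)) + of_int (alpha n j)"
proof -
  have ij: "res n i + int n * alpha n i < res n j + int n * alpha n j"
    using assms(3) alpha_eq[OF n, of i] alpha_eq[OF n, of j] by simp
  consider "alpha n i = alpha n j" | "alpha n i < alpha n j" | "alpha n j < alpha n i" by linarith
  then show ?thesis
  proof cases
    case 1
    then have "nat (res n i) < nat (res n j)" using ij res_bounds(1)[of i] by simp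
    then show ?thesis using 1 assms(1) res_bounds(3)[of i] res_bounds(3)[of j] by (auto simp: strict_mono_on_def)
  next
    case 2
    have le: "\<psi> k \<le> \<psi> n" if "k \<le> n" for k
      using assms(1) that by (cases "k = n") (auto simp: strict_mono_on_def less_imp_le)
    have lt: "\<psi> 0 < \<psi> k" if "1 \<le> k" "k \<le> n" for k
      using assms(1) that by (auto simp: strict_mono_on_def)
    have "real_of_int (alpha n i) + 1 \<le> real_of_int (alpha n j)" using 2 by linarith
    then show ?thesis using le[of "nat (res n i)"] lt[of "nat (res n j)"] res_bounds(3)[of i] res_bounds(3)[of j] assms(2) by simp
  next
    case 3
    then have "int n * (alpha n j + 1) \<le> int n * alpha n i" by (intro mult_left_mono) auto
    then show ?thesis using ij res_bounds(1,2)[of i] res_bounds(1,2)[of j] by (simp add: algebra_simps)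
  qed
qed

end

lemma permutation_no_inversion:
  assumes "\<sigma> permutes {..<m}" "\<And>a b. a < b \<Longrightarrow> b < m \<Longrightarrow> \<sigma> a < \<sigma> (b::nat)"
  shows "\<sigma> = id"
proof -
  have ge: "a \<le> \<sigma> a" if "a < m" for a
    using that
  proof (induction a)
    case (Suc a)
    then show ?case using assms(2)[of a "Suc a"] by simp
  qed simp
  have "(\<Sum>a<m. \<sigma> a) = (\<Sum>a<m. a)"
    using sum.permute[OF assms(1), of "\<lambda>a. a"] by (simp add: o_def)
  then have "\<sigma> a = a" if "a < m" for a
    using sum_mono_inv[of "\<lambda>a. a" "{..<m}" \<sigma> a] ge that by auto
  moreover have "\<sigma> a = a" if "\<not> a < m" for a using assms(1) that by (simp add: permutes_def)
  ultimately show ?thesis by (metis eq_id_iff)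
qed

context lifted_network
begin

text \<open>
  If a permutation has an inversion \<open>a < b\<close>, the walks that start at the \<open>a\<close>-th and the \<open>b\<close>-th
  chosen source cross each other in the strip and therefore share a vertex.
\<close>

theorem network_totally_nonneg: "totally_nonneg (network_matrix n N)"
  unfolding totally_nonneg_def network_matrix_walk_sum
proof (intro allI impI)
  fix m and I J :: "nat \<Rightarrow> int"
  assume I: "strict_mono_on {..<m} I" and J: "strict_mono_on {..<m} J"
  have Re_src: "Re (pos (src i)) < Re (pos (src j))" if "i < j" for i j
    using unrolled_strict_mono[OF \<theta>(1,2) that] by (simp add: pos_src)
  have Re_snk: "Re (pos (snk i)) < Re (pos (snk j))" if "i < j" for i j
    using unrolled_strict_mono[OF \<phi>(1,2) that] by (simp add: pos_snk)
  show "0 \<le> minor m (\<lambda>a b. walk_sum (src (I a)) (snk (J b)))"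
  proof (rule W.path_det_nonneg)
    show "inj_on (\<lambda>b. snk (J b)) {..<m}"
    proof (rule inj_onI)
      fix a b assume ab: "a \<in> {..<m}" "b \<in> {..<m}" "snk (J a) = snk (J b)"
      then have "\<not> J a < J b" "\<not> J b < J a" using Re_snk by (metis less_irrefl)+
      then show "a = b" using J ab(1,2) by (metis linorder_neqE_nat strict_mono_onD)
    qed
    show "out (snk (J b)) = {}" if "b < m" for b
    proof -
      have "out_degree (net_graph N) (fst (snk (J b))) = 0"
        using net res_bounds(3) by (simp add: cylindric_network_def snk_def)
      then have "out_arcs (net_graph N) (fst (snk (J b))) = {}"
        using G.finite_out_arcs by (simp add: out_degree_def)
      then show ?thesis by (auto simp: out_def out_arcs_def)
    qed
    fix \<sigma> S
    assume \<sigma>: "\<sigma> permutes {..<m}" and S: "\<And>a. a < m \<Longrightarrow> W.visits (src (I a)) (S a) (snk (J (\<sigma> a)))"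
      and disj: "\<And>a b. a < m \<Longrightarrow> b < m \<Longrightarrow> a \<noteq> b \<Longrightarrow> S a \<inter> S b = {}"
    show "\<sigma> = id"
    proof (rule permutation_no_inversion[OF \<sigma>], rule ccontr)
      fix a b assume ab: "a < b" "b < m" "\<not> \<sigma> a < \<sigma> b"
      then have am: "a < m" by simp
      have "\<sigma> a \<noteq> \<sigma> b" using permutes_inj[OF \<sigma>] ab(1) by (metis injD less_irrefl)
      then have "\<sigma> b < \<sigma> a" using ab(3) by simp
      moreover have "\<sigma> a < m" "\<sigma> b < m" using permutes_in_image[OF \<sigma>] am ab(2) by auto
      ultimately have Jlt: "J (\<sigma> b) < J (\<sigma> a)" by (intro strict_mono_onD[OF J]) auto
      have Ilt: "I a < I b" using ab am by (intro strict_mono_onD[OF I]) auto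
      obtain f where f: "path f" "path_image f \<subseteq> strip" "pathstart f = pos (src (I a))" "pathfinish f = pos (snk (J (\<sigma> a)))"
        "\<forall>z\<in>path_image f. tracks (S a) z" "fst ` S a \<subseteq> vertices N" using visits_path[OF S[OF am] src_vertex] by blast
      obtain g where g: "path g" "path_image g \<subseteq> strip" "pathstart g = pos (src (I b))" "pathfinish g = pos (snk (J (\<sigma> b)))"
        "\<forall>z\<in>path_image g. tracks (S b) z" "fst ` S b \<subseteq> vertices N" using visits_path[OF S[OF ab(2)] src_vertex] by blast
      have "path_image f \<inter> path_image g \<noteq> {}"
        using f g Re_src[OF Ilt] Re_snk[OF Jlt] by (intro paths_across_strip_meet) (auto simp: pos_src pos_snk)
      then obtain z where "z \<in> path_image f" "z \<in> path_image g" by blast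
      then have "S a \<inter> S b \<noteq> {}" using f g by (intro tracks_common_vertex[of _ z]) auto
      then show False using disj[OF am ab(2)] ab(1) by simp
    qed
  qed
qed

end

text \<open>
  The angles of the sinks are given only up to a common integer, which is adjusted to the end point
  of the chosen lift of the chord.
\<close>

lemma lifted_network_exists:
  assumes "n \<ge> 1" "cylindric_network n N"
  shows "\<exists>H \<theta> \<phi>. lifted_network N H n \<theta> \<phi>"
proof -
  let ?h = "chord N"
  note net = assms(2)
  obtain \<theta> where \<theta>: "strict_mono_on {0..n} \<theta>" "\<theta> n < \<theta> 0 + 1"
    "\<And>k. k \<in> {0..n} \<Longrightarrow> (if k = 0 then pathstart ?h else source N k) = cyl_cover (Complex (\<theta> k) 0)"
    using net by (auto simp: cylindric_network_def ccw_ordered_def)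
  obtain \<phi> where \<phi>: "strict_mono_on {0..n} \<phi>" "\<phi> n < \<phi> 0 + 1"
    "\<And>k. k \<in> {0..n} \<Longrightarrow> (if k = 0 then pathfinish ?h else sink N k) = cyl_cover (Complex (\<phi> k) 1)"
    using net by (auto simp: cylindric_network_def ccw_ordered_def)
  have h0: "?h 0 = cyl_cover (Complex (\<theta> 0) 0)" and h1: "?h 1 = cyl_cover (Complex (\<phi> 0) 1)"
    using \<theta>(3)[of 0] \<phi>(3)[of 0] by (simp_all add: pathstart_def pathfinish_def)
  have arc: "arc ?h" and int: "?h ` {0<..<1} \<subseteq> sphere 0 1 \<times> {0<..<1}"
    using net by (auto simp: cylindric_network_def)
  have "?h s \<in> cylinder" if s: "0 \<le> s" "s \<le> 1" for s
  proof -
    consider "s = 0" | "s = 1" | "s \<in> {0<..<1}" using s by (cases "s = 0 \<or> s = 1") auto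
    then show ?thesis
    proof cases
      case 1 then show ?thesis by (simp add: h0 cyl_cover_in_cylinder strip_def)
    next
      case 2 then show ?thesis by (simp add: h1 cyl_cover_in_cylinder strip_def)
    next
      case 3
      then have "?h s \<in> sphere 0 1 \<times> {0<..<1}" using int by blast
      then show ?thesis by (auto simp: cylinder_def)
    qed
  qed
  then have "path_image ?h \<subseteq> cylinder" by (auto simp: path_image_def)
  then obtain H where H: "is_lift H ?h" "H 0 = Complex (\<theta> 0) 0"
    using lift_exists[of ?h "Complex (\<theta> 0) 0"] arc h0 by (metis arc_imp_path)
  have "cyl_cover (H 1) = cyl_cover (Complex (\<phi> 0) 1)" using H(1) h1 by (simp add: is_lift_def)
  then obtain k :: int where k: "H 1 = Complex (\<phi> 0) 1 + of_int k" using cyl_cover_eq_iff by metis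
  define \<phi>' where "\<phi>' j = \<phi> j + of_int k" for j
  have \<phi>'c: "cyl_cover (Complex (\<phi>' j) 1) = cyl_cover (Complex (\<phi> j) 1)" for j
  proof -
    have "Complex (\<phi>' j) 1 = Complex (\<phi> j) 1 + of_int k" by (simp add: \<phi>'_def complex_eq_iff)
    then show ?thesis by (simp only: cyl_cover_add_int)
  qed
  have "lifted_network N H n \<theta> \<phi>'"
  proof
    show "snd (?h 0) = 0" "snd (?h 1) = 1" by (simp_all add: h0 h1 cyl_cover_def)
    show "strict_mono_on {0..n} \<phi>'" using \<phi>(1) by (auto simp: strict_mono_on_def \<phi>'_def)
    show "\<phi>' n < \<phi>' 0 + 1" using \<phi>(2) by (simp add: \<phi>'_def)
    show "H 1 = Complex (\<phi>' 0) 1" by (simp add: k \<phi>'_def complex_eq_iff)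
    show "source N j = cyl_cover (Complex (\<theta> j) 0)" if "j \<in> {1..n}" for j using \<theta>(3)[of j] that by simp
    show "sink N j = cyl_cover (Complex (\<phi>' j) 1)" if "j \<in> {1..n}" for j
      using \<phi>(3)[of j] that by (simp add: \<phi>'c)
  qed (use arc int H \<theta> assms in auto)
  then show ?thesis by blast
qed

section \<open>Determinants under elimination\<close>

text \<open>
  The row operation is multiplication by an upper unitriangular matrix.
\<close>

lemma det_subtract_next_rows:
  fixes f :: "nat \<Rightarrow> nat \<Rightarrow> real"
  shows "minor (Suc m) (\<lambda>a b. if a < m then f a b - c a * f (Suc a) b else f a b) =
    minor (Suc m) (\<lambda>a b. f a b)"
proof -
  let ?N = "Suc m"
  let ?F = "Matrix.mat ?N ?N (\<lambda>(a, b). f a b)"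
  define U where "U = Matrix.mat ?N ?N (\<lambda>(a, b). if b = a then 1 else if b = Suc a then - c a else 0)"
  have "Matrix.mat ?N ?N (\<lambda>(a, b). if a < m then f a b - c a * f (Suc a) b else f a b) = U * ?F"
  proof (rule eq_matI)
    fix a b assume "a < dim_row (U * ?F)" "b < dim_col (U * ?F)"
    then have ab: "a < ?N" "b < ?N" by (auto simp: U_def)
    then have "(U * ?F) $$ (a, b) =
        (\<Sum>k<?N. (if k = a then 1 else if k = Suc a then - c a else 0) * f k b)"
      by (auto simp: U_def scalar_prod_def atLeast0LessThan intro!: sum.cong)
    also have "\<dots> = (\<Sum>k<?N. (if k = a then f k b else 0) + (if k = Suc a then - c a * f k b else 0))"
      by (intro sum.cong) auto
    also have "\<dots> = (if a < m then f a b - c a * f (Suc a) b else f a b)"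
      using ab by (simp add: sum.distrib del: sum.lessThan_Suc)
    finally show "Matrix.mat ?N ?N (\<lambda>(a, b). if a < m then f a b - c a * f (Suc a) b else f a b) $$ (a, b)
        = (U * ?F) $$ (a, b)"
      using ab by simp
  qed (auto simp: U_def)
  moreover have "Determinant.det U = 1"
  proof -
    have "upper_triangular U" by (auto simp: U_def)
    moreover have "U \<in> carrier_mat ?N ?N" by (simp add: U_def)
    ultimately have "Determinant.det U = prod_list (diag_mat U)" by (rule det_upper_triangular)
    also have "diag_mat U = map (\<lambda>_. 1) [0..<?N]" by (auto simp: diag_mat_def U_def simp del: upt_Suc)
    finally show ?thesis by (simp add: map_replicate_const del: upt_Suc)
  qed
  ultimately show ?thesis
    using det_mult[of U ?N ?F] by (simp add: U_def)
qed

lemma det_last_col_unit: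
  fixes f :: "nat \<Rightarrow> nat \<Rightarrow> real"
  assumes "\<And>a. a < m \<Longrightarrow> f a m = 0"
  shows "minor (Suc m) (\<lambda>a b. f a b) =
    f m m * minor m (\<lambda>a b. f a b)"
proof -
  let ?F = "Matrix.mat (Suc m) (Suc m) (\<lambda>(a, b). f a b)"
  have "Determinant.det ?F = (\<Sum>a<Suc m. ?F $$ (a, m) * cofactor ?F a m)"
    by (intro laplace_expansion_column) auto
  also have "\<dots> = f m m * cofactor ?F m m"
    using assms by (simp add: sum.neutral)
  also have "mat_delete ?F m m = Matrix.mat m m (\<lambda>(a, b). f a b)"
    by (rule eq_matI) (auto simp: mat_delete_def)
  then have "cofactor ?F m m = minor m (\<lambda>a b. f a b)"
    by (simp add: cofactor_def)
  finally show ?thesis .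
qed

lemma det_zero_col:
  fixes f :: "nat \<Rightarrow> nat \<Rightarrow> real"
  assumes "b < m" "\<And>a. a < m \<Longrightarrow> f a b = 0"
  shows "minor m (\<lambda>a b. f a b) = 0"
proof -
  let ?F = "Matrix.mat m m (\<lambda>(a, b). f a b)"
  have "Determinant.det ?F = (\<Sum>a<m. ?F $$ (a, b) * cofactor ?F a b)"
    by (intro laplace_expansion_column) (use assms in auto)
  also have "\<dots> = 0" using assms by (intro sum.neutral) auto
  finally show ?thesis .
qed

lemma det_reverse_rows_cols:
  fixes f :: "nat \<Rightarrow> nat \<Rightarrow> real"
  shows "minor m (\<lambda>a b. f (m - 1 - a) (m - 1 - b)) =
    minor m (\<lambda>a b. f a b)"
proof -
  define \<rho> where "\<rho> a = (if a < m then m - 1 - a else a)" for a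
  have inv: "\<rho> (\<rho> a) = a" for a by (auto simp: \<rho>_def)
  have perm: "\<rho> permutes {0..<m}"
    by (rule bij_imp_permutes, rule bij_betw_byWitness[where f' = \<rho>]) (auto simp: inv, auto simp: \<rho>_def)
  have s: "signof \<rho> * signof \<rho> = (1 :: real)"
    by (simp add: sign_def)
  define g where "g = Matrix.mat m m (\<lambda>(a, b). f a b)"
  define g1 where "g1 = Matrix.mat m m (\<lambda>(a, b). f (\<rho> a) b)"
  have "Determinant.det g1 = signof \<rho> * Determinant.det g"
  proof -
    have "Matrix.mat m m (\<lambda>(i, j). g $$ (\<rho> i, j)) = g1"
      using perm by (intro eq_matI) (auto simp: g_def g1_def permutes_in_image[of \<rho> "{0..<m}", simplified])
    then show ?thesis using det_permute_rows[of g m \<rho>] perm by (simp add: g_def)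
  qed
  moreover have "minor m (\<lambda>a b. f (\<rho> a) (\<rho> b)) = signof \<rho> * Determinant.det g1"
  proof -
    let ?g2 = "Matrix.mat m m (\<lambda>(a, b). f (\<rho> a) (\<rho> b))"
    have "Matrix.mat m m (\<lambda>(i, j). (transpose_mat g1) $$ (\<rho> i, j)) = transpose_mat ?g2"
      using perm by (intro eq_matI) (auto simp: g1_def permutes_in_image[of \<rho> "{0..<m}", simplified])
    then have "Determinant.det (transpose_mat ?g2) = signof \<rho> * Determinant.det (transpose_mat g1)"
      using det_permute_rows[of "transpose_mat g1" m \<rho>] perm by (simp add: g1_def)
    then show ?thesis by (simp add: g1_def det_transpose[of _ m])
  qed
  moreover have "Matrix.mat m m (\<lambda>(a, b). f (m - 1 - a) (m - 1 - b)) = Matrix.mat m m (\<lambda>(a, b). f (\<rho> a) (\<rho> b))"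
    by (rule eq_matI) (auto simp: \<rho>_def)
  ultimately show ?thesis using s by (simp add: g_def mult.assoc[symmetric])
qed

section \<open>Periodic matrices and bidiagonal layers\<close>

definition periodic :: "nat \<Rightarrow> (int \<Rightarrow> int \<Rightarrow> real) \<Rightarrow> bool" where
  "periodic n X \<longleftrightarrow> (\<forall>i j. X (i + int n) (j + int n) = X i j)"

lemma periodic_shift:
  assumes "periodic n X" shows "X (i + int n * t) (j + int n * t) = X i j"
proof -
  have "X (i + (s + int n)) (j + (s + int n)) = X (i + s) (j + s)" for s
    using assms[unfolded periodic_def, rule_format, of "i + s" "j + s"] by (simp add: add_ac)
  then show ?thesis using periodic_int_mult[of "\<lambda>s. X (i + s) (j + s)" "int n" 0 t] by simp
qed

text \<open>
  The bound \<open>b\<close> limits the width of both bands, so that the entries of the product are the finite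
  sums in the last condition.
\<close>

definition right_inverse_within :: "int \<Rightarrow> (int \<Rightarrow> int \<Rightarrow> real) \<Rightarrow> (int \<Rightarrow> int \<Rightarrow> real) \<Rightarrow> bool" where
  "right_inverse_within b X Y \<longleftrightarrow>
     (\<forall>i j. X i j \<noteq> 0 \<longrightarrow> \<bar>j - i\<bar> \<le> b) \<and> (\<forall>i j. Y i j \<noteq> 0 \<longrightarrow> \<bar>j - i\<bar> \<le> b) \<and>
     (\<forall>i k. (\<Sum>j\<in>{i - b..i + b}. X i j * Y j k) = of_bool (i = k))"

text \<open>
  Only the rows have to be consecutive; the columns are arbitrary. This is the part of total
  nonnegativity that elimination preserves for evident reasons.
\<close>

definition solid_rows_nonneg :: "(int \<Rightarrow> int \<Rightarrow> real) \<Rightarrow> bool" where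
  "solid_rows_nonneg X \<longleftrightarrow> (\<forall>m p (J :: nat \<Rightarrow> int). strict_mono_on {..<m} J \<longrightarrow>
     minor m (\<lambda>a b. X (p + int a) (J b)) \<ge> 0)"

lemma solid_rows_nonneg_entry:
  assumes "solid_rows_nonneg X" shows "X i j \<ge> 0"
proof -
  have "Determinant.det (Matrix.mat 1 1 (\<lambda>(a, b). X (i + int a) ((\<lambda>_. j) b))) \<ge> 0"
  proof -
    have "strict_mono_on {..<1::nat} (\<lambda>_. j)" by (auto simp: strict_mono_on_def)
    then show ?thesis using assms unfolding solid_rows_nonneg_def by blast
  qed
  then show ?thesis by (simp add: det_single)
qed

lemma solid_rows_nonneg_two:
  assumes "solid_rows_nonneg X" "j < k"
  shows "X i j * X (i + 1) k \<ge> X i k * X (i + 1) j"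
proof -
  have "strict_mono_on {..<2} (\<lambda>b::nat. if b = 0 then j else k)"
    using assms(2) by (auto simp: strict_mono_on_def)
  then have "Determinant.det (Matrix.mat 2 2 (\<lambda>(a, b). X (i + int a) (if b = 0 then j else k))) \<ge> 0"
    using assms(1) unfolding solid_rows_nonneg_def by blast
  then show ?thesis
    by (simp add: laplace_expansion_row[of _ 2 0] cofactor_def mat_delete_def det_single numeral_2_eq_2)
qed

text \<open>
  Reversing both the rows and the columns of a square matrix preserves its determinant.
\<close>

lemma solid_rows_nonneg_reverse:
  assumes "solid_rows_nonneg X"
  shows "solid_rows_nonneg (\<lambda>i j. X (c - i) (c - j))"
  unfolding solid_rows_nonneg_def
proof (intro allI impI)
  fix m p and J :: "nat \<Rightarrow> int" assume J: "strict_mono_on {..<m} J"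
  let ?J = "\<lambda>b. c - J (m - 1 - b)"
  let ?p = "c - p - int (m - 1)"
  have "strict_mono_on {..<m} ?J"
    using J by (auto simp: strict_mono_on_def)
  then have "0 \<le> minor m (\<lambda>a b. X (?p + int a) (?J b))"
    using assms unfolding solid_rows_nonneg_def by blast
  also have "\<dots> = minor m (\<lambda>a b. X (?p + int (m - 1 - a)) (?J (m - 1 - b)))"
    by (rule det_reverse_rows_cols[of m "\<lambda>a b. X (?p + int a) (?J b)", symmetric])
  also have "Matrix.mat m m (\<lambda>(a, b). X (?p + int (m - 1 - a)) (?J (m - 1 - b)))
      = Matrix.mat m m (\<lambda>(a, b). X (c - (p + int a)) (c - J b))"
  proof (rule eq_matI)
    fix a b assume ab: "a < dim_row (Matrix.mat m m (\<lambda>(a, b). X (c - (p + int a)) (c - J b)))"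
      "b < dim_col (Matrix.mat m m (\<lambda>(a, b). X (c - (p + int a)) (c - J b)))"
    then have "int (m - 1 - a) = int (m - 1) - int a" "m - 1 - (m - 1 - b) = b" by auto
    then show "Matrix.mat m m (\<lambda>(a, b). X (?p + int (m - 1 - a)) (?J (m - 1 - b))) $$ (a, b)
      = Matrix.mat m m (\<lambda>(a, b). X (c - (p + int a)) (c - J b)) $$ (a, b)"
      using ab by (simp add: algebra_simps)
  qed auto
  finally show "0 \<le> minor m (\<lambda>a b. X (c - (p + int a)) (c - J b))" .
qed

lemma sum_window_superset:
  fixes f :: "int \<Rightarrow> real"
  assumes "finite T" "S \<subseteq> T" "\<And>j. j \<in> T - S \<Longrightarrow> f j = 0"
  shows "sum f T = sum f S"
  using assms by (metis sum.mono_neutral_right)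

lemma right_inverse_within_sum:
  assumes "right_inverse_within b X Y" "finite T" "{i - b..i + b} \<subseteq> T"
  shows "(\<Sum>j\<in>T. X i j * Y j k) = of_bool (i = k)"
proof -
  have "X i j = 0" if "j \<in> T - {i - b..i + b}" for j
    using assms(1) that unfolding right_inverse_within_def by (force simp: abs_le_iff)
  then have "(\<Sum>j\<in>T. X i j * Y j k) = (\<Sum>j\<in>{i - b..i + b}. X i j * Y j k)"
    using assms(2,3) by (intro sum_window_superset) auto
  then show ?thesis using assms(1) by (simp add: right_inverse_within_def)
qed

lemma right_inverse_within_reverse:
  assumes "right_inverse_within b X Y"
  shows "right_inverse_within b (\<lambda>i j. X (c - i) (c - j)) (\<lambda>i j. Y (c - i) (c - j))"
proof -
  have "(\<Sum>j\<in>{i - b..i + b}. X (c - i) (c - j) * Y (c - j) (c - k)) = of_bool (i = k)" for i k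
  proof -
    have "(\<Sum>j\<in>{i - b..i + b}. X (c - i) (c - j) * Y (c - j) (c - k)) =
        (\<Sum>j\<in>{c - i - b..c - i + b}. X (c - i) j * Y j (c - k))"
      by (rule sum.reindex_bij_witness[of _ "\<lambda>j. c - j" "\<lambda>j. c - j"]) auto
    then show ?thesis using assms by (simp add: right_inverse_within_def)
  qed
  moreover have "\<bar>j - i\<bar> \<le> b" if "Z (c - i) (c - j) \<noteq> 0" "\<And>i j. Z i j \<noteq> 0 \<Longrightarrow> \<bar>j - i\<bar> \<le> b"
    for Z :: "int \<Rightarrow> int \<Rightarrow> real" and i j
    using that(2)[OF that(1)] by simp
  ultimately show ?thesis using assms unfolding right_inverse_within_def by blast
qed

text \<open>
  Writing \<open>C\<close> for the matrix with entries \<open>c i\<close> at \<open>(i, i + 1)\<close>, the hypothesis on \<open>c\<close> says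
  \<open>C\<^sup>2 = 0\<close>. Hence \<open>1 - C\<close> has the banded inverse \<open>1 + C\<close>, and \<open>Y (1 + C)\<close> is a right inverse
  of \<open>(1 - C) X\<close>.
\<close>

lemma right_inverse_within_subtract_rows:
  assumes XY: "right_inverse_within b X Y" and c: "\<And>k. c k * c (k + 1) = 0"
  shows "\<exists>b' Y'. right_inverse_within b' (\<lambda>i j. X i j - c i * X (i + 1) j) Y'"
proof (intro exI)
  let ?Z = "\<lambda>i j. X i j - c i * X (i + 1) j"
  let ?Y = "\<lambda>j k. Y j k + Y j (k - 1) * c (k - 1)"
  have b: "X i j \<noteq> 0 \<Longrightarrow> \<bar>j - i\<bar> \<le> b" "Y i j \<noteq> 0 \<Longrightarrow> \<bar>j - i\<bar> \<le> b" for i j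
    using XY by (auto simp: right_inverse_within_def)
  show "right_inverse_within (b + 1) ?Z ?Y"
    unfolding right_inverse_within_def
  proof (intro conjI allI impI)
    fix i j assume "?Z i j \<noteq> 0"
    then have "X i j \<noteq> 0 \<or> X (i + 1) j \<noteq> 0" by auto
    then show "\<bar>j - i\<bar> \<le> b + 1" using b(1)[of i j] b(1)[of "i + 1" j] by linarith
  next
    fix i j assume "?Y i j \<noteq> 0"
    then have "Y i j \<noteq> 0 \<or> Y i (j - 1) \<noteq> 0" by auto
    then show "\<bar>j - i\<bar> \<le> b + 1" using b(2)[of i j] b(2)[of i "j - 1"] by linarith
  next
    fix i k
    let ?T = "{i - (b + 1)..i + (b + 1)}"
    have s: "(\<Sum>j\<in>?T. X i j * Y j k) = of_bool (i = k)"
      "(\<Sum>j\<in>?T. X (i + 1) j * Y j k) = of_bool (i + 1 = k)" for k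
      by (rule right_inverse_within_sum[OF XY]; force)+
    have "(\<Sum>j\<in>?T. ?Z i j * ?Y j k) =
      (\<Sum>j\<in>?T. X i j * Y j k) + c (k - 1) * (\<Sum>j\<in>?T. X i j * Y j (k - 1))
      - c i * (\<Sum>j\<in>?T. X (i + 1) j * Y j k) - c i * c (k - 1) * (\<Sum>j\<in>?T. X (i + 1) j * Y j (k - 1))"
      by (simp add: sum_distrib_left sum.distrib[symmetric] sum_subtractf[symmetric] algebra_simps)
    also have "\<dots> = of_bool (i = k)"
      unfolding s using c[of i] by (auto simp: algebra_simps)
    finally show "(\<Sum>j\<in>?T. ?Z i j * ?Y j k) = of_bool (i = k)" .
  qed
qed

text \<open>
  The layer \<open>(s, d, u)\<close> stands for the bidiagonal matrix with entries \<open>d i\<close> at \<open>(i, i)\<close> and \<open>u i\<close>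
  at \<open>(i, i + s)\<close>, upper or lower according to the sign of \<open>s\<close>. Diagonal matrices and the two
  shifts are layers as well.
\<close>

type_synonym layer = "int \<times> (int \<Rightarrow> real) \<times> (int \<Rightarrow> real)"

definition layer_ok :: "nat \<Rightarrow> layer \<Rightarrow> bool" where
  "layer_ok n = (\<lambda>(s, d, u). s \<in> {1, -1} \<and> (\<forall>i. d i \<ge> 0 \<and> u i \<ge> 0) \<and>
     (\<forall>i. d (i + int n) = d i \<and> u (i + int n) = u i))"

fun layer_mult :: "layer \<Rightarrow> (int \<Rightarrow> int \<Rightarrow> real) \<Rightarrow> int \<Rightarrow> int \<Rightarrow> real" where
  "layer_mult (s, d, u) X = (\<lambda>i j. d i * X i j + u i * X (i + s) j)"

definition layers_prod :: "layer list \<Rightarrow> int \<Rightarrow> int \<Rightarrow> real" where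
  "layers_prod Ls = foldr layer_mult Ls (\<lambda>i j. of_bool (i = j))"

text \<open>
  Reversal turns upper bidiagonal layers into lower ones.
\<close>

lemma layers_prod_reverse:
  assumes "\<forall>l\<in>set Ls. layer_ok n l"
  shows "\<exists>Ls'. (\<forall>l\<in>set Ls'. layer_ok n l) \<and> layers_prod Ls' = (\<lambda>i j. layers_prod Ls (c - i) (c - j))"
  using assms
proof (induction Ls)
  case Nil
  have "layers_prod [] = (\<lambda>i j. layers_prod [] (c - i) (c - j))"
    by (auto simp: layers_prod_def fun_eq_iff)
  then show ?case by (intro exI[of _ "[]"]) auto
next
  case (Cons l Ls)
  then obtain Ls' where Ls': "\<forall>l\<in>set Ls'. layer_ok n l"
    "layers_prod Ls' = (\<lambda>i j. layers_prod Ls (c - i) (c - j))" by auto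
  obtain s d u where l: "l = (s, d, u)" by (cases l)
  let ?l = "(- s, \<lambda>i. d (c - i), \<lambda>i. u (c - i))"
  have per: "f (c - (i + int n)) = f (c - i)" if "\<forall>i. f (i + int n) = f i" for f :: "int \<Rightarrow> real" and i
    using that[rule_format, of "c - (i + int n)"] by (simp add: algebra_simps)
  have "layer_ok n ?l"
    using Cons.prems per by (auto simp: layer_ok_def l)
  moreover have "layers_prod (?l # Ls') = (\<lambda>i j. layers_prod (l # Ls) (c - i) (c - j))"
    using Ls'(2) by (simp add: layers_prod_def l fun_eq_iff algebra_simps)
  ultimately show ?case using Ls'(1) by (intro exI[of _ "?l # Ls'"]) auto
qed

lemma shift_layers_prod:
  "\<exists>Ls. (\<forall>l\<in>set Ls. layer_ok n l) \<and> layers_prod Ls = (\<lambda>i j. of_bool (j = i + r))"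
proof -
  have *: "\<exists>Ls. (\<forall>l\<in>set Ls. layer_ok n l) \<and> layers_prod Ls = (\<lambda>i j. of_bool (j = i + s * int k))"
    if s: "s \<in> {1, -1}" for s k
  proof (induction k)
    case 0
    show ?case by (intro exI[of _ "[]"]) (auto simp: layers_prod_def fun_eq_iff)
  next
    case (Suc k)
    then obtain Ls where Ls: "\<forall>l\<in>set Ls. layer_ok n l" "layers_prod Ls = (\<lambda>i j. of_bool (j = i + s * int k))"
      by blast
    let ?l = "(s, \<lambda>_. 0, \<lambda>_. 1)"
    have "layer_ok n ?l" using s by (auto simp: layer_ok_def)
    moreover have "layers_prod (?l # Ls) = layer_mult ?l (layers_prod Ls)"
      by (simp add: layers_prod_def)
    then have "layers_prod (?l # Ls) = (\<lambda>i j. of_bool (j = i + s * int (Suc k)))"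
      using Ls(2) by (simp add: fun_eq_iff algebra_simps)
    ultimately show ?case using Ls(1) by (intro exI[of _ "?l # Ls"]) auto
  qed
  show ?thesis
    using *[of 1 "nat r"] *[of "-1" "nat (- r)"] by (cases "r \<ge> 0") auto
qed

section \<open>Elimination of a periodic banded matrix\<close>

definition rightmost :: "(int \<Rightarrow> int \<Rightarrow> real) \<Rightarrow> int \<Rightarrow> int" where
  "rightmost X i = Max {j. X i j \<noteq> 0}"

context
  fixes n :: nat and X Y :: "int \<Rightarrow> int \<Rightarrow> real" and b :: int
  assumes n: "n \<ge> 1" and per: "periodic n X" and inv: "right_inverse_within b X Y"
    and solid: "solid_rows_nonneg X"
begin

lemma row_finite: "finite {j. X i j \<noteq> 0}"
proof (rule finite_subset)
  show "{j. X i j \<noteq> 0} \<subseteq> {i - b..i + b}"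
    using inv by (force simp: right_inverse_within_def abs_le_iff)
qed simp

lemma row_nonempty: "{j. X i j \<noteq> 0} \<noteq> {}"
proof
  assume "{j. X i j \<noteq> 0} = {}"
  then have "(\<Sum>j\<in>{i - b..i + b}. X i j * Y j i) = 0" by (intro sum.neutral) auto
  then show False using inv by (simp add: right_inverse_within_def)
qed

lemma rightmost_nonzero: "X i (rightmost X i) > 0"
proof -
  have "X i (rightmost X i) \<noteq> 0"
    using Max_in[OF row_finite row_nonempty, of i] by (simp add: rightmost_def)
  then show ?thesis using solid_rows_nonneg_entry[OF solid, of i "rightmost X i"] by simp
qed

lemma le_rightmost: "X i j \<noteq> 0 \<Longrightarrow> j \<le> rightmost X i"
  using Max_ge[OF row_finite, of j i] by (simp add: rightmost_def)

lemma rightmost_eqI: "X i j \<noteq> 0 \<Longrightarrow> (\<And>k. X i k \<noteq> 0 \<Longrightarrow> k \<le> j) \<Longrightarrow> rightmost X i = j"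
  using rightmost_nonzero[of i] le_rightmost[of i j] by (intro antisym) auto

lemma rightmost_add: "rightmost X (i + int n) = rightmost X i + int n"
proof (rule rightmost_eqI)
  show "X (i + int n) (rightmost X i + int n) \<noteq> 0"
    using per rightmost_nonzero[of i] by (simp add: periodic_def)
next
  fix k assume "X (i + int n) k \<noteq> 0"
  then have "X i (k - int n) \<noteq> 0"
    using per[unfolded periodic_def, rule_format, of i "k - int n"] by simp
  then show "k \<le> rightmost X i + int n" using le_rightmost by force
qed

text \<open>
  Otherwise rows \<open>i\<close> and \<open>i + 1\<close> and the two columns in which they end form a negative minor.
\<close>

lemma rightmost_mono_step: "rightmost X i \<le> rightmost X (i + 1)"
proof (rule ccontr)
  assume "\<not> ?thesis"
  then have lt: "rightmost X (i + 1) < rightmost X i" by simp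
  then have z: "X (i + 1) (rightmost X i) = 0" using le_rightmost[of "i + 1" "rightmost X i"] by force
  have "X i (rightmost X i) * X (i + 1) (rightmost X (i + 1)) \<le> 0"
    using solid_rows_nonneg_two[OF solid lt, of i] z by simp
  then show False
    using mult_pos_pos[OF rightmost_nonzero[of i] rightmost_nonzero[of "i + 1"]] by simp
qed

lemma rightmost_mono: "i \<le> k \<Longrightarrow> rightmost X i \<le> rightmost X k"
proof (induction k rule: int_ge_induct)
  case (step k)
  then show ?case using rightmost_mono_step[of k] by linarith
qed simp

text \<open>
  Over a period of \<open>n\<close> steps \<open>rightmost X\<close> increases by \<open>n\<close>, so strict increase leaves no room for
  steps larger than 1.
\<close>

lemma rightmost_affine:
  assumes "\<And>i. rightmost X i < rightmost X (i + 1)"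
  shows "rightmost X i = rightmost X 0 + i"
proof -
  have ge: "rightmost X i + int k \<le> rightmost X (i + int k)" for i k
  proof (induction k)
    case (Suc k)
    then show ?case using assms[of "i + int k"] by (simp add: algebra_simps)
  qed simp
  have step: "rightmost X (i + 1) = rightmost X i + 1" for i
    using ge[of "i + 1" "n - 1"] rightmost_add[of i] assms[of i] n by (simp add: of_nat_diff)
  show ?thesis
  proof (induction i rule: int_induct[where k = 0])
    case (step1 i)
    then show ?case using step[of i] by linarith
  next
    case (step2 i)
    then show ?case using step[of "i - 1"] by simp
  qed simp
qed

lemma exists_plateau_start:
  assumes "\<not> (\<forall>i. rightmost X i < rightmost X (i + 1))"
  shows "\<exists>i. rightmost X (i - 1) < rightmost X i \<and> rightmost X i = rightmost X (i + 1)"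
proof -
  obtain i where i: "rightmost X i = rightmost X (i + 1)"
    using assms rightmost_mono_step by (meson antisym not_less)
  define k where "k = (LEAST k. rightmost X (i - int k - 1) < rightmost X i)"
  have "rightmost X (i - int (n - 1) - 1) < rightmost X i"
    using rightmost_add[of "i - int n"] n by (simp add: of_nat_diff)
  then have k: "rightmost X (i - int k - 1) < rightmost X i"
    unfolding k_def by (rule LeastI)
  have eq: "rightmost X (i - int k') = rightmost X i" if "k' \<le> k" for k'
  proof (cases k')
    case (Suc l)
    then have "\<not> rightmost X (i - int l - 1) < rightmost X i"
      using that not_less_Least[of l "\<lambda>k. rightmost X (i - int k - 1) < rightmost X i"]
      by (simp add: k_def)
    then show ?thesis using rightmost_mono[of "i - int k'" i] Suc by (simp add: algebra_simps)
  qed simp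
  have "rightmost X (i - int k + 1) = rightmost X i"
  proof (cases k)
    case 0 then show ?thesis using i by simp
  next
    case (Suc l) then show ?thesis using eq[of l] by (simp add: algebra_simps)
  qed
  then show ?thesis using k eq[of k] by (intro exI[of _ "i - int k"]) auto
qed

end

text \<open>
  The first row \<open>i0\<close> of a plateau is shortened with the help of the next one, simultaneously in all
  rows congruent to \<open>i0\<close>. A minor of the new matrix with rows \<open>p, \<dots>, q\<close> arises from the old
  rows by operations among themselves, unless \<open>q\<close> is congruent to \<open>i0\<close>. In this case append
  row \<open>q + 1\<close> and the column in which the rows \<open>q\<close> and \<open>q + 1\<close> end. After the row operations
  this column vanishes in the rows \<open>p, \<dots>, q\<close>, so the old minor with rows \<open>p, \<dots>, q + 1\<close> and
  the enlarged set of columns is the new minor times the positive entry in row \<open>q + 1\<close> and the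
  appended column. If this column is not to the right of all given columns, then the new minor has
  a zero column.
\<close>

lemma elimination_step:
  assumes n: "n \<ge> 1" and per: "periodic n X" and inv: "right_inverse_within b X Y"
    and solid: "solid_rows_nonneg X"
    and i0: "rightmost X (i0 - 1) < rightmost X i0" "rightmost X i0 = rightmost X (i0 + 1)"
  obtains l X' b' Y' where "layer_ok n l" "X = layer_mult l X'" "periodic n X'"
    "right_inverse_within b' X' Y'" "solid_rows_nonneg X'"
    "\<And>i j. X i j = 0 \<Longrightarrow> X' i j = 0" "X' i0 (rightmost X i0) = 0" "X i0 (rightmost X i0) \<noteq> 0"
proof -
  note asm = n per inv solid
  note R = rightmost_nonzero[OF asm] le_rightmost[OF asm] rightmost_add[OF asm] rightmost_mono[OF asm]
  let ?R = "rightmost X"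
  define r where "r = X i0 (?R i0) / X (i0 + 1) (?R i0)"
  have pos: "X i0 (?R i0) > 0" "X (i0 + 1) (?R i0) > 0" using R(1)[of i0] R(1)[of "i0 + 1"] i0 by auto
  then have r: "r > 0" by (simp add: r_def)
  define c where "c k = (if int n dvd k - i0 then r else 0)" for k
  have n2: "n \<noteq> 1"
  proof
    assume "n = 1"
    then show False using R(3)[of i0] i0 by simp
  qed
  with n have n2: "n \<ge> 2" by simp
  have cc: "c k * c (k + 1) = 0" for k
  proof -
    have "\<not> (int n dvd k - i0 \<and> int n dvd k + 1 - i0)"
      using n2 by (metis add.commute add_diff_eq dvd_add_right_iff int_ops(2) nat_dvd_1_iff_1
          of_nat_dvd_iff One_nat_def Suc_1 Suc_n_not_le_n)
    then show ?thesis by (auto simp: c_def)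
  qed
  have cper: "c (k + int n) = c k" for k
    by (simp add: c_def) (metis add_diff_eq add.commute dvd_add_triv_left_iff)
  let ?Z = "\<lambda>i j. X i j - c i * X (i + 1) j"
  note shift = periodic_shift[OF per]
  have Rshift: "?R (i + int n * t) = ?R i + int n * t" for i t
    by (rule rightmost_eqI[OF asm])
      (use R(1)[of i] shift[of i t "?R i"] R(2)[of i "_ - int n * t"] shift[of i t "_ - int n * t"] in \<open>auto simp: algebra_simps\<close>)
  have cD: "\<exists>t. k = i0 + int n * t" if "c k \<noteq> 0" for k
    using that by (auto simp: c_def dvd_def algebra_simps split: if_splits)
  have plateau: "?R (q - 1) < ?R q" "?R (q + 1) = ?R q" "X q (?R q) = c q * X (q + 1) (?R q)" "X (q + 1) (?R q) > 0"
    if q: "c q \<noteq> 0" for q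
  proof -
    obtain t where t: "q = i0 + int n * t" using cD[OF q] by blast
    have "c q = r" using q by (auto simp: c_def split: if_splits)
    moreover have "X q (?R q) = X i0 (?R i0)" "X (q + 1) (?R q) = X (i0 + 1) (?R i0)"
      using t shift[of i0 t "?R i0"] shift[of "i0 + 1" t "?R i0"] Rshift[of i0 t] by (auto simp: algebra_simps)
    ultimately show "X q (?R q) = c q * X (q + 1) (?R q)" "X (q + 1) (?R q) > 0"
      using pos by (auto simp: r_def)
    show "?R (q - 1) < ?R q" "?R (q + 1) = ?R q"
      using t i0 Rshift[of i0 t] Rshift[of "i0 - 1" t] Rshift[of "i0 + 1" t] by (auto simp: algebra_simps)
  qed
  \<comment> \<open>from the column in which row \<open>q\<close> ended onwards, the new rows up to \<open>q\<close> vanish\<close>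
  have vanish: "?Z k j = 0" if q: "c q \<noteq> 0" and k: "k \<le> q" and j: "j \<ge> ?R q" for q k j
  proof (cases "k = q")
    case True
    show ?thesis
    proof (cases "j = ?R q")
      case False
      then have "X q j = 0" "X (q + 1) j = 0" using j R(2)[of q j] R(2)[of "q + 1" j] plateau(2)[OF q] by force+
      then show ?thesis using True by simp
    qed (use plateau(3)[OF q] True in simp)
  next
    case False
    have Xz: "X k' j = 0" if "k' \<le> q - 1" for k'
      using R(4)[OF that] plateau(1)[OF q] j R(2)[of k' j] by force
    show ?thesis
    proof (cases "k = q - 1")
      case True
      then have "c k = 0" using cc[of k] q by simp
      then show ?thesis using Xz[of k] True by simp
    next
      case 2: False
      then show ?thesis using Xz[of k] Xz[of "k + 1"] False k by simp
    qed
  qed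
  have solidZ: "solid_rows_nonneg ?Z"
    unfolding solid_rows_nonneg_def
  proof (intro allI impI)
    fix m p and J :: "nat \<Rightarrow> int" assume J: "strict_mono_on {..<m} J"
    show "0 \<le> minor m (\<lambda>a b. ?Z (p + int a) (J b))"
    proof (cases m)
      case (Suc l)
      let ?q = "p + int l"
      show ?thesis
      proof (cases "c ?q = 0")
        case True
        have "Matrix.mat m m (\<lambda>(a, b). ?Z (p + int a) (J b)) = Matrix.mat (Suc l) (Suc l)
            (\<lambda>(a, b). if a < l then X (p + int a) (J b) - c (p + int a) * X (p + int (Suc a)) (J b)
                     else X (p + int a) (J b))"
          by (rule eq_matI) (use Suc True in \<open>auto simp: less_Suc_eq algebra_simps\<close>)
        also have "Determinant.det \<dots> = minor m (\<lambda>a b. X (p + int a) (J b))"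
          unfolding Suc using det_subtract_next_rows[where f = "\<lambda>a b. X (p + int a) (J b)" and c = "\<lambda>a. c (p + int a)"] .
        also have "\<dots> \<ge> 0" using solid J unfolding solid_rows_nonneg_def by blast
        finally show ?thesis .
      next
        case False
        show ?thesis
        proof (cases "\<exists>b<m. J b \<ge> ?R ?q")
          case True
          then obtain b where b: "b < m" "J b \<ge> ?R ?q" by blast
          have "minor m (\<lambda>a b. ?Z (p + int a) (J b)) = 0"
            by (rule det_zero_col[OF b(1)], rule vanish[OF False _ b(2)]) (use Suc in simp)
          then show ?thesis by simp
        next
          case below: False
          let ?J = "\<lambda>b. if b < m then J b else ?R ?q"
          let ?f = "\<lambda>a b. if a < m then ?Z (p + int a) (?J b) else X (p + int a) (?J b)"
          have J': "strict_mono_on {..<Suc m} ?J"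
            using J below by (auto simp: strict_mono_on_def less_Suc_eq not_le)
          have "0 \<le> minor (Suc m) (\<lambda>a b. X (p + int a) (?J b))"
            using solid J' unfolding solid_rows_nonneg_def by blast
          also have "\<dots> = minor (Suc m) (\<lambda>a b.
              if a < m then X (p + int a) (?J b) - c (p + int a) * X (p + int (Suc a)) (?J b)
              else X (p + int a) (?J b))"
            by (rule det_subtract_next_rows[where f = "\<lambda>a b. X (p + int a) (?J b)" and c = "\<lambda>a. c (p + int a)", symmetric])
          also have "\<dots> = minor (Suc m) (\<lambda>a b. ?f a b)"
            by (rule arg_cong[where f = Determinant.det], rule eq_matI) (auto simp: algebra_simps)
          also have "\<dots> = ?f m m * minor m (\<lambda>a b. ?f a b)"
          proof (rule det_last_col_unit)
            fix a assume "a < m"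
            then have "?Z (p + int a) (?R ?q) = 0" by (intro vanish[OF False]) (use Suc in auto)
            then show "?f a m = 0" using \<open>a < m\<close> by simp
          qed
          also have "Matrix.mat m m (\<lambda>(a, b). ?f a b) = Matrix.mat m m (\<lambda>(a, b). ?Z (p + int a) (J b))"
            by (rule eq_matI) auto
          finally have "0 \<le> ?f m m * minor m (\<lambda>a b. ?Z (p + int a) (J b))" .
          moreover have "?f m m > 0" using plateau(4)[OF False] Suc by (simp add: algebra_simps)
          ultimately show ?thesis by (simp add: zero_le_mult_iff)
        qed
      qed
    qed simp
  qed
  obtain b' Y' where inv': "right_inverse_within b' ?Z Y'"
    using right_inverse_within_subtract_rows[of b X Y c, OF inv cc] by blast
  have ok: "layer_ok n (1, \<lambda>_. 1, c)" using r cper by (auto simp: layer_ok_def c_def)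
  have fact: "X = layer_mult (1, \<lambda>_. 1, c) ?Z"
  proof (intro ext)
    fix i j
    have "c i * (c (i + 1) * X (i + 1 + 1) j) = 0" using cc[of i] by auto
    then show "X i j = layer_mult (1, \<lambda>_. 1, c) ?Z i j" by (simp add: algebra_simps)
  qed
  have per': "periodic n ?Z"
    using per cper per[unfolded periodic_def, rule_format, of "_ + 1"] by (simp add: periodic_def algebra_simps)
  have zeros: "?Z i j = 0" if "X i j = 0" for i j
  proof -
    have "?Z i j \<le> 0" using that solid_rows_nonneg_entry[OF solid] r by (simp add: c_def)
    then show ?thesis using solid_rows_nonneg_entry[OF solidZ, of i j] by simp
  qed
  have "c i0 \<noteq> 0" using r by (simp add: c_def)
  then have kill: "?Z i0 (?R i0) = 0" by (rule vanish) auto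
  have nz: "X i0 (?R i0) \<noteq> 0" using pos(1) by simp
  show ?thesis by (rule that[OF ok fact per' inv' solidZ zeros kill nz])
qed

section \<open>Factorization into bidiagonal layers\<close>

lemma sum_reverse_window: "(\<Sum>i\<in>{0..<int n}. f (int n - 1 - i)) = (\<Sum>i\<in>{0..<int n}. f i :: nat)"
  by (rule sum.reindex_bij_witness[of _ "\<lambda>i. int n - 1 - i" "\<lambda>i. int n - 1 - i"]) auto

text \<open>
  In the product of two banded matrices the outermost diagonals multiply without cancellation. As
  the product is the identity, the upper ends \<open>r\<close> and \<open>Max D\<close> of the two bands add up to 0, and so do
  the lower ends \<open>l\<close> and \<open>Min D\<close>; therefore \<open>r \<le> l\<close>.
\<close>

lemma diagonal_right_inverse_shift:
  assumes "right_inverse_within b X Y"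
    and "\<And>i j. X i j \<noteq> 0 \<Longrightarrow> i + l \<le> j \<and> j \<le> i + r"
    and "\<And>i. X i (i + r) \<noteq> 0" "\<And>i. X i (i + l) \<noteq> 0"
  shows "l = r"
proof -
  define D where "D = {s. \<exists>j. Y j (j + s) \<noteq> 0}"
  have sum: "(\<Sum>j\<in>{i - b..i + b}. X i j * Y j k) = of_bool (i = k)" for i k
    using assms(1) by (simp add: right_inverse_within_def)
  have band: "X i j \<noteq> 0 \<Longrightarrow> \<bar>j - i\<bar> \<le> b" for i j
    using assms(1) by (auto simp: right_inverse_within_def)
  have "finite D"
  proof (rule finite_subset)
    show "D \<subseteq> {- b..b}" using assms(1) by (force simp: D_def right_inverse_within_def abs_le_iff)
  qed simp
  have "D \<noteq> {}"
  proof
    assume "D = {}"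
    have "Y j k = 0" for j k
    proof (rule ccontr)
      assume "Y j k \<noteq> 0"
      then have "k - j \<in> D" by (auto simp: D_def intro!: exI[of _ j])
      with \<open>D = {}\<close> show False by simp
    qed
    then show False using sum[of 0 0] by simp
  qed
  have corner: "d + s = 0" if ds: "s \<in> D" "\<And>i. X i (i + d) \<noteq> 0"
    and ex: "\<And>i j t. X i j \<noteq> 0 \<Longrightarrow> t \<in> D \<Longrightarrow> j + t = i + d + s \<Longrightarrow> j = i + d" for d s
  proof -
    obtain j0 where j0: "Y j0 (j0 + s) \<noteq> 0" using ds(1) by (auto simp: D_def)
    define i where "i = j0 - d"
    have "X i j * Y j (j0 + s) = (if j = j0 then X i j0 * Y j0 (j0 + s) else 0)" for j
    proof (cases "X i j = 0 \<or> Y j (j0 + s) = 0")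
      case False
      then have "j0 + s - j \<in> D" by (auto simp: D_def intro!: exI[of _ j])
      then have "j = i + d" using False ex[of i j "j0 + s - j"] by (auto simp: i_def)
      then show ?thesis by (simp add: i_def)
    next
      case True
      then show ?thesis by auto
    qed
    then have "(\<Sum>j\<in>{i - b..i + b}. X i j * Y j (j0 + s)) =
        (\<Sum>j\<in>{i - b..i + b}. if j = j0 then X i j0 * Y j0 (j0 + s) else 0)" by simp
    also have "\<dots> = X i j0 * Y j0 (j0 + s)"
      using band[of i j0] ds(2)[of i] by (simp add: i_def abs_le_iff)
    also have "\<dots> \<noteq> 0" using j0 ds(2)[of i] by (simp add: i_def)
    finally have "i = j0 + s" using sum[of i "j0 + s"] by (auto split: if_splits)
    then show ?thesis by (simp add: i_def)
  qed
  have "r + Max D = 0"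
  proof (rule corner[OF Max_in[OF \<open>finite D\<close> \<open>D \<noteq> {}\<close>] assms(3)])
    fix i j t assume "X i j \<noteq> 0" "t \<in> D" "j + t = i + r + Max D"
    then show "j = i + r" using assms(2)[of i j] Max_ge[OF \<open>finite D\<close>, of t] by linarith
  qed
  moreover have "l + Min D = 0"
  proof (rule corner[OF Min_in[OF \<open>finite D\<close> \<open>D \<noteq> {}\<close>] assms(4)])
    fix i j t assume "X i j \<noteq> 0" "t \<in> D" "j + t = i + l + Min D"
    then show "j = i + l" using assms(2)[of i j] Min_le[OF \<open>finite D\<close>, of t] by linarith
  qed
  moreover have "Min D \<le> Max D" using \<open>finite D\<close> \<open>D \<noteq> {}\<close> by simp
  moreover have "l \<le> r" using assms(2)[OF assms(3)[of 0]] by simp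
  ultimately show ?thesis by linarith
qed

text \<open>
  Induction on the number of nonzero entries per period. An elimination step creates no new
  ones: where \<open>X\<close> vanishes, the new entry is at most 0, and it is nonnegative as a minor.
  Elimination from the left is elimination from the right for the reversed matrix; the reversal
  \<open>i \<mapsto> n - 1 - i\<close> maps the period \<open>0, \<dots>, n - 1\<close> to itself.
\<close>

theorem bidiagonal_factorization:
  assumes n: "n \<ge> 1" and "periodic n X" "right_inverse_within b X Y" "solid_rows_nonneg X"
  shows "\<exists>Ls. (\<forall>l\<in>set Ls. layer_ok n l) \<and> X = layers_prod Ls"
  using assms(2-)
proof (induction "\<Sum>i\<in>{0..<int n}. card {j. X i j \<noteq> 0}" arbitrary: X b Y rule: less_induct)
  case less
  note per = less.prems(1) and inv = less.prems(2) and solid = less.prems(3)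
  let ?rev = "\<lambda>(X :: int \<Rightarrow> int \<Rightarrow> real) i j. X (int n - 1 - i) (int n - 1 - j)"
  have revper: "periodic n (?rev X)" if "periodic n X" for X
    unfolding periodic_def
  proof (intro allI)
    fix i j
    show "?rev X (i + int n) (j + int n) = ?rev X i j"
      using that[unfolded periodic_def, rule_format, of "int n - 1 - (i + int n)" "int n - 1 - (j + int n)"]
      by (simp add: algebra_simps)
  qed
  have count_rev: "(\<Sum>i\<in>{0..<int n}. card {j. ?rev X i j \<noteq> 0}) = (\<Sum>i\<in>{0..<int n}. card {j. X i j \<noteq> 0})" for X
  proof -
    have "card {j. X i (int n - 1 - j) \<noteq> 0} = card {j. X i j \<noteq> 0}" for i
      by (rule bij_betw_same_card[of "\<lambda>j. int n - 1 - j"], rule bij_betw_byWitness[where f' = "\<lambda>j. int n - 1 - j"]) auto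
    then show ?thesis using sum_reverse_window[where n = n and f = "\<lambda>i. card {j. X i j \<noteq> 0}"] by (simp only:)
  qed
  have peel: "\<exists>Ls. (\<forall>l\<in>set Ls. layer_ok n l) \<and> Z = layers_prod Ls"
    if Z: "periodic n Z" "right_inverse_within c Z W" "solid_rows_nonneg Z"
      "(\<Sum>i\<in>{0..<int n}. card {j. Z i j \<noteq> 0}) = (\<Sum>i\<in>{0..<int n}. card {j. X i j \<noteq> 0})"
      "\<not> (\<forall>i. rightmost Z i < rightmost Z (i + 1))" for Z c W
  proof -
    obtain i0 where i0: "rightmost Z (i0 - 1) < rightmost Z i0" "rightmost Z i0 = rightmost Z (i0 + 1)"
      using exists_plateau_start[OF n Z(1-3,5)] by blast
    obtain l X' b' Y' where l: "layer_ok n l" "Z = layer_mult l X'" and X': "periodic n X'"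
      "right_inverse_within b' X' Y'" "solid_rows_nonneg X'"
      "\<And>i j. Z i j = 0 \<Longrightarrow> X' i j = 0" "X' i0 (rightmost Z i0) = 0" "Z i0 (rightmost Z i0) \<noteq> 0"
      by (rule elimination_step[OF n Z(1-3) i0]) blast
    let ?i = "i0 mod int n" and ?t = "i0 div int n"
    have fin: "finite {j. Z i j \<noteq> 0}" for i by (rule row_finite[OF n Z(1-3)])
    have "(\<Sum>i\<in>{0..<int n}. card {j. X' i j \<noteq> 0}) < (\<Sum>i\<in>{0..<int n}. card {j. Z i j \<noteq> 0})"
    proof (rule sum_strict_mono_ex1)
      show "\<forall>i\<in>{0..<int n}. card {j. X' i j \<noteq> 0} \<le> card {j. Z i j \<noteq> 0}"
        using X'(4) fin by (auto intro!: card_mono)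
      let ?j = "rightmost Z i0 - int n * ?t"
      have "X' ?i ?j = 0" "Z ?i ?j \<noteq> 0"
        using X'(5,6) periodic_shift[OF X'(1), of ?i ?t ?j] periodic_shift[OF Z(1), of ?i ?t ?j] by auto
      then have "{j. X' ?i j \<noteq> 0} \<subset> {j. Z ?i j \<noteq> 0}" using X'(4) by blast
      then have "card {j. X' ?i j \<noteq> 0} < card {j. Z ?i j \<noteq> 0}" using fin by (rule psubset_card_mono[rotated])
      moreover have "?i \<in> {0..<int n}" using n by simp
      ultimately show "\<exists>i\<in>{0..<int n}. card {j. X' i j \<noteq> 0} < card {j. Z i j \<noteq> 0}" by blast
    qed simp
    then obtain Ls where "\<forall>l\<in>set Ls. layer_ok n l" "X' = layers_prod Ls"
      using less.hyps[OF _ X'(1-3)] Z(4) by auto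
    then show ?thesis using l by (intro exI[of _ "l # Ls"]) (simp add: layers_prod_def)
  qed
  have rev: "periodic n (?rev X)" "right_inverse_within b (?rev X) (?rev Y)" "solid_rows_nonneg (?rev X)"
    using revper[OF per] right_inverse_within_reverse[OF inv] solid_rows_nonneg_reverse[OF solid] by auto
  consider "\<not> (\<forall>i. rightmost X i < rightmost X (i + 1))"
    | "\<not> (\<forall>i. rightmost (?rev X) i < rightmost (?rev X) (i + 1))"
    | "\<And>i. rightmost X i < rightmost X (i + 1)" "\<And>i. rightmost (?rev X) i < rightmost (?rev X) (i + 1)"
    by blast
  then show ?case
  proof cases
    case 1
    then show ?thesis using peel[OF per inv solid] by blast
  next
    case 2
    then obtain Ls where Ls: "\<forall>l\<in>set Ls. layer_ok n l" "?rev X = layers_prod Ls"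
      using peel[OF rev count_rev] by blast
    from layers_prod_reverse[OF Ls(1), of "int n - 1"] obtain Ls' where
      Ls': "\<forall>l\<in>set Ls'. layer_ok n l" "layers_prod Ls' = ?rev (layers_prod Ls)" by blast
    then have "layers_prod Ls' = X" by (simp add: Ls(2)[symmetric])
    then show ?thesis using Ls'(1) by blast
  next
    case 3
    \<comment> \<open>no elimination step is possible at either end, so the band has constant width\<close>
    define r where "r = rightmost X 0"
    define l where "l = - rightmost (?rev X) 0"
    have Rr: "rightmost X i = i + r" for i
      using rightmost_affine[OF n per inv solid 3(1), of i] by (simp add: r_def)
    have Rl: "rightmost (?rev X) i = i - l" for i
      using rightmost_affine[OF n rev 3(2), of i] by (simp add: l_def)
    have top: "X i (i + r) > 0" for i using rightmost_nonzero[OF n per inv solid, of i] by (simp add: Rr)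
    have bot: "X i (i + l) \<noteq> 0" for i
      using rightmost_nonzero[OF n rev, of "int n - 1 - i"] unfolding Rl by simp
    have lr: "i + l \<le> j \<and> j \<le> i + r" if "X i j \<noteq> 0" for i j
      using le_rightmost[OF n per inv solid that] le_rightmost[OF n rev, of "int n - 1 - i" "int n - 1 - j"] that
      unfolding Rr Rl by simp
    have "l = r" by (rule diagonal_right_inverse_shift[OF inv lr _ bot]) (use top in \<open>simp_all add: less_imp_neq[symmetric]\<close>)
    then have supp: "X i j = 0" if "j \<noteq> i + r" for i j using lr[of i j] that by force
    obtain Ls where Ls: "\<forall>l\<in>set Ls. layer_ok n l" "layers_prod Ls = (\<lambda>i j. of_bool (j = i + r))"
      using shift_layers_prod by blast
    let ?l = "(1, \<lambda>i. X i (i + r), \<lambda>_. 0)"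
    have "layer_ok n ?l"
      using top per[unfolded periodic_def, rule_format, of _ "_ + r"]
      by (auto simp: layer_ok_def less_imp_le add_ac)
    moreover have "X = layers_prod (?l # Ls)"
    proof (intro ext)
      fix i j
      have "layers_prod (?l # Ls) = layer_mult ?l (layers_prod Ls)" by (simp add: layers_prod_def)
      then show "X i j = layers_prod (?l # Ls) i j" using supp[of j i] by (simp add: Ls(2))
    qed
    ultimately show ?thesis using Ls(1) by (intro exI[of _ "?l # Ls"]) auto
  qed
qed

section \<open>Unfoldings of Laurent polynomial matrices\<close>

lemma laurent_poly_add: "laurent_poly f \<Longrightarrow> laurent_poly g \<Longrightarrow> laurent_poly (f + g)"
  unfolding laurent_poly_def
  by (rule finite_subset[of _ "{k. fls_nth f k \<noteq> 0} \<union> {k. fls_nth g k \<noteq> 0}"]) auto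

lemma laurent_poly_uminus: "laurent_poly f \<Longrightarrow> laurent_poly (- f)"
  by (simp add: laurent_poly_def)

lemma laurent_poly_mult:
  assumes "laurent_poly f" "laurent_poly g" shows "laurent_poly (f * g)"
proof -
  have "k \<in> (\<lambda>(i, j). i + j) ` ({k. fls_nth f k \<noteq> 0} \<times> {k. fls_nth g k \<noteq> 0})"
    if "fls_nth (f * g) k \<noteq> 0" for k
  proof -
    have "(\<Sum>i=fls_subdegree f..k - fls_subdegree g. fls_nth f i * fls_nth g (k - i)) \<noteq> 0"
      using that by (simp add: fls_times_nth(2))
    then obtain i where "fls_nth f i * fls_nth g (k - i) \<noteq> 0" by (rule sum.not_neutral_contains_not_neutral)
    then have "fls_nth f i \<noteq> 0" "fls_nth g (k - i) \<noteq> 0" by auto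
    then show ?thesis by (intro image_eqI[of _ _ "(i, k - i)"]) auto
  qed
  then have "{k. fls_nth (f * g) k \<noteq> 0}
      \<subseteq> (\<lambda>(i, j). i + j) ` ({k. fls_nth f k \<noteq> 0} \<times> {k. fls_nth g k \<noteq> 0})" by blast
  moreover have "finite \<dots>" using assms by (intro finite_imageI finite_cartesian_product) (auto simp: laurent_poly_def)
  ultimately show ?thesis unfolding laurent_poly_def by (rule finite_subset)
qed

lemma laurent_poly_const: "laurent_poly (fls_const c)"
  unfolding laurent_poly_def by (rule finite_subset[of _ "{0}"]) auto

lemma laurent_poly_intpow: "laurent_poly (fls_X_intpow k)"
  unfolding laurent_poly_def by (rule finite_subset[of _ "{k}"]) auto

lemma laurent_poly_0: "laurent_poly 0" and laurent_poly_1: "laurent_poly 1"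
  using laurent_poly_const[of 0] laurent_poly_const[of 1] by simp_all

lemma laurent_poly_sum: "(\<And>x. x \<in> S \<Longrightarrow> laurent_poly (f x)) \<Longrightarrow> laurent_poly (sum f S)"
  by (induction S rule: infinite_finite_induct) (simp_all add: laurent_poly_add laurent_poly_0)

lemma laurent_poly_prod: "(\<And>x. x \<in> S \<Longrightarrow> laurent_poly (f x)) \<Longrightarrow> laurent_poly (prod f S)"
  by (induction S rule: infinite_finite_induct) (simp_all add: laurent_poly_mult laurent_poly_1)

lemma laurent_poly_det:
  assumes "M \<in> carrier_mat m m" "\<And>i j. i < m \<Longrightarrow> j < m \<Longrightarrow> laurent_poly (M $$ (i, j))"
  shows "laurent_poly (Determinant.det M)"
proof -
  have "laurent_poly (signof p)" for p :: "nat \<Rightarrow> nat"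
    using laurent_poly_1 laurent_poly_uminus[OF laurent_poly_1] by (auto simp: sign_def)
  moreover have "p i < m" if "p permutes {0..<m}" "i < m" for p i
    using permutes_in_image[OF that(1), of i] that(2) by simp
  ultimately show ?thesis unfolding det_def'[OF assms(1)]
    by (intro laurent_poly_sum laurent_poly_mult laurent_poly_prod assms(2)) auto
qed

lemma fls_times_nth_window:
  fixes f g :: "real fls"
  assumes "\<And>s. fls_nth f s \<noteq> 0 \<Longrightarrow> \<bar>s\<bar> \<le> S"
  shows "fls_nth (f * g) m = (\<Sum>s\<in>{- S..S}. fls_nth f s * fls_nth g (m - s))"
proof -
  have "fls_nth (f * g) m = (\<Sum>s=fls_subdegree f..m - fls_subdegree g. fls_nth f s * fls_nth g (m - s))"
    by (rule fls_times_nth(2))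
  also have "\<dots> = (\<Sum>s\<in>{- S..S} \<union> {fls_subdegree f..m - fls_subdegree g}. fls_nth f s * fls_nth g (m - s))"
  proof (intro sum.mono_neutral_left)
    show "\<forall>s\<in>({- S..S} \<union> {fls_subdegree f..m - fls_subdegree g}) - {fls_subdegree f..m - fls_subdegree g}.
        fls_nth f s * fls_nth g (m - s) = 0"
    proof
      fix s assume "s \<in> ({- S..S} \<union> {fls_subdegree f..m - fls_subdegree g}) - {fls_subdegree f..m - fls_subdegree g}"
      then have "s < fls_subdegree f \<or> m - s < fls_subdegree g" by auto
      then show "fls_nth f s * fls_nth g (m - s) = 0" by auto
    qed
  qed auto
  also have "\<dots> = (\<Sum>s\<in>{- S..S}. fls_nth f s * fls_nth g (m - s))"
  proof (intro sum.mono_neutral_right)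
    have "fls_nth f s = 0" if "s \<notin> {- S..S}" for s
      using assms[of s] that by (cases "fls_nth f s = 0") (auto simp: abs_le_iff)
    then show "\<forall>s\<in>({- S..S} \<union> {fls_subdegree f..m - fls_subdegree g}) - {- S..S}.
        fls_nth f s * fls_nth g (m - s) = 0" by auto
  qed auto
  finally show ?thesis .
qed

text \<open>
  Unfolding turns products of Laurent polynomial matrices into products of infinite matrices: the
  column \<open>j\<close> corresponds to the entry \<open>l\<close> and the exponent \<open>s\<close> with \<open>j = l + 1 + n (alpha i + s)\<close>.
\<close>

lemma unfold_right_inverse:
  assumes n: "n \<ge> 1" and A: "A \<in> carrier_mat n n" and B: "B \<in> carrier_mat n n" and AB: "A * B = 1\<^sub>m n"
    and lA: "\<And>i j. i < n \<Longrightarrow> j < n \<Longrightarrow> laurent_poly (A $$ (i, j))"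
    and lB: "\<And>i j. i < n \<Longrightarrow> j < n \<Longrightarrow> laurent_poly (B $$ (i, j))"
  shows "\<exists>b. right_inverse_within b (unfold_mat n A) (unfold_mat n B)"
proof -
  let ?X = "unfold_mat n A" and ?Y = "unfold_mat n B"
  let ?r = "\<lambda>i. nat (res n i - 1)"
  have r: "?r i < n" for i using res_range[OF n, of i] by simp
  have bound: "\<exists>S\<ge>0. \<forall>i<n. \<forall>j<n. \<forall>s. fls_nth (M $$ (i, j)) s \<noteq> 0 \<longrightarrow> \<bar>s\<bar> \<le> S"
    if "\<And>i j. i < n \<Longrightarrow> j < n \<Longrightarrow> laurent_poly (M $$ (i, j))" for M :: "real fls mat"
  proof -
    let ?D = "\<Union>i\<in>{..<n}. \<Union>j\<in>{..<n}. {s. fls_nth (M $$ (i, j)) s \<noteq> 0}"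
    have "finite ?D" using that by (auto simp: laurent_poly_def)
    then have "\<bar>s\<bar> \<le> Max (insert 0 (abs ` ?D))" if "s \<in> ?D" for s using that by (intro Max_ge) auto
    moreover have "Max (insert 0 (abs ` ?D)) \<ge> 0" using \<open>finite ?D\<close> by (intro Max_ge) auto
    ultimately show ?thesis by (intro exI[of _ "Max (insert 0 (abs ` ?D))"]) blast
  qed
  obtain SA SB where SA: "SA \<ge> 0" "\<And>i j s. i < n \<Longrightarrow> j < n \<Longrightarrow> fls_nth (A $$ (i, j)) s \<noteq> 0 \<Longrightarrow> \<bar>s\<bar> \<le> SA"
    and SB: "SB \<ge> 0" "\<And>i j s. i < n \<Longrightarrow> j < n \<Longrightarrow> fls_nth (B $$ (i, j)) s \<noteq> 0 \<Longrightarrow> \<bar>s\<bar> \<le> SB"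
    using bound[of A, OF lA] bound[of B, OF lB] by metis
  define S where "S = SA + SB"
  have S: "i < n \<Longrightarrow> j < n \<Longrightarrow> fls_nth (A $$ (i, j)) s \<noteq> 0 \<Longrightarrow> \<bar>s\<bar> \<le> S"
    "i < n \<Longrightarrow> j < n \<Longrightarrow> fls_nth (B $$ (i, j)) s \<noteq> 0 \<Longrightarrow> \<bar>s\<bar> \<le> S" for i j s
    using SA(1) SA(2)[of i j s] SB(1) SB(2)[of i j s] by (auto simp: S_def)
  define b where "b = int n * (S + 1)"
  have dist: "\<bar>j - i\<bar> \<le> b" if "\<bar>alpha n j - alpha n i\<bar> \<le> S" for i j
  proof -
    have "j - i = (res n j - res n i) + int n * (alpha n j - alpha n i)"
      using alpha_eq[OF n, of i] alpha_eq[OF n, of j] by (simp add: algebra_simps)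
    moreover have "1 \<le> res n i" "res n i \<le> int n" for i by (rule res_range[OF n])+
    then have "\<bar>res n j - res n i\<bar> \<le> int n" by (smt (verit))
    moreover have "\<bar>int n * (alpha n j - alpha n i)\<bar> \<le> int n * S"
      using that by (simp add: abs_mult mult_left_mono)
    ultimately have "\<bar>j - i\<bar> \<le> int n + int n * S" by linarith
    then show ?thesis by (simp add: b_def algebra_simps)
  qed
  have band: "?X i j \<noteq> 0 \<Longrightarrow> \<bar>j - i\<bar> \<le> b" "?Y i j \<noteq> 0 \<Longrightarrow> \<bar>j - i\<bar> \<le> b" for i j
    using S(1)[OF r r, of i j] S(2)[OF r r, of i j] dist[of j i] by (auto simp: unfold_mat_def)
  have "(\<Sum>j\<in>{i - b..i + b}. ?X i j * ?Y j k) = of_bool (i = k)" for i k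
  proof -
    let ?T = "{j. \<bar>alpha n j - alpha n i\<bar> \<le> S}"
    let ?m = "alpha n k - alpha n i"
    have T: "?T \<subseteq> {i - b..i + b}" using dist[of _ i] by (auto simp: abs_le_iff) force+
    have "?X i j = 0" if "j \<notin> ?T" for j
      using that S(1)[OF r r, of i j] by (auto simp: unfold_mat_def)
    then have "(\<Sum>j\<in>{i - b..i + b}. ?X i j * ?Y j k) = (\<Sum>j\<in>?T. ?X i j * ?Y j k)"
      using T by (intro sum.mono_neutral_right) auto
    also have "\<dots> = (\<Sum>(l, s)\<in>{..<n} \<times> {- S..S}. fls_nth (A $$ (?r i, l)) s * fls_nth (B $$ (l, ?r k)) (?m - s))"
    proof (rule sum.reindex_bij_witness[of _ "\<lambda>(l, s). int l + 1 + int n * (alpha n i + s)" "\<lambda>j. (?r j, alpha n j - alpha n i)"])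
      fix j assume "j \<in> ?T"
      then show "(?r j, alpha n j - alpha n i) \<in> {..<n} \<times> {- S..S}" using r[of j] by (auto simp: abs_le_iff)
      have "res n j \<ge> 1" using n by (simp add: res_def)
      then show "(case (?r j, alpha n j - alpha n i) of (l, s) \<Rightarrow> int l + 1 + int n * (alpha n i + s)) = j"
        using alpha_eq[OF n, of j] by simp
      show "(case (?r j, alpha n j - alpha n i) of (l, s) \<Rightarrow> fls_nth (A $$ (?r i, l)) s * fls_nth (B $$ (l, ?r k)) (?m - s)) = ?X i j * ?Y j k"
        by (simp add: unfold_mat_def)
    next
      fix x assume x: "x \<in> {..<n} \<times> {- S..S}"
      obtain l s where ls: "x = (l, s)" by (cases x)
      have l: "l < n" using x ls by simp
      have "res n (int l + 1) = int l + 1" using l by (intro res_id) auto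
      then have *: "res n (int l + 1 + int n * (alpha n i + s)) = int l + 1"
        "alpha n (int l + 1 + int n * (alpha n i + s)) = alpha n i + s"
        using res_add[of n "int l + 1" "alpha n i + s"] alpha_add[OF n, of "int l + 1" "alpha n i + s"]
        by (simp_all add: alpha_def)
      then show "(\<lambda>j. (?r j, alpha n j - alpha n i)) (case x of (l, s) \<Rightarrow> int l + 1 + int n * (alpha n i + s)) = x"
        "(case x of (l, s) \<Rightarrow> int l + 1 + int n * (alpha n i + s)) \<in> ?T"
        using x by (simp_all add: ls abs_le_iff)
    qed
    also have "\<dots> = (\<Sum>l<n. \<Sum>s\<in>{- S..S}. fls_nth (A $$ (?r i, l)) s * fls_nth (B $$ (l, ?r k)) (?m - s))"
      by (rule sum.cartesian_product[symmetric])
    also have "\<dots> = (\<Sum>l<n. fls_nth (A $$ (?r i, l) * B $$ (l, ?r k)) ?m)"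
      by (intro sum.cong refl fls_times_nth_window[symmetric] S(1)[OF r]) auto
    also have "\<dots> = fls_nth ((A * B) $$ (?r i, ?r k)) ?m"
      using A B r[of i] r[of k] by (simp add: scalar_prod_def fls_nth_sum atLeast0LessThan)
    also have "\<dots> = of_bool (i = k)"
    proof -
      have "res n i \<ge> 1" "res n k \<ge> 1" using n by (simp_all add: res_def)
      then have "i = k \<longleftrightarrow> ?r i = ?r k \<and> ?m = 0"
        using alpha_eq[OF n, of i] alpha_eq[OF n, of k] by auto
      then show ?thesis using r[of i] r[of k] by (auto simp: AB)
    qed
    finally show ?thesis .
  qed
  then show ?thesis using band unfolding right_inverse_within_def by blast
qed

text \<open>
  The determinant is a unit, so the adjugate provides an inverse with Laurent polynomial entries.
\<close>

theorem totally_nonneg_factorization: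
  assumes n: "n \<ge> 1" and A: "A \<in> GL_laurent n" and tnn: "totally_nonneg (unfold_mat n A)"
  shows "\<exists>Ls. (\<forall>l\<in>set Ls. layer_ok n l) \<and> unfold_mat n A = layers_prod Ls"
proof -
  from A obtain c k where Ac: "A \<in> carrier_mat n n"
    and lA: "\<And>i j. i < n \<Longrightarrow> j < n \<Longrightarrow> laurent_poly (A $$ (i, j))"
    and c: "c \<noteq> 0" and det: "Determinant.det A = fls_const c * fls_X_intpow k"
    by (auto simp: GL_laurent_def)
  define u where "u = fls_const (1 / c) * fls_X_intpow (- k)"
  have u: "Determinant.det A * u = 1"
    using c by (simp add: det u_def fls_times_both_shifted_simp mult.assoc mult.left_commute fls_const_mult_const)
  have lu: "laurent_poly u" unfolding u_def by (intro laurent_poly_mult laurent_poly_const laurent_poly_intpow)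
  define B where "B = u \<cdot>\<^sub>m adj_mat A"
  note adj = adj_mat[OF Ac]
  have Bc: "B \<in> carrier_mat n n" using adj(1) by (simp add: B_def)
  have "A * B = u \<cdot>\<^sub>m (A * adj_mat A)" using Ac adj(1) by (simp add: B_def mult_smult_distrib)
  also have "\<dots> = 1\<^sub>m n" using u by (intro eq_matI) (auto simp: adj(2) mult.commute)
  finally have AB: "A * B = 1\<^sub>m n" .
  have lB: "laurent_poly (B $$ (i, j))" if "i < n" "j < n" for i j
  proof -
    have "laurent_poly (Determinant.det (mat_delete A j i))"
    proof (rule laurent_poly_det)
      show "mat_delete A j i \<in> carrier_mat (n - 1) (n - 1)" using Ac by (simp add: mat_delete_def)
      fix i' j' assume "i' < n - 1" "j' < n - 1"
      then show "laurent_poly (mat_delete A j i $$ (i', j'))"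
        using Ac that by (auto simp: mat_delete_def intro!: lA)
    qed
    moreover have "laurent_poly ((-1) ^ m)" for m :: nat
      using laurent_poly_1 laurent_poly_uminus[OF laurent_poly_1] by (cases "even m") auto
    ultimately show ?thesis
      using that Ac lu by (auto simp: B_def adj_mat_def cofactor_def intro!: laurent_poly_mult)
  qed
  obtain b where "right_inverse_within b (unfold_mat n A) (unfold_mat n B)"
    using unfold_right_inverse[OF n Ac Bc AB lA lB] by blast
  moreover have "periodic n (unfold_mat n A)" using unfold_mat_periodic[OF n] by (simp add: periodic_def)
  moreover have "solid_rows_nonneg (unfold_mat n A)"
    unfolding solid_rows_nonneg_def
  proof (intro allI impI)
    fix m p and J :: "nat \<Rightarrow> int" assume "strict_mono_on {..<m} J"
    moreover have "strict_mono_on {..<m} (\<lambda>a. p + int a)" by (auto simp: strict_mono_on_def)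
    ultimately show "0 \<le> minor m (\<lambda>a b. unfold_mat n A (p + int a) (J b))"
      using tnn unfolding totally_nonneg_def by blast
  qed
  ultimately show ?thesis using bidiagonal_factorization[OF n] by blast
qed

section \<open>The network of a product of layers\<close>

lemma continuous_on_cyl_cover: "continuous_on S f \<Longrightarrow> continuous_on S (\<lambda>x. cyl_cover (f x))"
  unfolding cyl_cover_def by (intro continuous_intros)

text \<open>
  The \<open>l\<close>-th layer of the list occupies the part of the cylinder between the heights \<open>l / L\<close> and
  \<open>(l + 1) / L\<close>, which is why the list must not be empty.
\<close>

locale layer_stack =
  fixes n :: nat and Ls :: "layer list"
  assumes n: "n \<ge> 1" and Ls: "Ls \<noteq> []" "\<forall>l\<in>set Ls. layer_ok n l"
begin

lemmas res_bounds = res_range[OF n]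

abbreviation L :: nat where "L \<equiv> length Ls"
definition shift :: "nat \<Rightarrow> int" where "shift l = fst (Ls ! l)"
definition straight :: "nat \<Rightarrow> int \<Rightarrow> real" where "straight l = fst (snd (Ls ! l))"
definition slanted :: "nat \<Rightarrow> int \<Rightarrow> real" where "slanted l = snd (snd (Ls ! l))"

lemma layer: assumes "l < L"
  shows "shift l = 1 \<or> shift l = -1" "straight l k \<ge> 0" "slanted l k \<ge> 0"
    "straight l (res n k) = straight l k" "slanted l (res n k) = slanted l k" "Ls ! l = (shift l, straight l, slanted l)"
proof -
  have ok: "layer_ok n (shift l, straight l, slanted l)"
    using Ls(2) assms by (simp add: shift_def straight_def slanted_def)
  then show "shift l = 1 \<or> shift l = -1" "straight l k \<ge> 0" "slanted l k \<ge> 0"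
    by (auto simp: layer_ok_def)
  show "straight l (res n k) = straight l k" "slanted l (res n k) = slanted l k"
    using ok by (intro periodic_res[OF n]; simp add: layer_ok_def)+
  show "Ls ! l = (shift l, straight l, slanted l)" by (simp add: shift_def straight_def slanted_def)
qed

lemma rL0: "real L > 0" and rn0: "real n > 0"
  using Ls(1) n by auto

text \<open>
  Points are given by a column in \<open>real\<close> modulo \<open>n\<close> and a level between 0 and \<open>L\<close>.
\<close>

definition point :: "real \<Rightarrow> real \<Rightarrow> cyl_point" where
  "point x y = cyl_cover (Complex (x / real n) (y / real L))"

lemma point_eq_iff: "point x y = point x' y' \<longleftrightarrow> y = y' \<and> (\<exists>m::int. x' = x + real n * of_int m)"
proof -
  have "point x y = point x' y' \<longleftrightarrow> (\<exists>m::int. x' / real n = x / real n + of_int m \<and> y' / real L = y / real L)"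
    unfolding point_def cyl_cover_eq_iff by (auto simp: complex_eq_iff)
  also have "\<dots> \<longleftrightarrow> y = y' \<and> (\<exists>m::int. x' = x + real n * of_int m)"
    using rL0 rn0 by (auto simp: field_simps)
  finally show ?thesis .
qed

lemma point_height: "snd (point x y) = y / real L"
  by (simp add: point_def cyl_cover_def)

lemma point_in_cylinder: "0 \<le> y \<Longrightarrow> y \<le> real L \<Longrightarrow> point x y \<in> cylinder"
  using rL0 by (simp add: point_def cyl_cover_in_cylinder strip_def)

text \<open>
  The edge that leaves column \<open>k\<close> at level \<open>l\<close>, straight up for \<open>\<epsilon> = 0\<close> and to the column
  \<open>k + shift l\<close> for \<open>\<epsilon> = 1\<close>. For \<open>n = 1\<close> the slanted edge winds once around the cylinder.
\<close>

definition edge_lift :: "nat \<Rightarrow> int \<Rightarrow> int \<Rightarrow> real \<Rightarrow> complex" where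
  "edge_lift l k \<epsilon> t = Complex ((of_int k + of_int (\<epsilon> * shift l) * t) / real n) ((real l + t) / real L)"

definition edge_arc :: "nat \<Rightarrow> int \<Rightarrow> int \<Rightarrow> real \<Rightarrow> cyl_point" where
  "edge_arc l k \<epsilon> t = point (of_int k + of_int (\<epsilon> * shift l) * t) (real l + t)"

definition vtx :: "nat \<Rightarrow> int \<Rightarrow> cyl_point" where
  "vtx l k = point (of_int k) (real l)"

definition V :: "cyl_point set" where
  "V = (\<lambda>(l, k). vtx l k) ` ({..L} \<times> {1..int n})"

definition IE :: "(nat \<times> int \<times> int) set" where "IE = {..<L} \<times> {1..int n} \<times> {0, 1}"

definition E :: "(real \<Rightarrow> cyl_point) set" where "E = (\<lambda>(l, k, \<epsilon>). edge_arc l k \<epsilon>) ` IE"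

text \<open>
  Weights are attached to curves, so the index of an edge is recovered from the curve.
\<close>

definition edge_weight :: "(real \<Rightarrow> cyl_point) \<Rightarrow> real" where
  "edge_weight e = (case inv_into IE (\<lambda>(l, k, \<epsilon>). edge_arc l k \<epsilon>) e of (l, k, \<epsilon>) \<Rightarrow>
     if \<epsilon> = 0 then straight l k else slanted l k)"

text \<open>
  The vertical line at column 1/2, between \<open>v_n\<close>, which is also column 0, and \<open>v_1\<close>.
\<close>

definition chord_lift_line :: "real \<Rightarrow> complex" where
  "chord_lift_line t = Complex (1 / (2 * real n)) t"

definition N :: cyl_network where
  "N = \<lparr>vertices = V, edges = E, source = (\<lambda>k. vtx 0 (int k)), sink = (\<lambda>k. vtx L (int k)),
     weight = edge_weight, chord = (\<lambda>t. cyl_cover (chord_lift_line t))\<rparr>"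

lemma N_simps [simp]: "vertices N = V" "edges N = E" "source N k = vtx 0 (int k)" "sink N k = vtx L (int k)"
    "weight N = edge_weight" "chord N = (\<lambda>t. cyl_cover (chord_lift_line t))"
  by (simp_all add: N_def)

lemma vtx_add: "vtx l (k + int n * m) = vtx l k"
  unfolding vtx_def point_eq_iff by (auto intro!: exI[of _ "- m"])

lemma vtx_res: "vtx l (res n k) = vtx l k"
  using vtx_add[of l "res n k" "alpha n k"] alpha_eq[OF n, of k] by simp

lemma vtx_in_V: assumes "l \<le> L" shows "vtx l k \<in> V"
proof -
  have "vtx l (res n k) \<in> V" unfolding V_def using assms res_bounds[of k] by (intro image_eqI[of _ _ "(l, res n k)"]) auto
  then show ?thesis by (simp add: vtx_res)
qed

lemma vtx_eq_iff: "vtx l k = vtx l' k' \<longleftrightarrow> l = l' \<and> (\<exists>m. k' = k + int n * m)"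
proof -
  have "real_of_int k' = real_of_int k + real n * real_of_int m \<longleftrightarrow> k' = k + int n * m" for m
  proof -
    have "real_of_int k + real n * real_of_int m = real_of_int (k + int n * m)" by simp
    then show ?thesis by (metis of_int_eq_iff)
  qed
  then show ?thesis unfolding vtx_def point_eq_iff by simp
qed

lemma edge_ends: "pathstart (edge_arc l k \<epsilon>) = vtx l k" "pathfinish (edge_arc l k \<epsilon>) = vtx (Suc l) (k + \<epsilon> * shift l)"
  by (simp_all add: pathstart_def pathfinish_def edge_arc_def vtx_def algebra_simps)

lemma edge_lift_is_lift:
  assumes "l < L" shows "is_lift (edge_lift l k \<epsilon>) (edge_arc l k \<epsilon>)"
proof -
  have "continuous_on {0..1} (edge_lift l k \<epsilon>)"
    unfolding edge_lift_def Complex_eq by (intro continuous_intros) (use rn0 rL0 in auto)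
  moreover have "edge_lift l k \<epsilon> t \<in> strip" if "t \<in> {0..1}" for t
  proof -
    have "real l + t \<le> real L" using assms that by auto
    then show ?thesis using that rL0 by (simp add: edge_lift_def strip_def)
  qed
  ultimately show ?thesis
    by (auto simp: is_lift_def path_def path_image_def edge_lift_def edge_arc_def point_def)
qed

lemma edge_arc_arc: assumes "l < L" shows "arc (edge_arc l k \<epsilon>)" "path_image (edge_arc l k \<epsilon>) \<subseteq> cylinder"
proof -
  have "continuous_on {0..1} (edge_arc l k \<epsilon>)"
    unfolding edge_arc_def point_def Complex_eq
    by (intro continuous_on_cyl_cover continuous_intros) (use rn0 rL0 in auto)
  moreover have "inj_on (edge_arc l k \<epsilon>) {0..1}" by (rule inj_onI) (simp add: edge_arc_def point_eq_iff)
  ultimately show "arc (edge_arc l k \<epsilon>)" by (simp add: arc_def path_def)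
  show "path_image (edge_arc l k \<epsilon>) \<subseteq> cylinder"
    using assms by (auto simp: path_image_def edge_arc_def intro!: point_in_cylinder)
qed

lemma level_eq:
  assumes "real l + t = real l' + t'" "0 < t" "t < 1" "0 \<le> t'" "t' < 1" shows "l = l' \<and> t = t'"
proof -
  have "real l < real l' + 1" "real l' < real l + 1" using assms by linarith+
  then have "l = l'" by linarith
  then show ?thesis using assms(1) by simp
qed

text \<open>
  At a common interior point the levels determine \<open>l\<close> and \<open>t\<close>. The columns then differ by an
  integer and by a multiple of \<open>t\<close> with a factor in \<open>{-1, 0, 1}\<close>, and since \<open>t\<close> is not an integer
  the factor is 0.
\<close>

lemma edge_arc_disjoint:
  assumes ie: "(l, k, \<epsilon>) \<in> IE" "(l', k', \<epsilon>') \<in> IE" and t: "0 < t" "t < 1" "0 < t'" "t' < 1"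
    and eq: "edge_arc l k \<epsilon> t = edge_arc l' k' \<epsilon>' t'"
  shows "(l, k, \<epsilon>) = (l', k', \<epsilon>')"
proof -
  from eq obtain m :: int where lt: "real l + t = real l' + t'"
    and m: "of_int k' + of_int (\<epsilon>' * shift l') * t' = of_int k + of_int (\<epsilon> * shift l) * t + real n * of_int m"
    unfolding edge_arc_def point_eq_iff by blast
  have l: "l = l'" "t = t'" using level_eq[OF lt] t by auto
  have s: "shift l = 1 \<or> shift l = -1" using ie(1) by (intro layer(1)) (simp add: IE_def)
  define d where "d = (\<epsilon>' - \<epsilon>) * shift l"
  define c where "c = k - k' + int n * m"
  have dt: "real_of_int d * t = real_of_int c" using m l by (simp add: d_def c_def algebra_simps)
  have d: "d = 0 \<or> d = 1 \<or> d = -1" using ie s by (auto simp: d_def IE_def)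
  have "d = 0"
  proof (rule ccontr)
    assume "d \<noteq> 0"
    then have "t = real_of_int c \<or> t = real_of_int (- c)" using d dt by auto
    moreover have "t \<noteq> real_of_int i" for i
    proof
      assume "t = real_of_int i"
      then have "0 < i" "i < 1" using t(1,2) by simp_all
      then show False by simp
    qed
    ultimately show False by blast
  qed
  then have "\<epsilon> = \<epsilon>'" using s by (auto simp: d_def)
  have "c = 0" using dt \<open>d = 0\<close> by simp
  then have "k' = k + int n * m" by (simp add: c_def)
  moreover have "1 \<le> k" "k \<le> int n" "1 \<le> k'" "k' \<le> int n" using ie by (auto simp: IE_def)
  ultimately have "k = k'" using res_id[of k n] res_id[of k' n] res_add[of n k m] by simp
  then show ?thesis using l \<open>\<epsilon> = \<epsilon>'\<close> by simp
qed

lemma edge_arc_inj: "inj_on (\<lambda>(l, k, \<epsilon>). edge_arc l k \<epsilon>) IE"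
proof (rule inj_onI)
  fix x y assume xy: "x \<in> IE" "y \<in> IE" "(\<lambda>(l, k, \<epsilon>). edge_arc l k \<epsilon>) x = (\<lambda>(l, k, \<epsilon>). edge_arc l k \<epsilon>) y"
  obtain l k \<epsilon> l' k' \<epsilon>' where "x = (l, k, \<epsilon>)" "y = (l', k', \<epsilon>')" by (cases x, cases y) auto
  then show "x = y" using xy edge_arc_disjoint[of l k \<epsilon> l' k' \<epsilon>' "1/2" "1/2"] by simp
qed

lemma edge_weight: assumes "(l, k, \<epsilon>) \<in> IE"
  shows "edge_weight (edge_arc l k \<epsilon>) = (if \<epsilon> = 0 then straight l k else slanted l k)"
  unfolding edge_weight_def using inv_into_f_f[OF edge_arc_inj assms] by simp

lemma edge_arc_vertex_free:
  assumes "0 < t" "t < 1" shows "edge_arc l k \<epsilon> t \<notin> V"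
proof
  assume "edge_arc l k \<epsilon> t \<in> V"
  then obtain l' where "real l + t = real l' + 0" by (auto simp: V_def vtx_def edge_arc_def point_eq_iff)
  from level_eq[OF this assms] show False using assms by simp
qed

lemma chord_point: "cyl_cover (chord_lift_line t) = point (1/2) (real L * t)"
  using rn0 rL0 by (simp add: chord_lift_line_def point_def field_simps)

lemma half_odd: "real_of_int a \<noteq> 1 / 2 + real_of_int b"
proof
  assume "real_of_int a = 1 / 2 + real_of_int b"
  then have "real_of_int (2 * a) = real_of_int (1 + 2 * b)" by simp
  then have "2 * a = 1 + 2 * b" by (simp only: of_int_eq_iff)
  then show False by presburger
qed

lemma E_cases: assumes "e \<in> E" obtains l k \<epsilon> where "(l, k, \<epsilon>) \<in> IE" "e = edge_arc l k \<epsilon>" "l < L"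
proof -
  obtain x where x: "x \<in> IE" "e = (\<lambda>(l, k, \<epsilon>). edge_arc l k \<epsilon>) x" using assms by (auto simp: E_def)
  obtain l k \<epsilon> where "x = (l, k, \<epsilon>)" by (cases x) auto
  then show ?thesis using that[of l k \<epsilon>] x by (simp add: IE_def)
qed

text \<open>
  A slanted edge passes column 1/2 modulo \<open>n\<close> at most in its middle, a straight edge never.
\<close>

lemma edge_chord_finite:
  assumes "(l, k, \<epsilon>) \<in> IE"
  shows "finite (path_image (edge_arc l k \<epsilon>) \<inter> path_image (\<lambda>t. cyl_cover (chord_lift_line t)))"
proof (rule finite_subset)
  show "path_image (edge_arc l k \<epsilon>) \<inter> path_image (\<lambda>t. cyl_cover (chord_lift_line t)) \<subseteq> {edge_arc l k \<epsilon> (1/2)}"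
  proof
    fix z assume "z \<in> path_image (edge_arc l k \<epsilon>) \<inter> path_image (\<lambda>t. cyl_cover (chord_lift_line t))"
    then obtain t t' where t: "0 \<le> t" "t \<le> 1" "z = edge_arc l k \<epsilon> t" "edge_arc l k \<epsilon> t = point (1/2) (real L * t')"
      by (auto simp: path_image_def chord_point)
    then obtain m :: int where m: "1/2 = of_int k + of_int (\<epsilon> * shift l) * t + real n * of_int m"
      unfolding edge_arc_def point_eq_iff by blast
    define d where "d = \<epsilon> * shift l"
    have d: "d = 0 \<or> d = 1 \<or> d = -1" using assms layer(1)[of l] by (auto simp: IE_def d_def)
    define c where "c = k + int n * m"
    have c: "1/2 = real_of_int d * t + real_of_int c" using m by (simp add: c_def d_def)
    have "t = 1/2"
    proof -
      consider "1/2 = real_of_int c" | "t = 1/2 - real_of_int c" | "t = real_of_int c - 1/2" using d c by auto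
      then show ?thesis
      proof cases
        case 1
        then show ?thesis using half_odd[of c 0] by simp
      next
        case 2
        then have "c = 0" using t(1,2) by linarith
        then show ?thesis using 2 by simp
      next
        case 3
        then have "c = 1" using t(1,2) by linarith
        then show ?thesis using 3 by simp
      qed
    qed
    show "z \<in> {edge_arc l k \<epsilon> (1/2)}" unfolding t(3) \<open>t = 1/2\<close> by (rule singletonI)
  qed
qed simp

text \<open>
  The angles of chord, sources and sinks; the index 0 stands for the chord.
\<close>

definition angle :: "nat \<Rightarrow> real" where
  "angle k = (if k = 0 then 1 / 2 else real k) / real n"

lemma angle_mono: "strict_mono_on {0..n} angle" and angle_turn: "angle n < angle 0 + 1"
  using rn0 by (auto simp: strict_mono_on_def angle_def divide_strict_right_mono field_simps)

lemma N_graph [simp]: "verts (net_graph N) = V" "arcs (net_graph N) = E" "tail (net_graph N) = pathstart" "head (net_graph N) = pathfinish"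
  by (simp_all add: net_graph_def)

lemma edge_levels: assumes "e \<in> E" shows "pathstart e \<in> V" "pathfinish e \<in> V" "snd (pathstart e) < snd (pathfinish e)"
  "0 < snd (pathfinish e)" "snd (pathstart e) < 1"
proof -
  obtain l k \<epsilon> where e: "(l, k, \<epsilon>) \<in> IE" "e = edge_arc l k \<epsilon>" "l < L" using E_cases[OF assms] by blast
  show "pathstart e \<in> V" "pathfinish e \<in> V" using e(2,3) by (auto simp: edge_ends intro!: vtx_in_V)
  show "snd (pathstart e) < snd (pathfinish e)" "0 < snd (pathfinish e)" "snd (pathstart e) < 1"
    using e(2,3) rL0 by (simp_all add: edge_ends vtx_def point_height divide_strict_right_mono)
qed

lemma fin_digraph_N: "fin_digraph (net_graph N)"
proof
  show "finite (verts (net_graph N))" "finite (arcs (net_graph N))" by (simp_all add: V_def E_def IE_def)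
qed (use edge_levels in auto)

lemma walk_rises:
  assumes "pre_digraph.awalk (net_graph N) u p v" "p \<noteq> []" shows "snd u < snd v"
proof -
  interpret fin_digraph "net_graph N" by (rule fin_digraph_N)
  have "p \<noteq> [] \<longrightarrow> snd u < snd v" if "awalk u p v" for u
    using that
  proof (induction p arbitrary: u)
    case (Cons e p)
    then have e: "e \<in> E" "u = pathstart e" "awalk (pathfinish e) p v" by (simp_all add: awalk_Cons_iff)
    then show ?case using edge_levels(3)[OF e(1)] Cons.IH[OF e(3)]
      by (cases "p = []") (auto simp: awalk_Nil_iff)
  qed simp
  then show ?thesis using assms by blast
qed

theorem cylindric_network_N: "cylindric_network n N"
  unfolding cylindric_network_def
proof (intro conjI ballI)
  interpret fin_digraph "net_graph N" by (rule fin_digraph_N)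
  show "fin_digraph (net_graph N)" by (rule fin_digraph_N)
  show "\<nexists>p. cycle p" using walk_rises unfolding cycle_def by blast
  have "V \<subseteq> cylinder" using point_in_cylinder by (auto simp: V_def vtx_def)
  moreover have "Path_Connected.arc e \<and> path_image e \<subseteq> cylinder \<and> e ` {0<..<1} \<inter> V = {}" if "e \<in> E" for e
  proof -
    obtain l k \<epsilon> where e: "(l, k, \<epsilon>) \<in> IE" "e = edge_arc l k \<epsilon>" "l < L" using E_cases[OF \<open>e \<in> E\<close>] by blast
    then show ?thesis using edge_arc_arc[OF e(3)] edge_arc_vertex_free by auto
  qed
  moreover have "e ` {0<..<1} \<inter> f ` {0<..<1} = {}" if ef: "e \<in> E" "f \<in> E" "e \<noteq> f" for e f
  proof -
    obtain l k \<epsilon> where e: "(l, k, \<epsilon>) \<in> IE" "e = edge_arc l k \<epsilon>" using E_cases[OF ef(1)] by blast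
    obtain l' k' \<epsilon>' where f: "(l', k', \<epsilon>') \<in> IE" "f = edge_arc l' k' \<epsilon>'" using E_cases[OF ef(2)] by blast
    show ?thesis using edge_arc_disjoint[OF e(1) f(1)] ef(3) e(2) f(2) by fastforce
  qed
  ultimately show "embedded_in_cylinder (vertices N) (edges N)" by (simp add: embedded_in_cylinder_def)
  fix k assume "k \<in> {1..n}"
  show "source N k \<in> vertices N" "sink N k \<in> vertices N" by (simp_all add: vtx_in_V)
  have "in_arcs (net_graph N) (source N k) = {}"
    using edge_levels(4) by (fastforce simp: in_arcs_def vtx_def point_height)
  then show "in_degree (net_graph N) (source N k) = 0" by (simp add: in_degree_def)
  have "out_arcs (net_graph N) (sink N k) = {}"
    using edge_levels(5) rL0 by (fastforce simp: out_arcs_def vtx_def point_height)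
  then show "out_degree (net_graph N) (sink N k) = 0" by (simp add: out_degree_def)
next
  show "ccw_ordered n 0 (\<lambda>k. if k = 0 then pathstart (chord N) else source N k)"
    unfolding ccw_ordered_def using angle_mono angle_turn
    by (intro exI[of _ angle]) (simp add: pathstart_def chord_lift_line_def vtx_def point_def angle_def)
  show "ccw_ordered n 1 (\<lambda>k. if k = 0 then pathfinish (chord N) else sink N k)"
    unfolding ccw_ordered_def using angle_mono angle_turn rL0
    by (intro exI[of _ angle]) (simp add: pathfinish_def chord_lift_line_def vtx_def point_def angle_def)
  show "weight N e \<ge> 0" if eN: "e \<in> edges N" for e
  proof -
    have "e \<in> E" using eN by simp
    then obtain l k \<epsilon> where e: "(l, k, \<epsilon>) \<in> IE" "e = edge_arc l k \<epsilon>" "l < L" by (rule E_cases)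
    then show ?thesis using layer(2,3)[OF e(3)] by (simp add: edge_weight)
  qed
  have "continuous_on {0..1} (chord N)"
    unfolding N_simps chord_lift_line_def Complex_eq by (intro continuous_on_cyl_cover continuous_intros)
  moreover have "inj_on (chord N) {0..1}"
    using rL0 by (intro inj_onI) (simp add: chord_point point_eq_iff)
  ultimately show "Path_Connected.arc (chord N)" by (simp add: arc_def path_def)
  show "chord N ` {0<..<1} \<subseteq> sphere 0 1 \<times> {0<..<1}"
    by (auto simp: cyl_cover_def chord_lift_line_def)
  show "path_image (chord N) \<inter> vertices N = {}"
  proof -
    have "point (1/2) y \<noteq> vtx l k" for y l k
    proof
      assume "point (1/2) y = vtx l k"
      then obtain m :: int where "real_of_int k = 1/2 + real n * of_int m" unfolding vtx_def point_eq_iff by blast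
      then show False using half_odd[of k "int n * m"] by simp
    qed
    note off = this
    show ?thesis by (auto simp: path_image_def chord_point V_def off off[symmetric])
  qed
  show "finite (path_image e \<inter> path_image (chord N))" if eN: "e \<in> edges N" for e
  proof -
    have "e \<in> E" using eN by simp
    then obtain l k \<epsilon> where e: "(l, k, \<epsilon>) \<in> IE" "e = edge_arc l k \<epsilon>" by (rule E_cases)
    show ?thesis using edge_chord_finite[OF e(1)] by (simp add: e(2))
  qed
qed

text \<open>
  Column \<open>k\<close> lies to the east of column \<open>1/2 + n i\<close> if and only if \<open>i \<le> alpha n k\<close>.
\<close>

lemma vertical_chord_sheet:
  assumes "chord_lift h chord_lift_line" "0 \<le> y" "y \<le> 1"
  shows "chord_lift.sheet chord_lift_line (Complex (of_int k / real n) y) = alpha n k"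
proof -
  interpret chord_lift h chord_lift_line by fact
  let ?z = "Complex (of_int k / real n) y"
  have zs: "?z \<in> strip" using assms by (simp add: strip_def)
  have line: "Re w = 1 / (2 * real n) + of_int i" if "w \<in> path_image (Hk i)" for w i
    using that by (auto simp: path_image_def chord_lift_line_def)
  have half: "of_int k / real n > 1 / (2 * real n) + of_int i \<longleftrightarrow> i \<le> alpha n k"
    "of_int k / real n < 1 / (2 * real n) + of_int i \<longleftrightarrow> \<not> i \<le> alpha n k" for i
  proof -
    have "1 / (2 * real n) + of_int i = (1 + 2 * real n * of_int i) / (2 * real n)"
      "of_int k / real n = 2 * real_of_int k / (2 * real n)"
      using rn0 by (simp_all add: add_divide_distrib)
    then have "of_int k / real n > 1 / (2 * real n) + of_int i \<longleftrightarrow> 2 * real_of_int k > 1 + 2 * real n * of_int i"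
      "of_int k / real n < 1 / (2 * real n) + of_int i \<longleftrightarrow> 2 * real_of_int k < 1 + 2 * real n * of_int i"
      using rn0 by (simp_all only: divide_less_cancel) auto
    moreover have "1 + 2 * real n * of_int i = real_of_int (1 + 2 * (int n * i))" by simp
    then have "2 * real_of_int k > 1 + 2 * real n * of_int i \<longleftrightarrow> 2 * k > 1 + 2 * (int n * i)"
      "2 * real_of_int k < 1 + 2 * real n * of_int i \<longleftrightarrow> 2 * k < 1 + 2 * (int n * i)"
      by (metis of_int_less_iff of_int_mult of_int_numeral)+
    moreover have "2 * k > 1 + 2 * (int n * i) \<longleftrightarrow> i \<le> alpha n k"
    proof
      assume "2 * k > 1 + 2 * (int n * i)"
      then have "int n * i < res n k + int n * alpha n k" using alpha_eq[OF n, of k] by linarith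
      then have "int n * i < int n * (alpha n k + 1)" using res_bounds(2)[of k] by (simp add: algebra_simps)
      then show "i \<le> alpha n k" by (simp add: mult_less_cancel_left)
    next
      assume "i \<le> alpha n k"
      then have "int n * i \<le> int n * alpha n k" by (simp add: mult_left_mono)
      then show "2 * k > 1 + 2 * (int n * i)" using alpha_eq[OF n, of k] res_bounds(1)[of k] by linarith
    qed
    moreover have "2 * k < 1 + 2 * (int n * i) \<longleftrightarrow> \<not> 2 * k > 1 + 2 * (int n * i)" by presburger
    ultimately show "of_int k / real n > 1 / (2 * real n) + of_int i \<longleftrightarrow> i \<le> alpha n k"
      "of_int k / real n < 1 / (2 * real n) + of_int i \<longleftrightarrow> \<not> i \<le> alpha n k" by blast+
  qed
  have "?z \<in> east_of (Hk i) \<longleftrightarrow> i \<le> alpha n k" for i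
  proof
    assume "i \<le> alpha n k"
    then have "Re ?z > 1 / (2 * real n) + of_int i" using half(1)[of i] by simp
    then show "?z \<in> east_of (Hk i)" using line[of "Complex _ (Im ?z)" i] by (intro ray_east_of[OF zs]) fastforce
  next
    assume E: "?z \<in> east_of (Hk i)"
    show "i \<le> alpha n k"
    proof (rule ccontr)
      assume "\<not> i \<le> alpha n k"
      then have "Re ?z < 1 / (2 * real n) + of_int i" using half(2)[of i] by simp
      then have "?z \<in> west_of (Hk i)" using line[of "Complex _ (Im ?z)" i] by (intro ray_west_of[OF zs]) fastforce
      then show False using E not_east_and_west by blast
    qed
  qed
  then show ?thesis by (rule sheet_eqI[OF zs])
qed

lemma lifted_network_N: "lifted_network N chord_lift_line n angle angle"
proof
  have "path chord_lift_line"
    unfolding path_def chord_lift_line_def Complex_eq by (intro continuous_intros)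
  then show "is_lift chord_lift_line (chord N)"
    by (auto simp: is_lift_def path_image_def chord_lift_line_def strip_def)
  show "source N k = cyl_cover (Complex (angle k) 0)" if "k \<in> {1..n}" for k
    using that by (simp add: vtx_def point_def angle_def)
  show "sink N k = cyl_cover (Complex (angle k) 1)" if "k \<in> {1..n}" for k
    using that rL0 by (simp add: vtx_def point_def angle_def)
qed (use cylindric_network_N n angle_mono angle_turn in
  \<open>auto simp: cylindric_network_def cyl_cover_def chord_lift_line_def angle_def simp del: N_simps(1-5)\<close>)

text \<open>
  Let \<open>vx l k\<close> be the vertex of the universal cover at level \<open>l\<close> in column \<open>k\<close>. Its two edges lead to
  \<open>vx (l + 1) k\<close> and \<open>vx (l + 1) (k + shift l)\<close>, so the recursion for path sums is the
  multiplication by the layer \<open>l\<close>, and downward induction on the level gives the product.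
\<close>

theorem network_matrix_N: "network_matrix n N = layers_prod Ls"
proof -
  interpret M: lifted_network N chord_lift_line n angle angle by (rule lifted_network_N)
  define vx where "vx l k = (vtx l k, alpha n k)" for l k
  have vx_eq: "vx L k = vx L j \<longleftrightarrow> k = j" for k j
  proof
    assume "vx L k = vx L j"
    then obtain m where "j = k + int n * m" "alpha n k = alpha n j" by (auto simp: vx_def vtx_eq_iff)
    then show "k = j" using alpha_add[OF n, of k m] by simp
  qed simp
  have rotor: "M.rotor (edge_arc l k \<epsilon>) = alpha n (k + \<epsilon> * shift l) - alpha n k" if "(l, k, \<epsilon>) \<in> IE" for l k \<epsilon>
  proof -
    have l: "l < L" using that by (simp add: IE_def)
    have "edge_arc l k \<epsilon> \<in> edges N" using that by (force simp: E_def)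
    then have "M.rotor (edge_arc l k \<epsilon>) = M.sheet (edge_lift l k \<epsilon> 1) - M.sheet (edge_lift l k \<epsilon> 0)"
      by (rule M.rotor_eqI[OF _ edge_lift_is_lift[OF l]])
    also have "edge_lift l k \<epsilon> 1 = Complex (of_int (k + \<epsilon> * shift l) / real n) ((real l + 1) / real L)"
      by (simp add: edge_lift_def)
    also have "edge_lift l k \<epsilon> 0 = Complex (of_int k / real n) (real l / real L)"
      by (simp add: edge_lift_def)
    also have "M.sheet (Complex (of_int (k + \<epsilon> * shift l) / real n) ((real l + 1) / real L)) = alpha n (k + \<epsilon> * shift l)"
    proof (rule vertical_chord_sheet[OF M.chord_lift_axioms])
      have "real l + 1 \<le> real L" using l by linarith
      then show "(real l + 1) / real L \<le> 1" using rL0 by simp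
    qed simp
    also have "M.sheet (Complex (of_int k / real n) (real l / real L)) = alpha n k"
      by (rule vertical_chord_sheet[OF M.chord_lift_axioms]) (use l rL0 in \<open>simp_all add: divide_le_eq\<close>)
    finally show ?thesis .
  qed
  have out: "M.out (vx l k) = {edge_arc l (res n k) 0, edge_arc l (res n k) 1}" if l: "l < L" for l k
  proof (rule equalityI; rule subsetI)
    fix e assume "e \<in> M.out (vx l k)"
    then have e: "e \<in> E" "pathstart e = vtx l k" by (auto simp: M.out_def vx_def)
    then obtain l' k' \<epsilon> where ie: "(l', k', \<epsilon>) \<in> IE" "e = edge_arc l' k' \<epsilon>" using E_cases by metis
    then obtain m where "l' = l" "k = k' + int n * m" using e(2) by (auto simp: edge_ends vtx_eq_iff)
    moreover have "1 \<le> k'" "k' \<le> int n" "\<epsilon> = 0 \<or> \<epsilon> = 1" using ie by (auto simp: IE_def)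
    ultimately have "k' = res n k" using res_id[of k' n] res_add[of n k' m] by simp
    then show "e \<in> {edge_arc l (res n k) 0, edge_arc l (res n k) 1}"
      using ie(2) \<open>l' = l\<close> \<open>\<epsilon> = 0 \<or> \<epsilon> = 1\<close> by auto
  next
    fix e assume "e \<in> {edge_arc l (res n k) 0, edge_arc l (res n k) 1}"
    then obtain \<epsilon> where e: "e = edge_arc l (res n k) \<epsilon>" "\<epsilon> = 0 \<or> \<epsilon> = 1" by auto
    then have "(l, res n k, \<epsilon>) \<in> IE" using l res_bounds[of k] by (auto simp: IE_def)
    then have "e \<in> E" using e(1) by (force simp: E_def)
    then show "e \<in> M.out (vx l k)" using e(1) by (simp add: M.out_def vx_def edge_ends vtx_res)
  qed
  have nxt: "M.nxt (vx l k) (edge_arc l (res n k) \<epsilon>) = vx (Suc l) (k + \<epsilon> * shift l)"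
    if "(l, res n k, \<epsilon>) \<in> IE" for l k \<epsilon>
  proof -
    let ?s = "\<epsilon> * shift l"
    have k: "k + ?s = (res n k + ?s) + int n * alpha n k" using alpha_eq[OF n, of k] by simp
    have "alpha n (res n k) = 0" using res_id[OF res_bounds(1,2)] by (simp add: alpha_def)
    moreover have "vtx (Suc l) (k + ?s) = vtx (Suc l) (res n k + ?s)" by (simp only: k vtx_add)
    moreover have "alpha n (k + ?s) = alpha n (res n k + ?s) + alpha n k" by (simp only: k alpha_add[OF n])
    ultimately show ?thesis unfolding M.nxt_def vx_def rotor[OF that] edge_ends by simp
  qed
  have sum: "M.walk_sum (vx l k) (vx L j) = layers_prod (drop l Ls) k j" if "l \<le> L" for l k j
    using that
  proof (induction l arbitrary: k rule: inc_induct)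
    case base
    have "M.out (vx L k) = {}"
      using edge_levels(5) rL0 by (fastforce simp: M.out_def vx_def vtx_def point_height)
    then show ?case using M.walk_sum_rec[of "vx L k" "vx L j"] by (simp add: vx_eq layers_prod_def)
  next
    case (step l)
    have ie: "(l, res n k, 0) \<in> IE" "(l, res n k, 1) \<in> IE" using step.hyps res_bounds[of k] by (auto simp: IE_def)
    have ne: "edge_arc l (res n k) 0 \<noteq> edge_arc l (res n k) 1"
      using inj_onD[OF edge_arc_inj, of "(l, res n k, 0)" "(l, res n k, 1)"] ie by auto
    have "vx l k \<noteq> vx L j" using step.hyps by (simp add: vx_def vtx_eq_iff)
    then have "M.walk_sum (vx l k) (vx L j) = straight l k * M.walk_sum (vx (Suc l) k) (vx L j)
        + slanted l k * M.walk_sum (vx (Suc l) (k + shift l)) (vx L j)"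
      using M.walk_sum_rec[of "vx l k" "vx L j"] ne nxt[OF ie(1)] nxt[OF ie(2)] edge_weight[OF ie(1)] edge_weight[OF ie(2)]
        layer(4,5)[OF step.hyps(2), of k]
      by (simp add: out[OF step.hyps(2)])
    also have "\<dots> = layer_mult (Ls ! l) (layers_prod (drop (Suc l) Ls)) k j"
      using step.IH by (subst layer(6)[OF step.hyps(2)]) simp
    also have "\<dots> = layers_prod (drop l Ls) k j"
      using Cons_nth_drop_Suc[OF step.hyps(2)] by (metis foldr_Cons layers_prod_def o_apply)
    finally show ?case .
  qed
  show ?thesis
  proof (intro ext)
    fix i j
    have "M.src i = vx 0 i" "M.snk j = vx L j"
      using res_bounds(1)[of i] res_bounds(1)[of j] by (simp_all add: M.src_def M.snk_def vx_def vtx_res)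
    then show "network_matrix n N i j = layers_prod Ls i j"
      using sum[of 0 i j] by (simp add: M.network_matrix_walk_sum)
  qed
qed

end

text \<open>
  At least one layer is needed to get from the bottom to the top of the cylinder, so an identity
  layer is added.
\<close>

theorem layers_prod_is_network_matrix:
  assumes "n \<ge> 1" "\<forall>l\<in>set Ls. layer_ok n l"
  shows "\<exists>N. cylindric_network n N \<and> layers_prod Ls = network_matrix n N"
proof -
  let ?Ls = "(1, \<lambda>_. 1, \<lambda>_. 0) # Ls"
  interpret layer_stack n ?Ls
    using assms by unfold_locales (auto simp: layer_ok_def)
  have "layers_prod ?Ls = layers_prod Ls" by (simp add: layers_prod_def)
  then show ?thesis using cylindric_network_N network_matrix_N by metis
qed

section \<open>Networks and totally nonnegative loops\<close>

theorem theorem3p4: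
  fixes n :: nat and A :: "real fls mat"
  assumes "n \<ge> 1" and "A \<in> GL_laurent n"
  shows "(\<exists>N. cylindric_network n N \<and> unfold_mat n A = network_matrix n N)
           \<longleftrightarrow> totally_nonneg (unfold_mat n A)"
proof
  assume "\<exists>N. cylindric_network n N \<and> unfold_mat n A = network_matrix n N"
  then obtain N where N: "cylindric_network n N" "unfold_mat n A = network_matrix n N" by blast
  obtain H \<theta> \<phi> where "lifted_network N H n \<theta> \<phi>" using lifted_network_exists[OF assms(1) N(1)] by blast
  then show "totally_nonneg (unfold_mat n A)"
    unfolding N(2) by (rule lifted_network.network_totally_nonneg)
next
  assume "totally_nonneg (unfold_mat n A)"
  then show "\<exists>N. cylindric_network n N \<and> unfold_mat n A = network_matrix n N"
    using totally_nonneg_factorization[OF assms] layers_prod_is_network_matrix[OF assms(1)] by metis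
qed

end
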